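(* Let $b \in L^1_{loc}[0,\infty)$ be real-valued and suppose that $$b(x) = \frac{-1+\epsilon(x)}{x} + \eta(x), \qquad x \ge 1,$$ where $\lim_{x\to\infty}\epsilon(x) = 0$ and $\eta \in L^1_{loc}[0,\infty)$ is such that the limit $A := \lim_{x\to\infty}\int_1^x \eta(u)\,du$ exists in $\mathbf{R}$ (this is the case $\rho = 0$). Put $$W(x) := \exp\left(\int_1^x b(u)\,du\right), \qquad m(x) := 2\int_0^x W(u)\,du,$$ and let $p(t;x,y)$ be the transition probability density, with respect to the speed measure $m(dx) = 2W(x)\,dx$, of the diffusion process on $[0,\infty)$ with generator $$\mathcal{L} = \frac12\left(\frac{d^2}{dx^2} + b(x)\frac{d}{dx}\right)$$ and reflecting boundary condition at $0$. If $m_\infty := \lim_{x\to\infty} m(x) < \infty$, then $$p(t;0,0) - \frac{1}{m_\infty} \sim \frac{1}{m_\infty^2}\left(m_\infty - m(\sqrt{t})\right), \qquad t \to \infty.$$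
   Context: Notation: $f \sim g$ means $\lim f/g = 1$. $L^1_{loc}[0,\infty)$ denotes functions integrable on every bounded interval $[0,R]$, so the left boundary $0$ is regular, and the reflecting boundary condition is imposed there. With $s(x) = \int_c^x \frac{du}{W(u)}$ the scale function, the generator has the canonical form $\mathcal{L} = \frac{d}{dm(x)}\frac{d}{ds(x)}$. The transition density $p(t;x,y)$ is taken with respect to $m(dx)$, i.e. $P_x(X_t \in dy) = p(t;x,y)\,m(dy)$, in its continuous version in $(x,y)$. It satisfies $p(t;0,0) = \int_{[0,\infty)} e^{-\lambda t}\,d\sigma(\lambda)$ for $t>0$, where $\sigma$ is the spectral function of the diffusion. *)

theory Defs
  imports "HOL-Probability.Probability" "HOL-Library.Landau_Symbols"
begin

section \<open>Weight, scale function and speed measure\<close>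

text \<open>
  All integrals of the drift are taken with respect to \<^const>\<open>lebesgue\<close>, so that a locally
  integrable \<open>b\<close> need not be Borel. The integrals \<open>LINT u=a..x\<close> are signed, i.e. they change
  sign when \<open>x < a\<close>.
\<close>

definition loc_integrable :: "(real \<Rightarrow> real) \<Rightarrow> bool" where
  "loc_integrable f \<longleftrightarrow> (\<forall>R. set_integrable lebesgue {0..R} f)"

definition weight :: "(real \<Rightarrow> real) \<Rightarrow> real \<Rightarrow> real" where
  "weight b x = exp (LINT u=1..x|lebesgue. b u)"

text \<open>The base point of the scale function is immaterial; it is chosen to be \<open>1\<close>.\<close>

definition scale_fun :: "(real \<Rightarrow> real) \<Rightarrow> real \<Rightarrow> real" where
  "scale_fun b x = (LINT u=1..x|lebesgue. (1 / weight b u))"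

definition speed_fun :: "(real \<Rightarrow> real) \<Rightarrow> real \<Rightarrow> real" where
  "speed_fun b x = 2 * (LINT u=0..x|lebesgue. weight b u)"

definition half_line :: "real measure" where
  "half_line = restrict_space borel {0..}"

definition speed_measure :: "(real \<Rightarrow> real) \<Rightarrow> real measure" where
  "speed_measure b = density (restrict_space lborel {0..}) (\<lambda>x. ennreal (2 * weight b x))"


section \<open>The operator d/dm d/ds with reflecting boundary condition\<close>

text \<open>\<open>has_deriv_wrt f u D x\<close>: the derivative \<open>df/du\<close> on \<open>[0,\<infinity>)\<close> exists at \<open>x\<close> and
  equals \<open>D\<close> (one-sided at \<open>0\<close>).\<close>

definition has_deriv_wrt :: "(real \<Rightarrow> real) \<Rightarrow> (real \<Rightarrow> real) \<Rightarrow> real \<Rightarrow> real \<Rightarrow> bool" where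
  "has_deriv_wrt f u D x \<longleftrightarrow>
     ((\<lambda>y. (f y - f x) / (u y - u x)) \<longlongrightarrow> D) (at x within {0..})"

text \<open>
  \<open>reflecting_L b f g\<close>: \<open>L f = g\<close> on \<open>[0,\<infinity>)\<close>, where \<open>L = d/dm d/ds\<close>, and \<open>df/ds (0) = 0\<close>.
  Since \<open>df/ds = W f'\<close> and \<open>dm = 2 W dx\<close>, one has \<open>L f = (W f')' / (2 W) = (f'' + b f') / 2\<close>.
\<close>

definition reflecting_L ::
  "(real \<Rightarrow> real) \<Rightarrow> (real \<Rightarrow> real) \<Rightarrow> (real \<Rightarrow> real) \<Rightarrow> bool" where
  "reflecting_L b f g \<longleftrightarrow>
     (\<exists>h. (\<forall>x\<ge>0. has_deriv_wrt f (scale_fun b) (h x) x) \<and>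
          (\<forall>x\<ge>0. has_deriv_wrt h (speed_fun b) (g x) x) \<and>
          h 0 = 0)"


section \<open>Continuous Markov processes on the half-line and their generators\<close>

definition natural_sigma :: "'w measure \<Rightarrow> (real \<Rightarrow> 'w \<Rightarrow> real) \<Rightarrow> real \<Rightarrow> 'w measure" where
  "natural_sigma \<Omega> X s =
     sigma (space \<Omega>) (\<Union>u\<in>{0..s}. {X u -` A \<inter> space \<Omega> | A. A \<in> sets half_line})"

definition transition_op ::
  "(real \<Rightarrow> 'w measure) \<Rightarrow> (real \<Rightarrow> 'w \<Rightarrow> real) \<Rightarrow> real \<Rightarrow> (real \<Rightarrow> real) \<Rightarrow> real \<Rightarrow> real" where
  "transition_op P X t f x = (\<integral>\<omega>. f (X t \<omega>) \<partial>P x)"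

text \<open>
  \<open>\<Omega>\<close> only carries the sample space and its sigma-algebra; the law of the process started at
  \<open>x\<close> is \<open>P x\<close>.
\<close>

locale continuous_markov_process =
  fixes \<Omega> :: "'w measure" and P :: "real \<Rightarrow> 'w measure" and X :: "real \<Rightarrow> 'w \<Rightarrow> real"
  assumes kernel: "P \<in> half_line \<rightarrow>\<^sub>M prob_algebra \<Omega>"
    and measurable_X: "\<And>t. t \<ge> 0 \<Longrightarrow> X t \<in> \<Omega> \<rightarrow>\<^sub>M half_line"
    and continuous_paths: "\<And>\<omega>. \<omega> \<in> space \<Omega> \<Longrightarrow> continuous_on {0..} (\<lambda>t. X t \<omega>)"
    and start: "\<And>x. x \<ge> 0 \<Longrightarrow> AE \<omega> in P x. X 0 \<omega> = x"
    and markov: "\<And>x s t f. x \<ge> 0 \<Longrightarrow> s \<ge> 0 \<Longrightarrow> t \<ge> 0 \<Longrightarrow>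
      f \<in> borel_measurable half_line \<Longrightarrow> bounded (f ` {0..}) \<Longrightarrow>
      AE \<omega> in P x. real_cond_exp (P x) (natural_sigma \<Omega> X s) (\<lambda>\<omega>. f (X (s + t) \<omega>)) \<omega>
        = transition_op P X t f (X s \<omega>)"

text \<open>Membership in \<open>C\<^sub>0 [0,\<infinity>)\<close>; the values on the negative half-line are irrelevant.\<close>

definition C0 :: "(real \<Rightarrow> real) \<Rightarrow> bool" where
  "C0 f \<longleftrightarrow> continuous_on {0..} f \<and> (f \<longlongrightarrow> 0) at_top"

definition generator ::
  "(real \<Rightarrow> 'w measure) \<Rightarrow> (real \<Rightarrow> 'w \<Rightarrow> real) \<Rightarrow> (real \<Rightarrow> real) \<Rightarrow> (real \<Rightarrow> real) \<Rightarrow> bool" where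
  "generator P X f g \<longleftrightarrow> C0 f \<and> C0 g \<and>
     uniform_limit {0..} (\<lambda>t x. (transition_op P X t f x - f x) / t) g (at_right 0)"

text \<open>
  The diffusion on \<open>[0,\<infinity>)\<close> with generator \<open>L = (d\<^sup>2/dx\<^sup>2 + b d/dx) / 2\<close>, reflected at \<open>0\<close>.
  The locale is meant for drifts for which the boundary \<open>\<infinity>\<close> is natural in Feller's
  classification, as is the case when \<open>b(x) = (-1 + o(1)) / x + \<eta>(x)\<close> with \<open>\<integral>\<^sub>1\<^sup>\<infinity> \<eta>\<close>
  convergent. Then no boundary condition at infinity is needed: the transition semigroup is a
  Feller semigroup on \<open>C\<^sub>0 [0,\<infinity>)\<close>, and the domain of its generator consists of all
  \<open>f \<in> C\<^sub>0\<close> with \<open>L f \<in> C\<^sub>0\<close> and \<open>df/ds (0) = 0\<close>.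
\<close>

locale reflecting_diffusion = continuous_markov_process \<Omega> P X
  for b :: "real \<Rightarrow> real" and \<Omega> :: "'w measure" and P X +
  assumes feller: "\<And>t f. t \<ge> 0 \<Longrightarrow> C0 f \<Longrightarrow> C0 (transition_op P X t f)"
    and generator_eq: "\<And>f g. generator P X f g \<longleftrightarrow> C0 f \<and> C0 g \<and> reflecting_L b f g"

text \<open>\<open>P\<^sub>x (X\<^sub>t \<in> dy) = p(t;x,y) m(dy)\<close> with \<open>p(t;\<cdot>,\<cdot>)\<close> continuous.\<close>

definition transition_density ::
  "(real \<Rightarrow> real) \<Rightarrow> (real \<Rightarrow> 'w measure) \<Rightarrow> (real \<Rightarrow> 'w \<Rightarrow> real) \<Rightarrow>
     (real \<Rightarrow> real \<Rightarrow> real \<Rightarrow> real) \<Rightarrow> bool" where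
  "transition_density b P X p \<longleftrightarrow> (\<forall>t>0.
     continuous_on ({0..} \<times> {0..}) (\<lambda>(x, y). p t x y) \<and>
     (\<forall>x\<ge>0. \<forall>y\<ge>0. p t x y \<ge> 0) \<and>
     (\<forall>x\<ge>0. distr (P x) half_line (X t) = density (speed_measure b) (\<lambda>y. ennreal (p t x y))))"

end

theory Submission
  imports Defs
begin

text \<open>
  Let \<open>T(x) = m_inf - m(x)\<close>, let \<open>\<phi> \<ge> 0\<close> be an element of the domain of the generator that lives
  near \<open>0\<close> and has \<open>m\<close>-integral \<open>1\<close>, and put \<open>q(t) = \<langle>\<phi>, P\<^sub>t \<phi>\<rangle>\<close> in \<open>L\<^sup>2(m)\<close>. By Green's formula the
  semigroup is symmetric, conservative and dissipative on its domain, so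
  \<open>q(t) = \<parallel>P\<^bsub>t/2\<^esub> \<phi>\<parallel>\<^sup>2\<close> decreases in \<open>t\<close> and \<open>q(t) \<ge> 1/m_inf\<close>; no spectral theory is needed. The Laplace
  transform of \<open>q\<close> at \<open>s\<close> is \<open>\<langle>\<phi>, f\<rangle>\<close> with \<open>f = (s - L)\<^sup>-\<^sup>1 \<phi>\<close>, and \<open>\<integral> f dm = 1/s\<close>. As \<open>\<phi>\<close> concentrates
  at \<open>0\<close>, this gives \<open>f(0) m_inf - 1/s = \<integral> (f(0) - f) dm\<close>. The function \<open>f\<close> is close to \<open>f(0)\<close> for
  \<open>x\<close> far below \<open>1/\<surd>s\<close> and close to \<open>0\<close> far above, while \<open>T\<close> varies slowly; hence the right-hand side
  is \<open>f(0) T(1/\<surd>s)\<close> up to a factor tending to \<open>1\<close>. A Tauberian theorem for monotone functions transfers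
  this to \<open>q(t) - 1/m_inf\<close>, and \<open>q(t)\<close> tends to \<open>p(t;0,0)\<close> as \<open>\<phi>\<close> shrinks to \<open>0\<close>.
\<close>

section \<open>A finite Tauberian theorem\<close>

text \<open>The constant comes from solving \<open>f(0) * m_inf - 1/s = f(0) * T\<close> for
  \<open>f(0)\<close>: \<open>s * f(0) = 1 / (m_inf - T)\<close>, and
  \<open>1 / (m_inf - T) - 1 / m_inf\<close> is asymptotic to \<open>T / m_inf^2\<close> because T
  tends to 0. The scale \<open>1/sqrt s\<close> appears because the upper bound for the deficit and
  the decay estimate for f depend on s and the cut-off R through \<open>s * R^2\<close>.

  The obstacle is the order of limits. The integrated identities hold for \<open>\<phi>\<close> in
  the domain of the generator, not for a point mass, and the error made by spreading the mass has to
  be small compared with \<open>T(1/sqrt s)\<close>, which itself tends to 0. Hence s is fixed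
  before the support of \<open>\<phi>\<close> shrinks, the estimates away from the source are
  uniform over supports inside \<open>[0,1]\<close>, and the Tauberian step must draw its conclusion
  from approximate information at a single scale s instead of a limit.\<close>

definition exp_law :: "real measure" where
  "exp_law = density lborel (\<lambda>u. ennreal (exponential_density 1 u))"

lemma sets_exp_law [measurable_cong, simp]: "sets exp_law = sets borel"
  by (simp add: exp_law_def)

lemma space_exp_law [simp]: "space exp_law = UNIV"
  by (simp add: exp_law_def)

interpretation exp_law: prob_space exp_law
  unfolding exp_law_def by (rule prob_space_exponential_density) simp

lemma AE_exp_law_nonneg: "AE u in exp_law. u \<ge> 0"
  unfolding exp_law_def by (subst AE_density) (auto simp: exponential_density_def)

lemma integral_exp_law:
  assumes "f \<in> borel_measurable borel"
  shows "(\<integral>u. f u \<partial>exp_law) = (\<integral>u. exponential_density 1 u * f u \<partial>lborel)"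
  unfolding exp_law_def using assms
  by (subst integral_density) (auto simp: exponential_density_def)

text \<open>Multiplied by \<open>k + 1\<close>, the integrand times the density is the exponential
  density of rate \<open>k + 1\<close>, which has mass one.\<close>

lemma exp_law_moment: "(\<integral>u. exp (- (real k * u)) \<partial>exp_law) = 1 / (real k + 1)"
proof -
  let ?l = "real k + 1"
  have pos: "0 \<le> exponential_density ?l u" for u
    by (simp add: exponential_density_def)
  interpret D: prob_space "density lborel (\<lambda>u. ennreal (exponential_density ?l u))"
    by (rule prob_space_exponential_density) simp
  have "1 = (\<integral>u. (1 :: real) \<partial>density lborel (\<lambda>u. ennreal (exponential_density ?l u)))"
    using D.prob_space by simp
  also have "\<dots> = (\<integral>u. exponential_density ?l u \<partial>lborel)"
    using pos by (subst integral_density) auto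
  also have "\<dots> = (\<integral>u. ?l * (exponential_density 1 u * exp (- (real k * u))) \<partial>lborel)"
    by (rule Bochner_Integration.integral_cong)
       (auto simp: exponential_density_def algebra_simps mult_exp_exp)
  also have "\<dots> = ?l * (\<integral>u. exponential_density 1 u * exp (- (real k * u)) \<partial>lborel)"
    by simp
  also have "\<dots> = ?l * (\<integral>u. exp (- (real k * u)) \<partial>exp_law)"
    by (subst integral_exp_law) auto
  finally show ?thesis by (simp add: field_simps)
qed

lemma integrable_exp_law:
  fixes f :: "real \<Rightarrow> real"
  assumes "f \<in> borel_measurable borel" and "\<And>u. u \<ge> 0 \<Longrightarrow> \<bar>f u\<bar> \<le> B"
  shows "integrable exp_law f"
  by (rule exp_law.integrable_const_bound[where B=B])
     (use assms AE_exp_law_nonneg in \<open>auto elim!: eventually_mono simp: measurable_def\<close>)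

lemma integrable_exp_law_mult:
  fixes f r :: "real \<Rightarrow> real"
  assumes "f \<in> borel_measurable borel" "r \<in> borel_measurable borel"
    and f: "\<And>u. u \<ge> 0 \<Longrightarrow> \<bar>f u\<bar> \<le> B" and r: "\<And>u. u \<ge> 0 \<Longrightarrow> 0 \<le> r u \<and> r u \<le> C"
  shows "integrable exp_law (\<lambda>u. f u * r u)"
proof (rule integrable_exp_law)
  fix u :: real assume u: "u \<ge> 0"
  have "0 \<le> B" using f[of 0] by linarith
  then show "\<bar>f u * r u\<bar> \<le> B * C"
    unfolding abs_mult using f[OF u] r[OF u] by (intro mult_mono) auto
qed (use assms in simp)

text \<open>The integrals are Laplace transforms of \<open>r\<close> at the points
  \<open>k + 1\<close>, and \<open>1 / (k + 1)\<close> is the transform of the constant 1 there.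
  Monotonicity is included because it is the Tauberian condition.\<close>

definition laplace_close :: "nat \<Rightarrow> real \<Rightarrow> (real \<Rightarrow> real) \<Rightarrow> bool" where
  "laplace_close N \<delta> r \<longleftrightarrow> r \<in> borel_measurable borel \<and> (\<forall>u\<ge>0. 0 \<le> r u) \<and>
     (\<forall>u v. 0 \<le> u \<longrightarrow> u \<le> v \<longrightarrow> r v \<le> r u) \<and>
     (\<forall>k\<le>N. \<bar>(\<integral>u. exp (- (real k * u)) * r u \<partial>exp_law) - 1 / (real k + 1)\<bar> \<le> \<delta>)"

lemma laplace_close_mono: "laplace_close N \<delta> r \<Longrightarrow> N' \<le> N \<Longrightarrow> \<delta> \<le> \<delta>' \<Longrightarrow> laplace_close N' \<delta>' r"
  unfolding laplace_close_def by (meson order.trans)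

text \<open>Karamata's argument: Weierstrass replaces \<open>F\<close> by a polynomial
  \<open>P\<close> on [0,1], and the integral of \<open>P (exp (- u)) * r u\<close> is a combination
  of finitely many of the controlled transforms. Degree and coefficients of \<open>P\<close> fix
  \<open>N\<close> and \<open>\<delta>\<close> before \<open>r\<close> is chosen, whence the
  uniformity in \<open>r\<close>.\<close>

lemma exp_law_approx:
  fixes F :: "real \<Rightarrow> real"
  assumes F: "continuous_on UNIV F" and \<theta>: "\<theta> > 0"
  obtains \<delta> N where "\<delta> > 0"
    and "\<And>r. laplace_close N \<delta> r \<Longrightarrow>
      \<bar>(\<integral>u. F (exp (- u)) * r u \<partial>exp_law) - (\<integral>u. F (exp (- u)) \<partial>exp_law)\<bar> \<le> \<theta>"
proof -
  have \<theta>4: "\<theta> / 4 > 0" using \<theta> by simp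
  obtain P where P: "real_polynomial_function P" and FP: "\<And>x. x \<in> {0..1} \<Longrightarrow> \<bar>F x - P x\<bar> < \<theta> / 4"
    using Stone_Weierstrass_real_polynomial_function[of "{0..1::real}" F, OF _ _ \<theta>4]
      continuous_on_subset[OF F] by (metis compact_Icc subset_UNIV)
  obtain c N where Pc: "P = (\<lambda>x. \<Sum>i\<le>N. c i * x ^ i)"
    using P real_polynomial_function_iff_sum by metis
  define S where "S = (\<Sum>i\<le>N. \<bar>c i\<bar>)"
  have S0: "S \<ge> 0" by (simp add: S_def sum_nonneg)
  \<comment> \<open>\<open>\<delta> * S \<le> \<theta> / 4\<close> controls the polynomial part;
    \<open>\<delta> \<le> 1\<close> bounds the integral of \<open>r\<close> by 2 through the case
    \<open>k = 0\<close>, which controls the replacement of \<open>F\<close> by \<open>P\<close>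
    under the weight \<open>r\<close>.\<close>
  define \<delta> where "\<delta> = min 1 (\<theta> / (4 * (1 + S)))"
  have \<delta>: "\<delta> > 0" "\<delta> \<le> 1" using S0 \<theta> by (auto simp: \<delta>_def)
  have "\<delta> * S \<le> \<theta> / (4 * (1 + S)) * S"
    using S0 by (intro mult_right_mono) (auto simp: \<delta>_def)
  also have "\<dots> \<le> \<theta> / 4" using S0 \<theta> by (simp add: field_simps)
  finally have \<delta>S: "\<delta> * S \<le> \<theta> / 4" .
  have [measurable]: "F \<in> borel_measurable borel" "P \<in> borel_measurable borel"
    using F unfolding Pc by (auto intro!: borel_measurable_continuous_onI borel_measurable_sum)
  have "bounded (F ` {0..1})"
    by (intro compact_imp_bounded compact_continuous_image continuous_on_subset[OF F]) auto
  then obtain B where B: "\<And>x. x \<in> {0..1} \<Longrightarrow> \<bar>F x\<bar> \<le> B"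
    unfolding bounded_iff real_norm_def by blast
  show ?thesis
  proof (rule that[of \<delta> N])
    fix r :: "real \<Rightarrow> real"
    assume "laplace_close N \<delta> r"
    then have r[measurable]: "r \<in> borel_measurable borel"
      and rb: "\<And>u. u \<ge> 0 \<Longrightarrow> 0 \<le> r u \<and> r u \<le> r 0"
      and lap: "\<And>k. k \<le> N \<Longrightarrow> \<bar>(\<integral>u. exp (- (real k * u)) * r u \<partial>exp_law) - 1 / (real k + 1)\<bar> \<le> \<delta>"
      by (auto simp: laplace_close_def)
    have e01: "exp (- u) \<in> {0..1}" if "u \<ge> 0" for u :: real using that by simp
    have FP': "\<bar>F (exp (- u)) - P (exp (- u))\<bar> \<le> \<theta> / 4" if "u \<ge> 0" for u
      using FP[OF e01[OF that]] by simp
    have iF: "integrable exp_law (\<lambda>u. F (exp (- u)))"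
      by (rule integrable_exp_law[where B=B]) (use B e01 in auto)
    have Pb: "\<bar>P (exp (- u))\<bar> \<le> B + \<theta> / 4" if "u \<ge> 0" for u
      using FP'[OF that] B[OF e01[OF that]] by linarith
    have iP: "integrable exp_law (\<lambda>u. P (exp (- u)))"
      by (rule integrable_exp_law[OF _ Pb]) auto
    have ir: "integrable exp_law r"
      by (rule integrable_exp_law[where B="r 0"]) (use rb in auto)
    have iFr: "integrable exp_law (\<lambda>u. F (exp (- u)) * r u)"
      by (rule integrable_exp_law_mult[OF _ r _ rb, where B=B]) (use B e01 in auto)
    have iPr: "integrable exp_law (\<lambda>u. P (exp (- u)) * r u)"
      by (rule integrable_exp_law_mult[OF _ r Pb rb]) auto
    have ikr: "integrable exp_law (\<lambda>u. exp (- (real k * u)) * r u)" for k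
      by (rule integrable_exp_law_mult[OF _ r _ rb, where B=1]) auto
    have ik: "integrable exp_law (\<lambda>u. exp (- (real k * u)))" for k
      by (rule integrable_exp_law[where B="1"]) auto
    have pw: "exp (- u) ^ k = exp (- (real k * u))" for u k
      by (simp flip: exp_of_nat_mult)
    have "(\<integral>u. P (exp (- u)) * r u \<partial>exp_law) - (\<integral>u. P (exp (- u)) \<partial>exp_law)
        = (\<Sum>k\<le>N. c k * ((\<integral>u. exp (- (real k * u)) * r u \<partial>exp_law) - 1 / (real k + 1)))"
      unfolding Pc pw
      by (simp add: sum_distrib_right mult.assoc ik ikr exp_law_moment sum_subtractf right_diff_distrib)
    also have "\<bar>\<dots>\<bar> \<le> (\<Sum>k\<le>N. \<bar>c k\<bar> * \<delta>)"
      using lap by (intro order.trans[OF sum_abs] sum_mono) (auto simp: abs_mult intro!: mult_left_mono)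
    also have "\<dots> \<le> \<theta> / 4" using \<delta>S by (simp add: S_def sum_distrib_left mult.commute)
    finally have 1: "\<bar>(\<integral>u. P (exp (- u)) * r u \<partial>exp_law) - (\<integral>u. P (exp (- u)) \<partial>exp_law)\<bar> \<le> \<theta> / 4" .
    have r1: "(\<integral>u. r u \<partial>exp_law) \<le> 2" using lap[of 0] \<delta>(2) by simp
    have "\<bar>(\<integral>u. F (exp (- u)) * r u \<partial>exp_law) - (\<integral>u. P (exp (- u)) * r u \<partial>exp_law)\<bar>
        = \<bar>\<integral>u. (F (exp (- u)) - P (exp (- u))) * r u \<partial>exp_law\<bar>"
      using iFr iPr by (simp add: left_diff_distrib)
    also have "\<dots> \<le> (\<integral>u. \<theta> / 4 * r u \<partial>exp_law)"
    proof (rule order.trans[OF integral_abs_bound integral_mono_AE])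
      show "integrable exp_law (\<lambda>u. \<bar>(F (exp (- u)) - P (exp (- u))) * r u\<bar>)"
        using iFr iPr by (simp add: left_diff_distrib)
      show "AE u in exp_law. \<bar>(F (exp (- u)) - P (exp (- u))) * r u\<bar> \<le> \<theta> / 4 * r u"
        using AE_exp_law_nonneg
      proof (rule eventually_mono)
        fix u :: real assume u: "u \<ge> 0"
        show "\<bar>(F (exp (- u)) - P (exp (- u))) * r u\<bar> \<le> \<theta> / 4 * r u"
          unfolding abs_mult using FP'[OF u] rb[OF u] \<theta> by (intro mult_mono) auto
      qed
    qed (use ir in simp)
    also have "\<dots> \<le> \<theta> / 4 * 2" using r1 \<theta> by simp
    finally have 2: "\<bar>(\<integral>u. F (exp (- u)) * r u \<partial>exp_law) - (\<integral>u. P (exp (- u)) * r u \<partial>exp_law)\<bar>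
      \<le> \<theta> / 2" by simp
    have "\<bar>(\<integral>u. P (exp (- u)) \<partial>exp_law) - (\<integral>u. F (exp (- u)) \<partial>exp_law)\<bar>
        = \<bar>\<integral>u. F (exp (- u)) - P (exp (- u)) \<partial>exp_law\<bar>"
      using iF iP by simp
    also have "\<dots> \<le> (\<integral>u. \<theta> / 4 \<partial>exp_law)"
      using eventually_mono[OF AE_exp_law_nonneg FP'] iF iP
      by (intro order.trans[OF integral_abs_bound integral_mono_AE]) simp_all
    finally have 3: "\<bar>(\<integral>u. P (exp (- u)) \<partial>exp_law) - (\<integral>u. F (exp (- u)) \<partial>exp_law)\<bar> \<le> \<theta> / 4"
      using exp_law.prob_space by simp
    show "\<bar>(\<integral>u. F (exp (- u)) * r u \<partial>exp_law) - (\<integral>u. F (exp (- u)) \<partial>exp_law)\<bar> \<le> \<theta>"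
      using 1 2 3 by linarith
  qed (use \<delta> in auto)
qed

lemma exp_law_pos:
  fixes F :: "real \<Rightarrow> real"
  assumes [measurable]: "F \<in> borel_measurable borel" and F0: "\<And>v. 0 \<le> F v" and F1: "\<And>v. 0 < v \<Longrightarrow> v \<le> 1 \<Longrightarrow> F v \<le> 1"
    and c: "\<And>v. v > p \<Longrightarrow> v < q \<Longrightarrow> F v > 0" and pq: "0 < p" "p < q" "q \<le> 1"
  shows "(\<integral>u. F (exp (- u)) \<partial>exp_law) > 0"
proof -
  have iF: "integrable exp_law (\<lambda>u. F (exp (- u)))"
    by (rule integrable_exp_law[where B=1]) (use F0 F1 in auto)
  have "\<not> (AE u in exp_law. F (exp (- u)) = 0)"
  proof
    assume "AE u in exp_law. F (exp (- u)) = 0"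
    then have "AE u in lborel. 0 < exponential_density 1 u \<longrightarrow> F (exp (- u)) = 0"
      unfolding exp_law_def by (subst (asm) AE_density) auto
    then have "AE u in lborel. u \<notin> {- ln q<..<- ln p}"
    proof (rule eventually_mono)
      fix u assume *: "0 < exponential_density 1 u \<longrightarrow> F (exp (- u)) = 0"
      show "u \<notin> {- ln q<..<- ln p}"
      proof
        assume u: "u \<in> {- ln q<..<- ln p}"
        then have "exp (- u) < exp (ln q)" "exp (ln p) < exp (- u)" unfolding exp_less_cancel_iff by auto
        then have "p < exp (- u)" "exp (- u) < q" using pq by auto
        moreover have "u \<ge> 0" using u pq by (smt (verit) greaterThanLessThan_iff ln_le_zero_iff)
        ultimately show False using * c[of "exp (- u)"] by (simp add: exponential_density_def)
      qed
    qed
    then have "emeasure lborel {- ln q<..<- ln p} = 0"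
      by (simp add: AE_iff_measurable[OF _ refl] greaterThanLessThan_def greaterThan_def lessThan_def Int_def)
    then show False using pq by simp
  qed
  then show ?thesis
    using integral_nonneg_eq_0_iff_AE[OF iF] F0
    by (smt (verit) Bochner_Integration.integral_nonneg eventually_mono always_eventually)
qed

text \<open>
  Karamata's Tauberian theorem with index \<open>1\<close> for monotone functions, in a quantitative form: as
  only finitely many values of the Laplace transform matter, it applies to approximations of the
  transition density before the limit is taken.
\<close>

lemma finite_tauberian:
  fixes \<epsilon> :: real
  assumes \<epsilon>: "\<epsilon> > 0"
  obtains \<delta> N where "\<delta> > 0"
    and "\<And>r. laplace_close N \<delta> r \<Longrightarrow> \<bar>r 1 - 1\<bar> \<le> \<epsilon>"
proof -
  let ?e = "exp (- 1) :: real"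
  \<comment> \<open>With \<open>v = exp (- u)\<close>, \<open>F\<close> lives on
    \<open>u \<le> 1\<close> and \<open>G\<close> on \<open>u \<ge> 1\<close>. As \<open>r\<close>
    is nonincreasing, \<open>r \<ge> r 1\<close> where \<open>F\<close> is positive and
    \<open>r \<le> r 1\<close> where \<open>G\<close> is. Both are continuous, so Weierstrass
    applies to them directly, unlike to the indicator of \<open>[exp (- 1), 1]\<close> in Karamata's
    proof.\<close>
  define F where "F v = max 0 (v - ?e)" for v
  define G where "G v = max 0 (?e - v)" for v
  have cF: "continuous_on UNIV F" and cG: "continuous_on UNIV G"
    unfolding F_def G_def by (auto intro!: continuous_intros)
  have e1: "?e < 1" "0 < ?e" by auto
  have F1: "F v \<le> 1" if "v \<le> 1" for v
    using that e1 unfolding F_def by linarith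
  have G1: "G v \<le> 1" if "0 < v" for v
    using that e1 unfolding G_def by linarith
  have [measurable]: "F \<in> borel_measurable borel" "G \<in> borel_measurable borel"
    using cF cG by (auto intro!: borel_measurable_continuous_onI)
  define IF where "IF = (\<integral>u. F (exp (- u)) \<partial>exp_law)"
  define IG where "IG = (\<integral>u. G (exp (- u)) \<partial>exp_law)"
  have IF: "IF > 0" unfolding IF_def
    by (rule exp_law_pos[where p="?e" and q=1]) (use e1 F1 in \<open>auto simp: F_def\<close>)
  have IG: "IG > 0" unfolding IG_def
    by (rule exp_law_pos[where p="?e/2" and q="?e"]) (use e1 G1 in \<open>auto simp: G_def\<close>)
  obtain dF NF where dF: "dF > 0" and F: "\<And>r. laplace_close NF dF r \<Longrightarrow>
      \<bar>(\<integral>u. F (exp (- u)) * r u \<partial>exp_law) - IF\<bar> \<le> \<epsilon> * IF"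
    using exp_law_approx[OF cF mult_pos_pos[OF \<epsilon> IF], folded IF_def] by blast
  obtain dG NG where dG: "dG > 0" and G: "\<And>r. laplace_close NG dG r \<Longrightarrow>
      \<bar>(\<integral>u. G (exp (- u)) * r u \<partial>exp_law) - IG\<bar> \<le> \<epsilon> * IG"
    using exp_law_approx[OF cG mult_pos_pos[OF \<epsilon> IG], folded IG_def] by blast
  show ?thesis
  proof (rule that[of "min dF dG" "max NF NG"])
    fix r :: "real \<Rightarrow> real"
    assume close: "laplace_close (max NF NG) (min dF dG) r"
    then have r[measurable]: "r \<in> borel_measurable borel"
      and r0: "\<And>u. u \<ge> 0 \<Longrightarrow> 0 \<le> r u"
      and rm: "\<And>u v. 0 \<le> u \<Longrightarrow> u \<le> v \<Longrightarrow> r v \<le> r u"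
      by (auto simp: laplace_close_def)
    have rb: "0 \<le> r u \<and> r u \<le> r 0" if "u \<ge> 0" for u
      using r0 rm that by simp
    have Fr: "\<bar>(\<integral>u. F (exp (- u)) * r u \<partial>exp_law) - IF\<bar> \<le> \<epsilon> * IF"
      by (rule F[OF laplace_close_mono[OF close]]) auto
    have Gr: "\<bar>(\<integral>u. G (exp (- u)) * r u \<partial>exp_law) - IG\<bar> \<le> \<epsilon> * IG"
      by (rule G[OF laplace_close_mono[OF close]]) auto
    have Fb: "0 \<le> F (exp (- u))" "F (exp (- u)) \<le> 1" "0 \<le> G (exp (- u))" "G (exp (- u)) \<le> 1"
      if "u \<ge> 0" for u
      using that F1[of "exp (- u)"] G1[of "exp (- u)"] by (simp_all add: F_def G_def)
    have int: "integrable exp_law (\<lambda>u. H (exp (- u)) * r u)" "integrable exp_law (\<lambda>u. H (exp (- u)))"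
      if [measurable]: "H \<in> borel_measurable borel" and H: "\<And>u. u \<ge> 0 \<Longrightarrow> \<bar>H (exp (- u))\<bar> \<le> 1" for H
    proof -
      show "integrable exp_law (\<lambda>u. H (exp (- u)) * r u)"
        by (rule integrable_exp_law_mult[OF _ r H rb]) auto
      show "integrable exp_law (\<lambda>u. H (exp (- u)))"
        by (rule integrable_exp_law[OF _ H]) auto
    qed
    have Fa: "\<bar>F (exp (- u))\<bar> \<le> 1" "\<bar>G (exp (- u))\<bar> \<le> 1" if "u \<ge> 0" for u
      using Fb[OF that] by simp_all
    note intF = int[OF \<open>F \<in> _\<close> Fa(1)] and intG = int[OF \<open>G \<in> _\<close> Fa(2)]
    have "(\<integral>u. r 1 * F (exp (- u)) \<partial>exp_law) \<le> (\<integral>u. F (exp (- u)) * r u \<partial>exp_law)"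
    proof (rule integral_mono_AE)
      show "AE u in exp_law. r 1 * F (exp (- u)) \<le> F (exp (- u)) * r u"
        using AE_exp_law_nonneg
      proof (rule eventually_mono)
        fix u :: real assume "u \<ge> 0"
        show "r 1 * F (exp (- u)) \<le> F (exp (- u)) * r u"
        proof (cases "u \<le> 1")
          case True
          then show ?thesis
            using mult_right_mono[OF rm[OF \<open>u \<ge> 0\<close> True] Fb(1)[OF \<open>u \<ge> 0\<close>]] by (simp add: mult.commute)
        qed (simp add: F_def)
      qed
    qed (simp_all add: intF)
    then have "r 1 * IF \<le> (1 + \<epsilon>) * IF" using Fr unfolding distrib_right
      by (simp add: IF_def)
    then have up: "r 1 \<le> 1 + \<epsilon>" using IF by simp
    have "(\<integral>u. G (exp (- u)) * r u \<partial>exp_law) \<le> (\<integral>u. r 1 * G (exp (- u)) \<partial>exp_law)"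
    proof (rule integral_mono_AE)
      show "AE u in exp_law. G (exp (- u)) * r u \<le> r 1 * G (exp (- u))"
        using AE_exp_law_nonneg
      proof (rule eventually_mono)
        fix u :: real assume "u \<ge> 0"
        show "G (exp (- u)) * r u \<le> r 1 * G (exp (- u))"
        proof (cases "1 \<le> u")
          case True
          then show ?thesis
            using mult_right_mono[OF rm[OF _ True] Fb(3)[OF \<open>u \<ge> 0\<close>]] by (simp add: mult.commute)
        qed (simp add: G_def)
      qed
    qed (simp_all add: intG)
    then have "(1 - \<epsilon>) * IG \<le> r 1 * IG" using Gr unfolding left_diff_distrib
      by (simp add: IG_def)
    then have "1 - \<epsilon> \<le> r 1" using IG by simp
    then show "\<bar>r 1 - 1\<bar> \<le> \<epsilon>" using up by linarith
  qed (use dF dG in auto)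
qed

section \<open>Weights of regular variation\<close>

lemma at_within_half_line:
  fixes x b :: real
  assumes "x < b"
  shows "at x within {0..b} = at x within {0..}"
  by (rule at_within_nhd[where S="{..<b}"]) (use assms in auto)

lemma integral_half_line_deriv:
  fixes g :: "real \<Rightarrow> real"
  assumes "continuous_on {0..} g" "x \<ge> 0"
  shows "((\<lambda>x. integral {0..x} g) has_real_derivative g x) (at x within {0..})"
proof -
  have "continuous_on {0..x+1} g" by (rule continuous_on_subset[OF assms(1)]) auto
  then have "((\<lambda>x. integral {0..x} g) has_real_derivative g x) (at x within {0..x+1})"
    by (rule integral_has_real_derivative) (use assms in auto)
  then show ?thesis using at_within_half_line[of x "x+1"] by simp
qed

text \<open>The workhorse of the development: an inequality between integrals is put as monotonicity
  of one function, whose derivative is then checked pointwise. Derivatives are taken within the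
  half-line so that the reflecting end 0 is included.\<close>

lemma half_line_mono:
  fixes f :: "real \<Rightarrow> real"
  assumes ab: "0 \<le> a" "a \<le> b"
    and f: "\<And>x. a \<le> x \<Longrightarrow> x \<le> b \<Longrightarrow> (f has_real_derivative f' x) (at x within {0..})"
    and f': "\<And>x. a \<le> x \<Longrightarrow> x \<le> b \<Longrightarrow> 0 \<le> f' x"
  shows "f a \<le> f b"
proof (cases "a = b")
  case False
  then have "a < b" using ab by simp
  moreover have "(f has_derivative (*) (f' x)) (at x within {a..b})" if "a \<le> x" "x \<le> b" for x
    by (rule has_derivative_subset[OF f[OF that, unfolded has_field_derivative_def]]) (use ab in auto)
  ultimately obtain z where z: "z \<in> {a<..<b}" "f b - f a = f' z * (b - a)"
    using mvt_simple[of a b f "\<lambda>x. (*) (f' x)"] by blast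
  have "0 \<le> f' z * (b - a)" using f'[of z] z ab by (intro mult_nonneg_nonneg) auto
  then show ?thesis using z by linarith
qed simp

text \<open>Stands in for estimates of integrals over \<open>[a, \<infinity>)\<close>: the value at
  infinity is supplied as a limit.\<close>

lemma half_line_le_limit:
  fixes f :: "real \<Rightarrow> real"
  assumes a: "0 \<le> a"
    and f: "\<And>x. a \<le> x \<Longrightarrow> (f has_real_derivative f' x) (at x within {0..})"
    and f': "\<And>x. a \<le> x \<Longrightarrow> 0 \<le> f' x"
    and l: "(f \<longlongrightarrow> l) at_top"
  shows "f a \<le> l"
proof (rule tendsto_lowerbound[OF l _ trivial_limit_at_top_linorder], rule eventually_at_top_linorderI)
  show "f a \<le> f x" if "a \<le> x" for x
    by (rule half_line_mono[OF a that f f'])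
qed

lemma half_line_less:
  fixes f :: "real \<Rightarrow> real"
  assumes ab: "0 \<le> a" "a < b"
    and f: "\<And>x. a \<le> x \<Longrightarrow> x \<le> b \<Longrightarrow> (f has_real_derivative f' x) (at x within {0..})"
    and f': "\<And>x. a < x \<Longrightarrow> x < b \<Longrightarrow> 0 < f' x"
  shows "f a < f b"
proof -
  have "(f has_derivative (*) (f' x)) (at x within {a..b})" if "a \<le> x" "x \<le> b" for x
    by (rule has_derivative_subset[OF f[OF that, unfolded has_field_derivative_def]]) (use ab in auto)
  then obtain z where z: "z \<in> {a<..<b}" "f b - f a = f' z * (b - a)"
    using mvt_simple[of a b f "\<lambda>x. (*) (f' x)"] ab by blast
  have "0 < f' z * (b - a)" using f'[of z] z ab by (intro mult_pos_pos) auto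
  then show ?thesis using z by linarith
qed

section \<open>Mass of the speed measure beyond a point\<close>

locale speed_weight =
  fixes W :: "real \<Rightarrow> real" and m_inf :: real
  assumes W_cont: "continuous_on {0..} W"
    and W_pos: "\<And>x. x \<ge> 0 \<Longrightarrow> W x > 0"
    and W_tail: "((\<lambda>x. 2 * integral {0..x} W) \<longlongrightarrow> m_inf) at_top"
begin

definition tail :: "real \<Rightarrow> real" where
  "tail x = m_inf - 2 * integral {0..x} W"

lemma tail_deriv:
  "x \<ge> 0 \<Longrightarrow> (tail has_real_derivative (- 2 * W x)) (at x within {0..})"
  unfolding tail_def
  by (auto intro!: derivative_eq_intros integral_half_line_deriv W_cont)

lemma tail_tendsto: "(tail \<longlongrightarrow> 0) at_top"
  unfolding tail_def using tendsto_diff[OF tendsto_const[of m_inf] W_tail] by simp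

lemma tail_0 [simp]: "tail 0 = m_inf"
  by (simp add: tail_def)

lemma tail_antimono:
  assumes "0 \<le> x" "x \<le> y" shows "tail y \<le> tail x"
proof -
  have "- tail x \<le> - tail y"
    by (rule half_line_mono[where f'="\<lambda>x. 2 * W x"])
       (use assms W_pos in \<open>auto intro!: derivative_eq_intros tail_deriv simp: less_imp_le\<close>)
  then show ?thesis by simp
qed

lemma tail_pos:
  assumes "0 \<le> x" shows "tail x > 0"
proof -
  have "- tail x < - tail (x + 1)"
    by (rule half_line_less[where f'="\<lambda>x. 2 * W x"])
       (use assms W_pos in \<open>auto intro!: derivative_eq_intros tail_deriv\<close>)
  moreover have "0 \<le> tail (x + 1)"
    by (rule tendsto_upperbound[OF tail_tendsto _ trivial_limit_at_top_linorder])
       (use assms in \<open>auto intro!: eventually_at_top_linorderI[of "x + 1"] tail_antimono\<close>)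
  ultimately show ?thesis by linarith
qed

lemma m_inf_pos: "m_inf > 0"
  using tail_pos[of 0] by simp

lemma tail_cont: "continuous_on {0..} tail"
  by (rule DERIV_continuous_on[where D="\<lambda>x. - 2 * W x"], rule tail_deriv) simp

end

text \<open>Integrated form of regular variation with index -1: \<open>W v / W u\<close> is
  \<open>u / v\<close> up to a factor between \<open>exp (- d)\<close> and \<open>exp d\<close> with
  \<open>d = \<delta> * (1 + ln (v / u))\<close>. For the weight of a drift the summand 1 absorbs
  \<eta>, whose integral merely converges, and the logarithm absorbs \<epsilon>.\<close>

locale regular_weight = speed_weight +
  assumes W_regular: "\<And>\<delta>. \<delta> > 0 \<Longrightarrow> \<exists>x0>0. \<forall>u\<ge>x0. \<forall>v\<ge>u.
    \<bar>ln (W v) - ln (W u) + (ln v - ln u)\<bar> \<le> \<delta> * (1 + (ln v - ln u))"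
begin

text \<open>With \<open>\<delta> = 1 / (1 + ln K)\<close> the allowed error in \<open>ln W\<close>
  is at most 1 on \<open>[x, K * x]\<close>, so there \<open>W\<close> follows \<open>1 / x\<close>
  up to a factor \<open>exp 1\<close>.\<close>

lemma W_ratio:
  assumes K: "K \<ge> 1"
  obtains x0 where "x0 > 0"
    and "\<And>x v. x \<ge> x0 \<Longrightarrow> x \<le> v \<Longrightarrow> v \<le> K * x \<Longrightarrow> exp (- 1) * W x * x / v \<le> W v"
    and "\<And>x v. x \<ge> x0 \<Longrightarrow> x \<le> v \<Longrightarrow> v \<le> K * x \<Longrightarrow> W v \<le> exp 1 * W x * x / v"
proof -
  have lK: "ln K \<ge> 0" using K by simp
  obtain x0 where x0: "x0 > 0" and b: "\<And>u v. u \<ge> x0 \<Longrightarrow> v \<ge> u \<Longrightarrow>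
      \<bar>ln (W v) - ln (W u) + (ln v - ln u)\<bar> \<le> 1 / (1 + ln K) * (1 + (ln v - ln u))"
    using W_regular[of "1 / (1 + ln K)"] lK by (meson add_pos_nonneg divide_pos_pos zero_less_one)
  have main: "\<bar>ln (W v) - ln (W x) + (ln v - ln x)\<bar> \<le> 1"
    if v: "x \<ge> x0" "x \<le> v" "v \<le> K * x" for x v
  proof -
    have "ln v \<le> ln (K * x)" using v x0 K by (subst ln_le_cancel_iff) auto
    then have "ln v - ln x \<le> ln K" using v x0 K by (simp add: ln_mult)
    then have "1 / (1 + ln K) * (1 + (ln v - ln x)) \<le> 1"
      using lK by (simp add: field_simps)
    then show ?thesis using b[of x v] v by linarith
  qed
  show ?thesis
  proof (rule that[OF x0])
    fix x v assume v: "x \<ge> x0" "x \<le> v" "v \<le> K * x"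
    then have pos: "x > 0" "v > 0" "W x > 0" "W v > 0" using x0 W_pos[of x] W_pos[of v] by auto
    have "exp (- 1) * W x * x / v = exp (- 1 + ln (W x) + ln x - ln v)"
      unfolding exp_add exp_diff using pos by simp
    also have "\<dots> \<le> exp (ln (W v))" using main[OF v] by (subst exp_le_cancel_iff) linarith
    finally show "exp (- 1) * W x * x / v \<le> W v" using pos by simp
    have "W v = exp (ln (W v))" using pos by simp
    also have "\<dots> \<le> exp (1 + ln (W x) + ln x - ln v)" using main[OF v] by (subst exp_le_cancel_iff) linarith
    also have "\<dots> = exp 1 * W x * x / v"
      using pos by (simp add: exp_add exp_diff)
    finally show "W v \<le> exp 1 * W x * x / v" .
  qed
qed

text \<open>A Potter bound with exponent 1/2 in place of 1, valid for all \<open>v \<ge> u\<close>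
  and not just for bounded ratios. It is the case \<open>\<delta> = 1/2\<close> of
  \<open>W_regular\<close>.\<close>

lemma W_sqrt_bound:
  obtains x0 where "x0 > 0"
    and "\<And>u v. u \<ge> x0 \<Longrightarrow> u \<le> v \<Longrightarrow> W v \<le> exp 1 * W u * sqrt u / sqrt v"
proof -
  obtain x0 where x0: "x0 > 0" and b: "\<And>u v. u \<ge> x0 \<Longrightarrow> v \<ge> u \<Longrightarrow>
      \<bar>ln (W v) - ln (W u) + (ln v - ln u)\<bar> \<le> (1/2) * (1 + (ln v - ln u))"
    using W_regular[of "1/2"] by auto
  show ?thesis
  proof (rule that[OF x0])
    fix u v assume v: "u \<ge> x0" "u \<le> v"
    then have pos: "u > 0" "v > 0" "W u > 0" "W v > 0" using x0 W_pos[of u] W_pos[of v] by auto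
    have "2 * (ln (W v) - ln (W u) + (ln v - ln u)) \<le> 1 + (ln v - ln u)"
      using abs_le_D1[OF b[OF v]] by simp
    then have *: "ln (W v) \<le> 1 + ln (W u) + ln u / 2 - ln v / 2" by argo
    have "W v = exp (ln (W v))" using pos by simp
    also have "\<dots> \<le> exp (1 + ln (W u) + ln (sqrt u) - ln (sqrt v))"
      unfolding exp_le_cancel_iff ln_sqrt[OF less_imp_le[OF pos(1)]] ln_sqrt[OF less_imp_le[OF pos(2)]] by (rule *)
    also have "\<dots> = exp 1 * W u * sqrt u / sqrt v"
      using pos by (simp add: exp_add exp_diff)
    finally show "W v \<le> exp 1 * W u * sqrt u / sqrt v" .
  qed
qed

text \<open>Karamata's theorem in the boundary case: on \<open>[x, K * x]\<close> the weight is at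
  least a multiple of \<open>x * W x / v\<close>, so the mass there is at least a multiple of
  \<open>x * W x * ln K\<close>, and \<open>ln K\<close> can be taken as large as
  \<open>exp 1 / c\<close>.\<close>

lemma W_tail_small:
  assumes c: "c > 0"
  obtains x0 where "x0 > 0" and "\<And>x. x \<ge> x0 \<Longrightarrow> 2 * x * W x \<le> c * tail x"
proof -
  define K where "K = exp (exp 1 / c)"
  have K: "K \<ge> 1" using c by (simp add: K_def)
  obtain x0 where x0: "x0 > 0" and b: "\<And>x v. x \<ge> x0 \<Longrightarrow> x \<le> v \<Longrightarrow> v \<le> K * x \<Longrightarrow>
      exp (- 1) * W x * x / v \<le> W v"
    using W_ratio[OF K] by metis
  show ?thesis
  proof (rule that[OF x0])
    fix x assume x: "x \<ge> x0"
    define d where "d = 2 * exp (- 1) * W x * x"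
    have xK: "x \<le> K * x" using K x x0 by simp
    have "- tail x - d * ln x \<le> - tail (K * x) - d * ln (K * x)"
    proof (rule half_line_mono[where f="\<lambda>v. - tail v - d * ln v" and f'="\<lambda>v. 2 * W v - d / v"])
      fix v assume v: "x \<le> v" "v \<le> K * x"
      show "((\<lambda>v. - tail v - d * ln v) has_real_derivative 2 * W v - d / v) (at v within {0..})"
        using v x x0 by (auto intro!: derivative_eq_intros tail_deriv)
      show "0 \<le> 2 * W v - d / v" using b[OF x v] by (simp add: d_def)
    qed (use x x0 xK in auto)
    moreover have "ln (K * x) = exp 1 / c + ln x" using x x0 K c by (simp add: ln_mult K_def)
    ultimately have "d * (exp 1 / c) \<le> tail x - tail (K * x)" by (simp add: algebra_simps)
    moreover have "d * (exp 1 / c) = 2 * x * W x / c"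
      unfolding d_def by (simp add: exp_minus field_simps)
    moreover have "tail (K * x) > 0" using x x0 K by (intro tail_pos) auto
    ultimately have "2 * x * W x / c \<le> tail x" by linarith
    then show "2 * x * W x \<le> c * tail x" using c by (simp add: field_simps)
  qed
qed

text \<open>The mass of \<open>[x, K * x]\<close> is at most a multiple of
  \<open>x * W x * ln K\<close>, and \<open>x * W x\<close> is negligible against
  \<open>tail x\<close> by \<open>W_tail_small\<close>.\<close>

lemma tail_slow_variation_ge1:
  assumes K: "K \<ge> 1"
  shows "((\<lambda>x. tail (K * x) / tail x) \<longlongrightarrow> 1) at_top"
proof (rule tendstoI)
  fix e :: real assume e: "e > 0"
  obtain x0 where x0: "x0 > 0" and b: "\<And>x v. x \<ge> x0 \<Longrightarrow> x \<le> v \<Longrightarrow> v \<le> K * x \<Longrightarrow>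
      W v \<le> exp 1 * W x * x / v"
    using W_ratio[OF K] by metis
  have lK: "ln K \<ge> 0" using K by simp
  \<comment> \<open>Adding 1 keeps the quotient \<open>c\<close> meaningful when
    \<open>K = 1\<close>.\<close>
  define L where "L = 1 + ln K"
  have L: "L > 0" "ln K \<le> L" using lK by (auto simp: L_def)
  define c where "c = e / (2 * exp 1 * L)"
  have c: "c > 0" using e L by (simp add: c_def)
  obtain x1 where x1: "x1 > 0" and b1: "\<And>x. x \<ge> x1 \<Longrightarrow> 2 * x * W x \<le> c * tail x"
    using W_tail_small[OF c] by metis
  show "\<forall>\<^sub>F x in at_top. dist (tail (K * x) / tail x) 1 < e"
  proof (rule eventually_at_top_linorderI[of "max x0 x1"])
    fix x assume "max x0 x1 \<le> x"
    then have x: "x \<ge> x0" "x \<ge> x1" by auto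
    define d where "d = 2 * exp 1 * W x * x"
    have xK: "x \<le> K * x" using K x x0 by simp
    have "tail x + d * ln x \<le> tail (K * x) + d * ln (K * x)"
    proof (rule half_line_mono[where f="\<lambda>v. tail v + d * ln v" and f'="\<lambda>v. - 2 * W v + d / v"])
      fix v assume v: "x \<le> v" "v \<le> K * x"
      show "((\<lambda>v. tail v + d * ln v) has_real_derivative - 2 * W v + d / v) (at v within {0..})"
        using v x x0 by (auto intro!: derivative_eq_intros tail_deriv)
      show "0 \<le> - 2 * W v + d / v" using b[OF x(1) v] by (simp add: d_def)
    qed (use x x0 xK in auto)
    moreover have "ln (K * x) = ln K + ln x" using x x0 K by (simp add: ln_mult)
    ultimately have "tail x - tail (K * x) \<le> d * ln K" by (simp add: algebra_simps)
    also have "\<dots> = exp 1 * ln K * (2 * x * W x)" by (simp add: d_def)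
    also have "\<dots> \<le> exp 1 * ln K * (c * tail x)"
      using b1[OF x(2)] lK by (intro mult_left_mono) auto
    also have "\<dots> = (exp 1 * ln K * c) * tail x" by simp
    also have "exp 1 * ln K * c \<le> exp 1 * L * c"
      using c L by (intro mult_right_mono mult_left_mono) auto
    also have "exp 1 * L * c = e / 2"
      using L by (simp add: c_def)
    finally have 1: "tail x - tail (K * x) \<le> e / 2 * tail x"
      using tail_pos[of x] x x0 by simp
    have tp: "tail x > 0" using tail_pos[of x] x x0 by simp
    have 2: "tail (K * x) \<le> tail x" using tail_antimono[OF _ xK] x x0 by simp
    have "\<bar>tail (K * x) / tail x - 1\<bar> = (tail x - tail (K * x)) / tail x"
      using tp 2 by (simp add: field_simps)
    also have "\<dots> \<le> e / 2" using 1 tp by (simp add: field_simps)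
    finally show "dist (tail (K * x) / tail x) 1 < e" using e by (simp add: dist_real_def)
  qed
qed

lemma tail_slow_variation:
  assumes K: "K > 0"
  shows "((\<lambda>x. tail (K * x) / tail x) \<longlongrightarrow> 1) at_top"
proof (cases "K \<ge> 1")
  case False
  then have "1 / K \<ge> 1" using K by simp
  then have "((\<lambda>x. tail (1 / K * x) / tail x) \<longlongrightarrow> 1) at_top" by (rule tail_slow_variation_ge1)
  moreover have "filterlim (\<lambda>x. K * x) at_top at_top"
    using K by (intro filterlim_tendsto_pos_mult_at_top[OF tendsto_const _ filterlim_ident])
  ultimately have "((\<lambda>x. tail (1 / K * (K * x)) / tail (K * x)) \<longlongrightarrow> 1) at_top"
    by (rule filterlim_compose)
  then have "((\<lambda>x. inverse (tail x / tail (K * x))) \<longlongrightarrow> inverse 1) at_top"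
    using K by (intro tendsto_inverse) auto
  then show ?thesis by (simp add: field_simps)
qed (rule tail_slow_variation_ge1)

text \<open>The derivative \<open>(tail x / 2 - 2 * x * W x) / sqrt x\<close> is nonnegative once
  \<open>W_tail_small\<close> applies with \<open>c = 1/2\<close>: a slowly varying function loses
  less than a power gains.\<close>

lemma tail_sqrt_mono:
  obtains x0 where "x0 > 0" and "\<And>u v. u \<ge> x0 \<Longrightarrow> u \<le> v \<Longrightarrow> tail u * sqrt u \<le> tail v * sqrt v"
proof -
  obtain x0 where x0: "x0 > 0" and b: "\<And>x. x \<ge> x0 \<Longrightarrow> 2 * x * W x \<le> (1/2) * tail x"
    using W_tail_small[of "1/2"] by auto
  show ?thesis
  proof (rule that[OF x0])
    fix u v assume uv: "u \<ge> x0" "u \<le> v"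
    show "tail u * sqrt u \<le> tail v * sqrt v"
    proof (rule half_line_mono[where f="\<lambda>x. tail x * sqrt x" and f'="\<lambda>x. - 2 * W x * sqrt x + tail x / (2 * sqrt x)"])
      fix x assume x: "u \<le> x" "x \<le> v"
      then have xp: "x > 0" using uv x0 by simp
      show "((\<lambda>x. tail x * sqrt x) has_real_derivative - 2 * W x * sqrt x + tail x / (2 * sqrt x)) (at x within {0..})"
        using xp by (auto intro!: derivative_eq_intros tail_deriv simp: field_simps)
      have "0 \<le> (tail x / 2 - 2 * x * W x) / sqrt x"
        using b[of x] x uv xp by (intro divide_nonneg_nonneg) auto
      also have "\<dots> = - 2 * W x * sqrt x + tail x / (2 * sqrt x)"
        using xp by (simp add: field_simps)
      finally show "0 \<le> - 2 * W x * sqrt x + tail x / (2 * sqrt x)" .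
    qed (use uv x0 in auto)
  qed
qed

text \<open>The bound that \<open>deficit_upper\<close> integrates. Far out,
  \<open>tail x - tail R\<close> is at most a multiple of \<open>W x * sqrt x * sqrt R\<close> by
  the Potter bound, and \<open>tail x * sqrt x \<le> tail R * sqrt R\<close>; the two factors
  \<open>sqrt R\<close> combine to \<open>R\<close>. Near 0 the left-hand side is bounded by a
  constant, and \<open>R * tail R\<close> stays above its value at \<open>x0\<close>.\<close>

lemma tail_product_bound:
  obtains C x1 where "C > 0" "x1 > 0"
    and "\<And>R x. R \<ge> x1 \<Longrightarrow> 0 \<le> x \<Longrightarrow> x \<le> R \<Longrightarrow> (tail x - tail R) * tail x / W x \<le> C * R * tail R"
proof -
  obtain y0 where y0: "y0 > 0" and Ts: "\<And>u v. u \<ge> y0 \<Longrightarrow> u \<le> v \<Longrightarrow> tail u * sqrt u \<le> tail v * sqrt v"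
    using tail_sqrt_mono by metis
  obtain z0 where z0: "z0 > 0" and Ws: "\<And>u v. u \<ge> z0 \<Longrightarrow> u \<le> v \<Longrightarrow> W v \<le> exp 1 * W u * sqrt u / sqrt v"
    using W_sqrt_bound by metis
  define x0 where "x0 = max y0 z0"
  have x0: "x0 > 0" "x0 \<ge> y0" "x0 \<ge> z0" using y0 by (auto simp: x0_def)
  obtain w where w: "w \<in> {0..x0}" "\<And>x. x \<in> {0..x0} \<Longrightarrow> W w \<le> W x"
    using continuous_attains_inf[of "{0..x0}" W] continuous_on_subset[OF W_cont, of "{0..x0}"] x0 by auto
  have Ww: "W w > 0" using w W_pos by auto
  define B where "B = m_inf * m_inf / W w"
  have B: "B > 0" using m_inf_pos Ww by (simp add: B_def)
  have T0: "tail x0 > 0" using tail_pos x0 by simp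
  \<comment> \<open>The first summand serves \<open>x \<ge> x0\<close>: one factor 2 comes from the
    density \<open>2 * W\<close>, the other from integrating \<open>1 / sqrt v\<close>. The second
    serves the compact remainder.\<close>
  define C where "C = 4 * exp 1 + B / (x0 * tail x0)"
  have C1: "C \<ge> 4 * exp 1" and C2: "C \<ge> B / (x0 * tail x0)"
    using B T0 x0 by (auto simp: C_def)
  show ?thesis
  proof (rule that[of C x0])
    show "C > 0" using B T0 x0 by (auto simp: C_def intro!: add_pos_pos)
    fix R x assume R: "R \<ge> x0" "0 \<le> x" "x \<le> R"
    have TR: "tail R > 0" using tail_pos R by simp
    have Tx: "tail x > 0" "tail R \<le> tail x" using tail_pos tail_antimono R by auto
    have Wx: "W x > 0" using W_pos R by simp
    show "(tail x - tail R) * tail x / W x \<le> C * R * tail R"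
    proof (cases "x \<ge> x0")
      case True
      define d where "d = 4 * exp 1 * W x * sqrt x"
      have "tail x + d * sqrt x \<le> tail R + d * sqrt R"
      proof (rule half_line_mono[where f="\<lambda>v. tail v + d * sqrt v" and f'="\<lambda>v. - 2 * W v + d / (2 * sqrt v)"])
        fix v assume v: "x \<le> v" "v \<le> R"
        show "((\<lambda>v. tail v + d * sqrt v) has_real_derivative - 2 * W v + d / (2 * sqrt v)) (at v within {0..})"
          using v True x0 by (auto intro!: derivative_eq_intros tail_deriv simp: field_simps)
        have "d / (2 * sqrt v) = 2 * (exp 1 * W x * sqrt x / sqrt v)" by (simp add: d_def)
        moreover have "W v \<le> exp 1 * W x * sqrt x / sqrt v"
          using Ws[of x v] v True x0 by simp
        ultimately show "0 \<le> - 2 * W v + d / (2 * sqrt v)" by linarith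
      qed (use R in auto)
      moreover have "0 \<le> d * sqrt x" using R Wx by (simp add: d_def)
      ultimately have 1: "tail x - tail R \<le> d * sqrt R" by linarith
      have 2: "tail x * sqrt x \<le> tail R * sqrt R" using Ts[of x R] True x0 R by simp
      have "(tail x - tail R) * tail x \<le> d * sqrt R * tail x"
        using 1 Tx by (intro mult_right_mono) auto
      also have "\<dots> = 4 * exp 1 * W x * sqrt R * (tail x * sqrt x)" by (simp add: d_def)
      also have "\<dots> \<le> 4 * exp 1 * W x * sqrt R * (tail R * sqrt R)"
        using 2 Wx R by (intro mult_left_mono) auto
      also have "\<dots> = 4 * exp 1 * W x * (sqrt R * sqrt R) * tail R" by simp
      also have "sqrt R * sqrt R = R" using R by simp
      finally have "(tail x - tail R) * tail x / W x \<le> 4 * exp 1 * R * tail R"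
        using Wx by (simp add: field_simps)
      also have "\<dots> \<le> C * R * tail R" using C1 R TR by (intro mult_right_mono) auto
      finally show ?thesis .
    next
      case False
      have "tail x \<le> m_inf" using tail_antimono[of 0 x] R by simp
      then have "(tail x - tail R) * tail x / W x \<le> m_inf * m_inf / W w"
        using TR Tx R Ww w False by (intro frac_le mult_mono) auto
      also have "\<dots> = B / (x0 * tail x0) * (x0 * tail x0)" using x0 T0 by (simp add: B_def)
      also have "\<dots> \<le> C * (x0 * tail x0)" using C2 x0 T0 by (intro mult_right_mono) auto
      also have "\<dots> \<le> C * (R * tail R)"
      proof (rule mult_left_mono)
        have "x0 * tail x0 = sqrt x0 * (tail x0 * sqrt x0)" using x0 by simp
        also have "\<dots> \<le> sqrt R * (tail R * sqrt R)"
          by (rule mult_mono) (use Ts[of x0 R] x0 R T0 TR in auto)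
        also have "\<dots> = R * tail R" using R x0 by simp
        finally show "x0 * tail x0 \<le> R * tail R" .
        show "0 \<le> C" using order.trans[OF _ C1, of 0] by simp
      qed
      finally show ?thesis by (simp add: mult.assoc)
    qed
  qed (use x0 in auto)
qed

text \<open>Within \<open>[R / 2, R]\<close> the ratios \<open>u / v\<close> are at least 1/2, which
  cancels against the factor 2 of the density \<open>2 * W\<close>.\<close>

lemma tail_increment_lower:
  obtains x1 where "x1 > 0"
    and "\<And>R u. R \<ge> x1 \<Longrightarrow> R / 2 \<le> u \<Longrightarrow> u \<le> R \<Longrightarrow> exp (- 1) * (R - u) * W u \<le> tail u - tail R"
proof -
  obtain x0 where x0: "x0 > 0" and b: "\<And>x v. x \<ge> x0 \<Longrightarrow> x \<le> v \<Longrightarrow> v \<le> 2 * x \<Longrightarrow>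
      exp (- 1) * W x * x / v \<le> W v"
    using W_ratio[of 2] by (metis one_le_numeral)
  show ?thesis
  proof (rule that[of "2 * x0"])
    fix R u assume R: "R \<ge> 2 * x0" "R / 2 \<le> u" "u \<le> R"
    define d where "d = exp (- 1) * W u"
    have "- tail u - d * u \<le> - tail R - d * R"
    proof (rule half_line_mono[where f="\<lambda>v. - tail v - d * v" and f'="\<lambda>v. 2 * W v - d"])
      fix v assume v: "u \<le> v" "v \<le> R"
      show "((\<lambda>v. - tail v - d * v) has_real_derivative 2 * W v - d) (at v within {0..})"
        using v R x0 by (auto intro!: derivative_eq_intros tail_deriv)
      have "d / 2 \<le> d * (u / v)"
        using v R x0 W_pos[of u] unfolding d_def
        by (subst divide_inverse, intro mult_left_mono) (auto simp: field_simps)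
      also have "\<dots> \<le> W v" using b[of u v] v R x0 by (simp add: d_def)
      finally show "0 \<le> 2 * W v - d" by simp
    qed (use R x0 in auto)
    then show "exp (- 1) * (R - u) * W u \<le> tail u - tail R"
      by (simp add: d_def algebra_simps)
  qed (use x0 in auto)
qed

end

section \<open>Resolvent densities away from the source\<close>

text \<open>
  \<open>f\<close> stands for a resolvent density \<open>f = (s - L)\<^sup>-\<^sup>1 \<phi>\<close> with \<open>\<phi>\<close> supported in \<open>[0,a]\<close>, and \<open>h\<close> for
  its derivative with respect to the scale function.
\<close>

locale resolvent_tail = speed_weight +
  fixes s a :: real and f h :: "real \<Rightarrow> real"
  assumes s_pos: "s > 0" and a_nonneg: "a \<ge> 0"
    and f_deriv: "\<And>x. x \<ge> a \<Longrightarrow> (f has_real_derivative h x / W x) (at x within {0..})"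
    and h_deriv: "\<And>x. x \<ge> a \<Longrightarrow> (h has_real_derivative 2 * W x * (s * f x)) (at x within {0..})"
    and f_nonneg: "\<And>x. x \<ge> a \<Longrightarrow> f x \<ge> 0"
    and h_tendsto: "(h \<longlongrightarrow> 0) at_top"
begin

text \<open>Beyond \<open>a\<close> the flux increases, its derivative being nonnegative there, and
  it ends at 0.\<close>

lemma h_nonpos:
  assumes x: "a \<le> x" shows "h x \<le> 0"
proof (rule half_line_le_limit[where f=h and f'="\<lambda>x. 2 * W x * (s * f x)", OF _ _ _ h_tendsto])
  fix z assume "x \<le> z"
  then have z: "a \<le> z" "0 \<le> z" using x a_nonneg by auto
  show "(h has_real_derivative 2 * W z * (s * f z)) (at z within {0..})" by (rule h_deriv[OF z(1)])
  show "0 \<le> 2 * W z * (s * f z)"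
    using W_pos[OF z(2)] f_nonneg[OF z(1)] s_pos by simp
qed (use x a_nonneg in simp)

lemma f_antimono:
  assumes "a \<le> x" "x \<le> y" shows "f y \<le> f x"
proof -
  have "- f x \<le> - f y"
  proof (rule half_line_mono[where f="\<lambda>x. - f x" and f'="\<lambda>x. - h x / W x"])
    fix z assume z: "x \<le> z" "z \<le> y"
    show "((\<lambda>x. - f x) has_real_derivative - h z / W z) (at z within {0..})"
      using z assms by (auto intro!: derivative_eq_intros f_deriv)
    show "0 \<le> - h z / W z"
      using h_nonpos[of z] W_pos[of z] z assms a_nonneg by (intro divide_nonneg_nonneg) auto
  qed (use assms a_nonneg in auto)
  then show ?thesis by simp
qed

text \<open>\<open>- h x\<close> is the integral of \<open>s * f\<close> over
  \<open>[x, \<infinity>)\<close> against the speed measure, and on \<open>[a, \<infinity>)\<close>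
  the function \<open>f\<close> is largest at \<open>a\<close>.\<close>

lemma h_lower:
  assumes "a \<le> x" shows "- h x \<le> s * f a * tail x"
proof -
  let ?g = "\<lambda>x. - (h x + s * f a * tail x)"
  have "(?g \<longlongrightarrow> - (0 + s * f a * 0)) at_top"
    by (intro tendsto_intros h_tendsto tail_tendsto)
  then have lim: "(?g \<longlongrightarrow> 0) at_top" by simp
  have "?g x \<le> 0"
  proof (rule half_line_le_limit[where f="?g" and f'="\<lambda>z. 2 * W z * s * (f a - f z)", OF _ _ _ lim])
    fix z assume "x \<le> z"
    then have z: "a \<le> z" "0 \<le> z" using assms a_nonneg by auto
    show "(?g has_real_derivative 2 * W z * s * (f a - f z)) (at z within {0..})"
      using z by (auto intro!: derivative_eq_intros h_deriv tail_deriv simp: algebra_simps)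
    show "0 \<le> 2 * W z * s * (f a - f z)"
      using f_antimono[OF order_refl z(1)] W_pos[OF z(2)] s_pos by simp
  qed (use assms a_nonneg in simp)
  then show ?thesis by simp
qed

text \<open>\<open>deficit x\<close> equals \<open>\<integral> (f a - f u) dm(u)\<close> over \<open>[x,\<infinity>)\<close>.\<close>

definition deficit :: "real \<Rightarrow> real" where
  "deficit x = f a * tail x + h x / s"

lemma deficit_deriv:
  assumes "a \<le> x"
  shows "(deficit has_real_derivative - 2 * W x * (f a - f x)) (at x within {0..})"
  unfolding deficit_def using assms a_nonneg s_pos
  by (auto intro!: derivative_eq_intros h_deriv tail_deriv simp: field_simps)

lemma deficit_antimono:
  assumes "a \<le> x" "x \<le> y" shows "deficit y \<le> deficit x"
proof -
  have "- deficit x \<le> - deficit y"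
  proof (rule half_line_mono[where f="\<lambda>x. - deficit x" and f'="\<lambda>z. 2 * W z * (f a - f z)"])
    fix z assume z: "x \<le> z" "z \<le> y"
    show "((\<lambda>x. - deficit x) has_real_derivative 2 * W z * (f a - f z)) (at z within {0..})"
      using z assms by (auto intro!: derivative_eq_intros deficit_deriv)
    show "0 \<le> 2 * W z * (f a - f z)"
      using f_antimono[of a z] W_pos[of z] z assms a_nonneg by (intro mult_nonneg_nonneg) auto
  qed (use assms a_nonneg in auto)
  then show ?thesis by simp
qed

lemma deficit_le_tail:
  assumes "a \<le> x" shows "deficit x \<le> f a * tail x"
  using h_nonpos[OF assms] s_pos by (simp add: deficit_def field_simps)

text \<open>Beyond \<open>R\<close> the integrand \<open>f a - f u\<close> is at least
  \<open>f a - f R\<close>.\<close>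

lemma deficit_ge_tail:
  assumes R: "a \<le> R" shows "(f a - f R) * tail R \<le> deficit R"
proof -
  let ?g = "\<lambda>x. - (deficit x - (f a - f R) * tail x)"
  have "(?g \<longlongrightarrow> - ((f a * 0 + 0 / s) - (f a - f R) * 0)) at_top"
    unfolding deficit_def using s_pos by (intro tendsto_intros h_tendsto tail_tendsto) auto
  then have lim: "(?g \<longlongrightarrow> 0) at_top" by simp
  have "?g R \<le> 0"
  proof (rule half_line_le_limit[where f="?g" and f'="\<lambda>z. 2 * W z * (f R - f z)", OF _ _ _ lim])
    fix z assume z: "R \<le> z"
    then have z': "a \<le> z" "0 \<le> z" using assms a_nonneg by auto
    show "(?g has_real_derivative 2 * W z * (f R - f z)) (at z within {0..})"
      using z' by (auto intro!: derivative_eq_intros deficit_deriv tail_deriv simp: algebra_simps)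
    show "0 \<le> 2 * W z * (f R - f z)"
      using f_antimono[OF R z] W_pos[OF z'(2)] by simp
  qed (use assms a_nonneg in simp)
  then show ?thesis by simp
qed

text \<open>
  Subtracting \<open>(tail x - tail R) * (f a - f x)\<close> from \<open>deficit x\<close> is an integration by parts: it trades
  \<open>f a - f x\<close> for the flux \<open>h\<close>, which \<open>h_lower\<close> controls.
\<close>

lemma deficit_upper:
  assumes R: "a \<le> R" and C: "C \<ge> 0"
    and prod: "\<And>x. 0 \<le> x \<Longrightarrow> x \<le> R \<Longrightarrow> (tail x - tail R) * tail x / W x \<le> C * R * tail R"
  shows "deficit a \<le> f a * tail R * (1 + C * s * R\<^sup>2)"
proof -
  define d where "d = s * f a * (C * R * tail R)"
  have R0: "R \<ge> 0" using R a_nonneg by simp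
  have d0: "d \<ge> 0" unfolding d_def using s_pos C R0 f_nonneg[of a] tail_pos[OF R0]
    by (intro mult_nonneg_nonneg) auto
  \<comment> \<open>Differentiating the product cancels the derivative of \<open>deficit\<close> and
    leaves the flux term \<open>(tail x - tail R) * (h x / W x)\<close>, which \<open>d\<close>
    compensates. The product vanishes at both ends: \<open>f a - f x\<close> at \<open>a\<close>,
    and \<open>tail x - tail R\<close> at \<open>R\<close>.\<close>
  let ?g = "\<lambda>x. deficit x - (tail x - tail R) * (f a - f x) + d * x"
  have "?g a \<le> ?g R"
  proof (rule half_line_mono[where f="?g" and f'="\<lambda>x. (tail x - tail R) * (h x / W x) + d"])
    fix x assume x: "a \<le> x" "x \<le> R"
    then have x0: "x \<ge> 0" using a_nonneg by simp
    show "(?g has_real_derivative (tail x - tail R) * (h x / W x) + d) (at x within {0..})"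
      using x x0 by (auto intro!: derivative_eq_intros deficit_deriv tail_deriv f_deriv simp: algebra_simps)
    have "(tail x - tail R) * (- h x / W x) \<le> (tail x - tail R) * (s * f a * tail x / W x)"
      using h_lower[OF x(1)] tail_antimono[OF x0 x(2)] W_pos[OF x0]
      by (intro mult_left_mono divide_right_mono) auto
    also have "\<dots> = s * f a * ((tail x - tail R) * tail x / W x)" by simp
    also have "\<dots> \<le> d" unfolding d_def
      using prod[OF x0 x(2)] s_pos f_nonneg[of a] by (intro mult_left_mono) auto
    finally show "0 \<le> (tail x - tail R) * (h x / W x) + d" by simp
  qed (use R a_nonneg in auto)
  then have "deficit a \<le> deficit R + d * (R - a)" by (simp add: algebra_simps)
  also have "\<dots> \<le> f a * tail R + d * R"
    using deficit_le_tail[OF R] d0 a_nonneg by (intro add_mono mult_left_mono) auto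
  also have "\<dots> = f a * tail R * (1 + C * s * R\<^sup>2)"
    by (simp add: d_def power2_eq_square algebra_simps)
  finally show ?thesis .
qed

text \<open>The interval \<open>[u, R]\<close> alone contributes to \<open>- h u\<close> at least
  \<open>s * f R\<close> times its mass, so the slope of \<open>- f\<close> at \<open>u\<close> is
  at least a multiple of \<open>s * f R * (R - u)\<close>. Integration over
  \<open>[R / 2, R]\<close> produces \<open>(R / 2)^2 / 2 = R^2 / 8\<close>.\<close>

lemma f_decay:
  assumes R: "a \<le> R / 2"
    and incr: "\<And>u. R / 2 \<le> u \<Longrightarrow> u \<le> R \<Longrightarrow> exp (- 1) * (R - u) * W u \<le> tail u - tail R"
  shows "f R * (1 + exp (- 1) * s * R\<^sup>2 / 8) \<le> f a"
proof -
  have R0: "R \<ge> 0" "a \<le> R" using R a_nonneg by auto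
  have fR: "f R \<ge> 0" using f_nonneg R0 by simp
  have hb: "- h u \<ge> s * f R * (tail u - tail R)" if u: "R / 2 \<le> u" "u \<le> R" for u
  proof -
    let ?g = "\<lambda>x. h x + s * f R * tail x"
    have "?g u \<le> ?g R"
    proof (rule half_line_mono[where f="?g" and f'="\<lambda>x. 2 * W x * s * (f x - f R)"])
      fix x assume x: "u \<le> x" "x \<le> R"
      then have x0: "x \<ge> a" "x \<ge> 0" using a_nonneg R u by auto
      show "(?g has_real_derivative 2 * W x * s * (f x - f R)) (at x within {0..})"
        using x0 by (auto intro!: derivative_eq_intros h_deriv tail_deriv simp: algebra_simps)
      show "0 \<le> 2 * W x * s * (f x - f R)"
        using f_antimono[OF x0(1) x(2)] W_pos[OF x0(2)] s_pos by (intro mult_nonneg_nonneg) auto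
    qed (use u R a_nonneg in auto)
    then show ?thesis using h_nonpos[OF R0(2)] by (simp add: algebra_simps)
  qed
  define d where "d = s * f R * exp (- 1)"
  have d0: "d \<ge> 0" using s_pos fR by (simp add: d_def)
  let ?g = "\<lambda>x. - f x + d * (R - x)\<^sup>2 / 2"
  have "?g (R / 2) \<le> ?g R"
  proof (rule half_line_mono[where f="?g" and f'="\<lambda>x. - h x / W x - d * (R - x)"])
    fix x assume x: "R / 2 \<le> x" "x \<le> R"
    then have x0: "x \<ge> a" "x \<ge> 0" using a_nonneg R by auto
    show "(?g has_real_derivative - h x / W x - d * (R - x)) (at x within {0..})"
      using x0 by (auto intro!: derivative_eq_intros f_deriv simp: field_simps power2_eq_square)
    have "d * (R - x) * W x = s * f R * (exp (- 1) * (R - x) * W x)" by (simp add: d_def)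
    also have "\<dots> \<le> s * f R * (tail x - tail R)"
      using incr[OF x] s_pos fR by (intro mult_left_mono) auto
    also have "\<dots> \<le> - h x" by (rule hb[OF x])
    finally show "0 \<le> - h x / W x - d * (R - x)" using W_pos[OF x0(2)] by (simp add: field_simps)
  qed (use R a_nonneg in auto)
  then have "f R + d * (R / 2)\<^sup>2 / 2 \<le> f (R / 2)" by simp
  also have "\<dots> \<le> f a" using f_antimono R by simp
  finally show ?thesis by (simp add: d_def power2_eq_square algebra_simps)
qed

end

section \<open>The deficit at the scale 1 / sqrt s\<close>

context regular_weight
begin

text \<open>The cut-off \<open>R\<close> is a multiple of \<open>1 / sqrt s\<close>: a small
  multiple makes \<open>s * R^2\<close> negligible in \<open>deficit_upper\<close>, a large one
  makes \<open>f R\<close> negligible against \<open>f a\<close> in \<open>f_decay\<close>, and slow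
  variation of \<open>tail\<close> makes both equivalent to \<open>1 / sqrt s\<close>. The threshold
  \<open>s0\<close> precedes \<open>a\<close>, \<open>f\<close> and \<open>h\<close>, so that
  \<open>a\<close> may later be chosen depending on \<open>s\<close>.\<close>

lemma deficit_asymptotics:
  assumes \<delta>: "0 < \<delta>" "\<delta> \<le> 1"
  obtains s0 where "s0 > 0"
    and "\<And>s a f h. 0 < s \<Longrightarrow> s < s0 \<Longrightarrow> a \<le> 1 \<Longrightarrow> resolvent_tail W m_inf s a f h \<Longrightarrow>
      (1 - \<delta>) * tail (1 / sqrt s) * f a \<le> f a * tail a + h a / s \<and>
      f a * tail a + h a / s \<le> (1 + \<delta>) * tail (1 / sqrt s) * f a"
proof -
  obtain C x1 where C: "C > 0" and x1: "x1 > 0" and prod: "\<And>R x. R \<ge> x1 \<Longrightarrow> 0 \<le> x \<Longrightarrow> x \<le> R \<Longrightarrow>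
      (tail x - tail R) * tail x / W x \<le> C * R * tail R"
    using tail_product_bound by metis
  obtain x2 where x2: "x2 > 0" and incr: "\<And>R u. R \<ge> x2 \<Longrightarrow> R / 2 \<le> u \<Longrightarrow> u \<le> R \<Longrightarrow>
      exp (- 1) * (R - u) * W u \<le> tail u - tail R"
    using tail_increment_lower by metis
  \<comment> \<open>At \<open>R = K1 / sqrt s\<close> the error \<open>C * s * R^2\<close> is
    \<open>\<delta> / 3\<close>; at \<open>R = K2 / sqrt s\<close> the term
    \<open>exp (- 1) * s * R^2 / 8\<close> is \<open>2 / \<delta>\<close>, whence
    \<open>f R \<le> \<delta> / 2 * f a\<close>.\<close>
  define K1 where "K1 = sqrt (\<delta> / (3 * C))"
  define K2 where "K2 = sqrt (16 * exp 1 / \<delta>)"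
  have K1: "K1 > 0" and K2: "K2 > 0" using \<delta> C by (auto simp: K1_def K2_def)
  have K1s: "C * K1\<^sup>2 = \<delta> / 3" using \<delta> C by (simp add: K1_def)
  have K2s: "exp (- 1) * K2\<^sup>2 / 8 = 2 / \<delta>" using \<delta> by (simp add: K2_def exp_minus field_simps)
  have "\<forall>\<^sub>F x in at_top. tail (K1 * x) / tail x < 1 + \<delta> / 3"
    by (rule order_tendstoD[OF tail_slow_variation[OF K1]]) (use \<delta> in simp)
  moreover have "\<forall>\<^sub>F x in at_top. tail (K2 * x) / tail x > 1 - \<delta> / 2"
    by (rule order_tendstoD[OF tail_slow_variation[OF K2]]) (use \<delta> in simp)
  ultimately have "\<forall>\<^sub>F x in at_top. tail (K1 * x) / tail x < 1 + \<delta> / 3 \<and> tail (K2 * x) / tail x > 1 - \<delta> / 2"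
    by eventually_elim simp
  then obtain y0 where y0: "\<And>x. x \<ge> y0 \<Longrightarrow> tail (K1 * x) / tail x < 1 + \<delta> / 3 \<and> tail (K2 * x) / tail x > 1 - \<delta> / 2"
    unfolding eventually_at_top_linorder by blast
  \<comment> \<open>\<open>y0\<close> is for slow variation, \<open>x1 / K1\<close> and
    \<open>x2 / K2\<close> move the cut-offs beyond the two thresholds, and \<open>1 / K1\<close>,
    \<open>2 / K2\<close> keep \<open>a \<le> 1\<close> below \<open>K1 * y\<close> and
    \<open>K2 * y / 2\<close>.\<close>
  define Y where "Y = Max {1, y0, x1 / K1, x2 / K2, 1 / K1, 2 / K2}"
  have Y: "Y \<ge> 1" "Y \<ge> y0" "Y \<ge> x1 / K1" "Y \<ge> x2 / K2" "Y \<ge> 1 / K1" "Y \<ge> 2 / K2"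
    unfolding Y_def by (auto intro: Max_ge)
  show ?thesis
  proof (rule that[of "1 / Y\<^sup>2"])
    show "1 / Y\<^sup>2 > 0" using Y(1) by simp
    fix s a :: real and f h :: "real \<Rightarrow> real"
    assume s: "0 < s" "s < 1 / Y\<^sup>2" and a: "a \<le> 1" and res: "resolvent_tail W m_inf s a f h"
    interpret resolvent_tail W m_inf s a f h by (rule res)
    define y where "y = 1 / sqrt s"
    have "sqrt s < sqrt (1 / Y\<^sup>2)" using s by (subst real_sqrt_less_iff)
    also have "\<dots> = 1 / Y" using Y(1) by (simp add: real_sqrt_divide)
    finally have "Y \<le> y" using s Y(1) by (simp add: y_def field_simps)
    then have y: "y \<ge> 1" "y \<ge> y0" "y \<ge> x1 / K1" "y \<ge> x2 / K2" "y \<ge> 1 / K1" "y \<ge> 2 / K2"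
      using Y by auto
    have sy: "s * y\<^sup>2 = 1" using s by (simp add: y_def power_divide)
    have Ty: "tail y > 0" using tail_pos y by simp
    have t1: "tail (K1 * y) \<le> (1 + \<delta> / 3) * tail y" and t2: "(1 - \<delta> / 2) * tail y \<le> tail (K2 * y)"
      using y0[OF y(2)] Ty by (auto simp: field_simps)
    have R1: "K1 * y \<ge> x1" "a \<le> K1 * y" and R2: "K2 * y \<ge> x2" "a \<le> K2 * y / 2"
      using y a K1 K2 by (auto simp: field_simps)
    have fa: "f a \<ge> 0" using f_nonneg by simp
    have "deficit a \<le> f a * tail (K1 * y) * (1 + C * s * (K1 * y)\<^sup>2)"
      by (rule deficit_upper[OF R1(2) less_imp_le[OF C]]) (rule prod[OF R1(1)])
    also have "C * s * (K1 * y)\<^sup>2 = (C * K1\<^sup>2) * (s * y\<^sup>2)" by (simp add: power_mult_distrib)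
    also have "\<dots> = \<delta> / 3" using K1s sy by simp
    also have "f a * tail (K1 * y) * (1 + \<delta> / 3) \<le> f a * ((1 + \<delta> / 3) * tail y) * (1 + \<delta> / 3)"
      using t1 fa \<delta> by (intro mult_right_mono mult_left_mono) auto
    also have "\<dots> = ((1 + \<delta> / 3) * (1 + \<delta> / 3)) * (tail y * f a)" by simp
    also have "\<dots> \<le> (1 + \<delta>) * (tail y * f a)"
    proof (rule mult_right_mono)
      have "\<delta> * \<delta> \<le> \<delta> * 1" using \<delta> by (intro mult_left_mono) auto
      moreover have "(1 + \<delta> / 3) * (1 + \<delta> / 3) = 1 + 2 * \<delta> / 3 + \<delta> * \<delta> / 9" by (simp add: algebra_simps)
      ultimately show "(1 + \<delta> / 3) * (1 + \<delta> / 3) \<le> 1 + \<delta>" using \<delta> by linarith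
    qed (use Ty fa in auto)
    finally have up: "deficit a \<le> (1 + \<delta>) * tail y * f a" by simp
    have "f (K2 * y) * (1 + exp (- 1) * s * (K2 * y)\<^sup>2 / 8) \<le> f a"
      by (rule f_decay[OF R2(2)]) (rule incr[OF R2(1)])
    moreover have "exp (- 1) * s * (K2 * y)\<^sup>2 / 8 = (exp (- 1) * K2\<^sup>2 / 8) * (s * y\<^sup>2)"
      by (simp add: power_mult_distrib)
    ultimately have "f (K2 * y) * (1 + 2 / \<delta>) \<le> f a" using K2s sy by simp
    moreover have fK: "f (K2 * y) \<ge> 0" using f_nonneg R2 a_nonneg by simp
    ultimately have "f (K2 * y) * (2 / \<delta>) \<le> f a" by (simp add: algebra_simps)
    then have fK2: "f (K2 * y) \<le> \<delta> / 2 * f a" using \<delta> by (simp add: field_simps)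
    have aK2: "a \<le> K2 * y" using R2 a_nonneg by simp
    have "(1 - \<delta>) * (tail y * f a) \<le> ((1 - \<delta> / 2) * (1 - \<delta> / 2)) * (tail y * f a)"
      using Ty fa \<delta> by (intro mult_right_mono) (auto simp: algebra_simps)
    also have "\<dots> = (f a - \<delta> / 2 * f a) * ((1 - \<delta> / 2) * tail y)" by (simp add: algebra_simps)
    also have "\<dots> \<le> (f a - f (K2 * y)) * tail (K2 * y)"
      using fK2 t2 \<delta> Ty fa f_antimono[OF order_refl aK2] by (intro mult_mono) (auto intro!: mult_nonneg_nonneg)
    also have "\<dots> \<le> deficit (K2 * y)" by (rule deficit_ge_tail[OF aK2])
    also have "\<dots> \<le> deficit a" by (rule deficit_antimono[OF order_refl aK2])
    finally show "(1 - \<delta>) * tail (1 / sqrt s) * f a \<le> f a * tail a + h a / s \<and>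
      f a * tail a + h a / s \<le> (1 + \<delta>) * tail (1 / sqrt s) * f a"
      using up by (simp add: deficit_def y_def mult.assoc)
  qed
qed

end

section \<open>The weight of a drift\<close>

text \<open>Passes from signed Lebesgue integrals to gauge integrals over \<open>{0..x}\<close>,
  which are then differentiated within the half-line.\<close>

lemma interval_lebesgue_integral_half_line:
  fixes f :: "real \<Rightarrow> real"
  assumes f: "loc_integrable f" and xy: "0 \<le> x" "0 \<le> y"
  shows "(LINT u=x..y|lebesgue. f u) = integral {0..y} f - integral {0..x} f"
proof -
  have main: "(LINT u=x..y|lebesgue. f u) = integral {0..y} f - integral {0..x} f"
    if "0 \<le> x" "x \<le> y" for x y
  proof -
    have int: "set_integrable lebesgue {0..y} f" using f by (simp add: loc_integrable_def)
    have "(LINT u=x..y|lebesgue. f u) = (LINT u:{x<..<y}|lebesgue. f u)"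
      using that by (simp add: interval_lebesgue_integral_def)
    also have "\<dots> = integral {x<..<y} f"
      by (rule set_lebesgue_integral_eq_integral, rule set_integrable_subset[OF int]) (use that in auto)
    also have "\<dots> = integral {x..y} f" using integral_open_interval_real[of x y f] by simp
    also have "\<dots> = integral {0..y} f - integral {0..x} f"
      using Henstock_Kurzweil_Integration.integral_combine[of 0 x y f] that
        set_lebesgue_integral_eq_integral(1)[OF int] by simp
    finally show ?thesis .
  qed
  show ?thesis
  proof (cases "x \<le> y")
    case False
    then have "(LINT u=x..y|lebesgue. f u) = - (LINT u=y..x|lebesgue. f u)"
      by (simp add: interval_lebesgue_integral_def)
    then show ?thesis using main[of y x] xy False by simp
  qed (use main xy in simp)
qed

lemma loc_integrable_imp_integrable_on:
  assumes "loc_integrable f" "0 \<le> x" shows "f integrable_on {x..y}"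
proof -
  have "set_integrable lebesgue {0..y} f" using assms by (simp add: loc_integrable_def)
  then have "set_integrable lebesgue {x..y} f"
    by (rule set_integrable_subset) (use assms in auto)
  then show ?thesis by (rule set_lebesgue_integral_eq_integral)
qed

lemma loc_integrable_continuous:
  assumes "continuous_on {0..} f" shows "loc_integrable f"
  unfolding loc_integrable_def
  by (auto intro!: absolutely_integrable_continuous_real continuous_on_subset[OF assms])

lemma weight_eq:
  assumes "loc_integrable b" "0 \<le> x"
  shows "weight b x = exp (integral {0..x} b - integral {0..1} b)"
  unfolding weight_def using interval_lebesgue_integral_half_line[OF assms(1), of 1 x] assms(2)
  by (simp add: one_ereal_def)

lemma weight_pos: "weight b x > 0"
  by (simp add: weight_def)

lemma weight_continuous:
  assumes b: "loc_integrable b" shows "continuous_on {0..} (weight b)"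
proof -
  have "continuous_on {0..} (\<lambda>x. integral {0..x} b)"
    unfolding continuous_on_eq_continuous_within
  proof
    fix x :: real assume "x \<in> {0..}"
    moreover have "continuous_on {0..x + 1} (\<lambda>x. integral {0..x} b)"
      by (intro indefinite_integral_continuous_1 loc_integrable_imp_integrable_on b) simp
    ultimately have "continuous (at x within {0..x + 1}) (\<lambda>x. integral {0..x} b)"
      unfolding continuous_on_eq_continuous_within by simp
    then show "continuous (at x within {0..}) (\<lambda>x. integral {0..x} b)"
      using at_within_half_line[of x "x + 1"] by simp
  qed
  then have "continuous_on {0..} (\<lambda>x. exp (integral {0..x} b - integral {0..1} b))"
    by (intro continuous_intros)
  then show ?thesis by (rule continuous_on_eq) (simp add: weight_eq[OF b])
qed

lemma speed_fun_eq:
  assumes "loc_integrable b" "0 \<le> x"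
  shows "speed_fun b x = 2 * integral {0..x} (weight b)"
  unfolding speed_fun_def
  using interval_lebesgue_integral_half_line[OF loc_integrable_continuous[OF weight_continuous[OF assms(1)]], of 0 x] assms(2)
  by (simp add: zero_ereal_def)

lemma speed_fun_deriv:
  assumes "loc_integrable b" "0 \<le> x"
  shows "(speed_fun b has_real_derivative 2 * weight b x) (at x within {0..})"
proof -
  have "((\<lambda>x. 2 * integral {0..x} (weight b)) has_real_derivative 2 * weight b x) (at x within {0..})"
    by (intro DERIV_cmult integral_half_line_deriv weight_continuous assms)
  then show ?thesis
    by (rule has_field_derivative_transform_within[OF _ zero_less_one]) (use assms in \<open>auto simp: speed_fun_eq\<close>)
qed

lemma scale_fun_deriv:
  assumes b: "loc_integrable b" and x: "0 \<le> x"
  shows "(scale_fun b has_real_derivative 1 / weight b x) (at x within {0..})"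
proof -
  have c: "continuous_on {0..} (\<lambda>x. 1 / weight b x)"
    using weight_pos[of b] by (intro continuous_intros weight_continuous b) (simp add: less_imp_neq[symmetric])
  have eq: "scale_fun b y = integral {0..y} (\<lambda>u. 1 / weight b u) - integral {0..1} (\<lambda>u. 1 / weight b u)" if "y \<ge> 0" for y
    unfolding scale_fun_def
    using interval_lebesgue_integral_half_line[OF loc_integrable_continuous[OF c], of 1 y] that
    by (simp add: one_ereal_def)
  have "((\<lambda>y. integral {0..y} (\<lambda>u. 1 / weight b u) - integral {0..1} (\<lambda>u. 1 / weight b u)) has_real_derivative 1 / weight b x - 0) (at x within {0..})"
    by (intro DERIV_diff DERIV_const integral_half_line_deriv c x)
  then have "((\<lambda>y. integral {0..y} (\<lambda>u. 1 / weight b u) - integral {0..1} (\<lambda>u. 1 / weight b u)) has_real_derivative 1 / weight b x) (at x within {0..})"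
    by simp
  then show ?thesis
    by (rule has_field_derivative_transform_within[OF _ zero_less_one]) (use x in \<open>auto simp: eq\<close>)
qed

text \<open>The difference quotient of \<open>f\<close> with respect to \<open>u\<close> is the
  quotient of two ordinary ones; strict monotonicity of \<open>u\<close> keeps the denominators
  nonzero.\<close>

lemma has_deriv_wrt_iff:
  assumes u: "\<And>x. x \<ge> 0 \<Longrightarrow> (u has_real_derivative u' x) (at x within {0..})"
    and u': "\<And>x. x \<ge> 0 \<Longrightarrow> u' x > 0" and x: "x \<ge> 0"
  shows "has_deriv_wrt f u D x \<longleftrightarrow> (f has_real_derivative D * u' x) (at x within {0..})"
proof -
  have mono: "u y < u z" if "0 \<le> y" "y < z" for y z
    by (rule half_line_less[where f'=u']) (use that u u' in auto)
  have ne: "u y \<noteq> u x" if "y \<ge> 0" "y \<noteq> x" for y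
    using mono[of x y] mono[of y x] that x by (cases "x < y") auto
  have ev: "\<forall>\<^sub>F y in at x within {0..}. y \<ge> 0 \<and> y \<noteq> x"
    by (auto simp: eventually_at intro: exI[of _ 1])
  have ulim: "((\<lambda>y. (u y - u x) / (y - x)) \<longlongrightarrow> u' x) (at x within {0..})"
    using u[OF x] by (simp add: has_field_derivative_iff)
  show ?thesis
  proof
    assume "has_deriv_wrt f u D x"
    then have "((\<lambda>y. (f y - f x) / (u y - u x) * ((u y - u x) / (y - x))) \<longlongrightarrow> D * u' x) (at x within {0..})"
      unfolding has_deriv_wrt_def by (intro tendsto_mult ulim)
    then have "((\<lambda>y. (f y - f x) / (y - x)) \<longlongrightarrow> D * u' x) (at x within {0..})"
      by (rule Lim_transform_eventually) (use ev in eventually_elim, use ne in auto)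
    then show "(f has_real_derivative D * u' x) (at x within {0..})"
      by (simp add: has_field_derivative_iff)
  next
    assume "(f has_real_derivative D * u' x) (at x within {0..})"
    then have "((\<lambda>y. (f y - f x) / (y - x) / ((u y - u x) / (y - x))) \<longlongrightarrow> D * u' x / u' x) (at x within {0..})"
      using u'[OF x] by (intro tendsto_divide ulim) (auto simp: has_field_derivative_iff)
    then have "((\<lambda>y. (f y - f x) / (u y - u x)) \<longlongrightarrow> D * u' x / u' x) (at x within {0..})"
      by (rule Lim_transform_eventually) (use ev in eventually_elim, use ne in auto)
    then show "has_deriv_wrt f u D x"
      using u'[OF x] by (simp add: has_deriv_wrt_def)
  qed
qed

text \<open>The flux \<open>h = df/ds\<close> is kept as a separate function: for a merely
  integrable drift the weight may fail to be differentiable, and \<open>f\<close> need not have a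
  second derivative.\<close>

lemma reflecting_L_iff:
  assumes b: "loc_integrable b"
  shows "reflecting_L b f g \<longleftrightarrow>
    (\<exists>h. (\<forall>x\<ge>0. (f has_real_derivative h x / weight b x) (at x within {0..})) \<and>
         (\<forall>x\<ge>0. (h has_real_derivative 2 * weight b x * g x) (at x within {0..})) \<and> h 0 = 0)"
proof -
  have 1: "has_deriv_wrt f (scale_fun b) D x \<longleftrightarrow> (f has_real_derivative D / weight b x) (at x within {0..})"
    if "x \<ge> 0" for f D x
    using has_deriv_wrt_iff[OF scale_fun_deriv[OF b] _ that, of f D] weight_pos by simp
  have 2: "has_deriv_wrt f (speed_fun b) D x \<longleftrightarrow> (f has_real_derivative 2 * weight b x * D) (at x within {0..})"
    if "x \<ge> 0" for f D x
    using has_deriv_wrt_iff[OF speed_fun_deriv[OF b] _ that, of f D] weight_pos by (simp add: mult.commute)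
  show ?thesis unfolding reflecting_L_def using 1 2 by (metis (no_types, lifting))
qed

text \<open>The left-hand side is the absolute value of the integral of
  \<open>\<epsilon> x / x + \<eta> x\<close> over \<open>[u, v]\<close>. The first part is at most
  \<open>\<delta> * (ln v - ln u)\<close>; the second is a difference of two values of a convergent
  function, each within \<open>\<delta> / 2\<close> of \<open>A\<close>.\<close>

lemma weight_regular:
  assumes b: "loc_integrable b" and \<eta>: "loc_integrable \<eta>"
    and drift: "\<And>x. x \<ge> 1 \<Longrightarrow> b x = (-1 + \<epsilon> x) / x + \<eta> x"
    and \<epsilon>: "(\<epsilon> \<longlongrightarrow> 0) at_top"
    and A: "((\<lambda>x::real. LINT u=1..x|lebesgue. \<eta> u) \<longlongrightarrow> A) at_top"
    and \<delta>: "\<delta> > 0"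
  shows "\<exists>x0>0. \<forall>u\<ge>x0. \<forall>v\<ge>u.
    \<bar>ln (weight b v) - ln (weight b u) + (ln v - ln u)\<bar> \<le> \<delta> * (1 + (ln v - ln u))"
proof -
  have "\<forall>\<^sub>F x in at_top. \<bar>\<epsilon> x\<bar> < \<delta>"
    using tendstoD[OF \<epsilon> \<delta>] by (simp add: dist_real_def)
  moreover have "\<forall>\<^sub>F x::real in at_top. \<bar>(LINT u=1..x|lebesgue. \<eta> u) - A\<bar> < \<delta> / 2"
    using tendstoD[OF A, of "\<delta> / 2"] \<delta> by (simp add: dist_real_def)
  ultimately have "\<forall>\<^sub>F x::real in at_top. \<bar>\<epsilon> x\<bar> < \<delta> \<and> \<bar>(LINT u=1..x|lebesgue. \<eta> u) - A\<bar> < \<delta> / 2"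
    by eventually_elim simp
  then obtain y0 where y0: "\<And>x::real. x \<ge> y0 \<Longrightarrow> \<bar>\<epsilon> x\<bar> < \<delta>"
    "\<And>x::real. x \<ge> y0 \<Longrightarrow> \<bar>(LINT u=1..x|lebesgue. \<eta> u) - A\<bar> < \<delta> / 2"
    unfolding eventually_at_top_linorder by blast
  show ?thesis
  proof (intro exI[of _ "max 1 y0"] conjI allI impI)
    fix u v assume uv: "max 1 y0 \<le> u" "u \<le> v"
    then have u: "u \<ge> 1" "u \<ge> y0" and v: "v \<ge> 1" "v \<ge> y0" by auto
    have ib: "b integrable_on {u..v}" and i\<eta>: "\<eta> integrable_on {u..v}"
      using b \<eta> u by (auto intro: loc_integrable_imp_integrable_on)
    have inv: "((\<lambda>x. 1 / x) has_integral ln v - ln u) {u..v}"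
      using u by (intro fundamental_theorem_of_calculus uv)
        (auto intro!: derivative_eq_intros simp flip: has_real_derivative_iff_has_vector_derivative)
    have "((\<lambda>x. b x + 1 / x - \<eta> x) has_integral integral {u..v} b + (ln v - ln u) - integral {u..v} \<eta>) {u..v}"
      by (intro has_integral_add has_integral_diff integrable_integral ib i\<eta> inv)
    then have e: "((\<lambda>x. \<epsilon> x / x) has_integral integral {u..v} b + (ln v - ln u) - integral {u..v} \<eta>) {u..v}"
      by (rule has_integral_eq[rotated]) (use u in \<open>auto simp: drift field_simps\<close>)
    have "norm (integral {u..v} (\<lambda>x. \<epsilon> x / x)) \<le> integral {u..v} (\<lambda>x. \<delta> * (1 / x))"
    proof (rule integral_norm_bound_integral)
      show "(\<lambda>x. \<epsilon> x / x) integrable_on {u..v}" using e by blast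
      show "(\<lambda>x. \<delta> * (1 / x)) integrable_on {u..v}" using has_integral_mult_right[OF inv] by blast
      fix x assume "x \<in> {u..v}"
      then show "norm (\<epsilon> x / x) \<le> \<delta> * (1 / x)"
        using y0(1)[of x] u by (simp add: abs_divide divide_right_mono)
    qed
    also have "\<dots> = \<delta> * (ln v - ln u)"
      by (rule integral_unique[OF has_integral_mult_right[OF inv]])
    finally have 1: "\<bar>integral {u..v} b + (ln v - ln u) - integral {u..v} \<eta>\<bar> \<le> \<delta> * (ln v - ln u)"
      using integral_unique[OF e] by simp
    have comb: "integral {u..v} f = integral {0..v} f - integral {0..u} f" if "loc_integrable f" for f
      using Henstock_Kurzweil_Integration.integral_combine[of 0 u v f] u uv
        loc_integrable_imp_integrable_on[OF that, of 0 v] by simp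
    have "integral {u..v} \<eta> = (LINT t=1..v|lebesgue. \<eta> t) - (LINT t=1..u|lebesgue. \<eta> t)"
      using interval_lebesgue_integral_half_line[OF \<eta>, of 1 v] interval_lebesgue_integral_half_line[OF \<eta>, of 1 u] u v
      by (simp add: comb[OF \<eta>] one_ereal_def)
    then have 2: "\<bar>integral {u..v} \<eta>\<bar> \<le> \<delta>"
      using y0(2)[OF u(2)] y0(2)[OF v(2)] by linarith
    have "ln (weight b v) - ln (weight b u) = integral {u..v} b"
      using u v by (simp add: weight_eq[OF b] comb[OF b])
    then show "\<bar>ln (weight b v) - ln (weight b u) + (ln v - ln u)\<bar> \<le> \<delta> * (1 + (ln v - ln u))"
      unfolding distrib_left using 1 2 by linarith
  qed simp
qed

section \<open>Integration against the speed measure\<close>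

lemma at_within_half_line_interior: "(x::real) > 0 \<Longrightarrow> at x within {0..} = at x"
  by (rule at_within_interior) (simp add: interior_real_atLeast)

lemma continuous_on_max_half_line:
  fixes f :: "real \<Rightarrow> real"
  assumes "continuous_on {0..} f" shows "continuous_on UNIV (\<lambda>x. f (max 0 x))"
  by (rule continuous_on_compose2[OF assms]) (auto intro!: continuous_intros)

lemma borel_measurable_max_half_line:
  fixes f :: "real \<Rightarrow> real"
  assumes "continuous_on {0..} f" shows "(\<lambda>x. f (max 0 x)) \<in> borel_measurable borel"
  using continuous_on_max_half_line[OF assms] by (rule borel_measurable_continuous_onI)

text \<open>\<open>- exp (- u) * F u\<close> is an antiderivative of
  \<open>exp (- u) * (F u - F' u)\<close>. This is the integration by parts in time behind the
  Laplace transforms below.\<close>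

lemma exp_law_FTC:
  fixes F F' :: "real \<Rightarrow> real"
  assumes d: "\<And>u. u \<ge> 0 \<Longrightarrow> (F has_real_derivative F' u) (at u within {0..})"
    and c: "continuous_on {0..} F'"
    and B: "\<And>u. u \<ge> 0 \<Longrightarrow> \<bar>F u\<bar> \<le> B" and B': "\<And>u. u \<ge> 0 \<Longrightarrow> \<bar>F' u\<bar> \<le> B'"
  shows "(\<integral>u. F (max 0 u) - F' (max 0 u) \<partial>exp_law) = F 0"
proof -
  define G where "G u = F (max 0 u) - F' (max 0 u)" for u
  define k where "k u = exp (- u) * (F u - F' u)" for u
  define K where "K u = - exp (- u) * F u" for u
  have cF: "continuous_on {0..} F"
    by (rule DERIV_continuous_on[where D=F']) (use d in auto)
  have [measurable]: "G \<in> borel_measurable borel"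
    unfolding G_def using borel_measurable_max_half_line[OF cF] borel_measurable_max_half_line[OF c] by measurable
  have "integrable exp_law G"
    by (rule integrable_exp_law[where B="B + B'"])
       (auto simp: G_def intro!: order.trans[OF abs_triangle_ineq4] add_mono B B')
  then have int: "integrable lborel (\<lambda>u. exponential_density 1 u * G u)"
    unfolding exp_law_def
    by (subst (asm) integrable_density) (auto simp: exponential_density_def)
  have ae: "AE u in lborel. exponential_density 1 u * G u = indicator {0<..} u *\<^sub>R k u"
    using AE_lborel_singleton[of 0]
    by eventually_elim (auto simp: exponential_density_def indicator_def G_def k_def)
  have ck: "continuous_on {0..} k"
    unfolding k_def by (intro continuous_intros cF c)
  have mk: "(\<lambda>u. indicator {0<..} u *\<^sub>R k u) \<in> borel_measurable borel"
    by (rule borel_measurable_continuous_on_indicator) (auto intro: continuous_on_subset[OF ck])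
  have "set_integrable lborel {0<..} k"
    unfolding set_integrable_def
    by (rule integrable_cong_AE_imp[OF int]) (use mk ae in \<open>auto elim: eventually_mono\<close>)
  then have ik: "set_integrable lborel (einterval 0 \<infinity>) k"
    by (simp add: zero_ereal_def)
  have "(LBINT u=0..\<infinity>. k u) = 0 - (- F 0)"
  proof (rule interval_integral_FTC_integrable[OF _ _ _ ik])
    fix u assume "0 < ereal u"
    then have u: "u > 0" by simp
    have "(F has_real_derivative F' u) (at u)"
      using d[of u] u by (simp add: at_within_half_line_interior)
    then have "(K has_real_derivative k u) (at u)"
      unfolding K_def k_def by (auto intro!: derivative_eq_intros simp: algebra_simps)
    then show "(K has_vector_derivative k u) (at u)"
      by (simp add: has_real_derivative_iff_has_vector_derivative)
    show "isCont k u"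
      using ck u at_within_half_line_interior[OF u] by (metis atLeast_iff continuous_on_eq_continuous_within less_imp_le)
  next
    have "continuous_on {0..} K" unfolding K_def by (intro continuous_intros cF)
    then have "(K \<longlongrightarrow> K 0) (at 0 within {0..})" by (simp add: continuous_on_def)
    then have "(K \<longlongrightarrow> - F 0) (at_right 0)"
      unfolding K_def by (auto intro: tendsto_within_subset)
    then show "((K \<circ> real_of_ereal) \<longlongrightarrow> - F 0) (at_right 0)"
      unfolding zero_ereal_def ereal_tendsto_simps .
    have "(K \<longlongrightarrow> 0) at_top"
    proof (rule Lim_null_comparison)
      show "\<forall>\<^sub>F u in at_top. norm (K u) \<le> B * exp (- u)"
        using eventually_ge_at_top[of 0]
        by eventually_elim (use B in \<open>auto simp: K_def abs_mult mult.commute intro!: mult_right_mono\<close>)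
      have "((\<lambda>u::real. exp (- u)) \<longlongrightarrow> 0) at_top"
        by (rule filterlim_compose[OF exp_at_bot filterlim_uminus_at_bot_at_top])
      then show "((\<lambda>u. B * exp (- u)) \<longlongrightarrow> 0) at_top" by (rule tendsto_mult_right_zero)
    qed
    then show "((K \<circ> real_of_ereal) \<longlongrightarrow> 0) (at_left \<infinity>)"
      unfolding ereal_tendsto_simps .
  qed simp
  moreover have "(LBINT u=0..\<infinity>. k u) = (\<integral>u. indicator {0<..} u *\<^sub>R k u \<partial>lborel)"
    by (simp add: interval_lebesgue_integral_def set_lebesgue_integral_def zero_ereal_def)
  moreover have "\<dots> = (\<integral>u. exponential_density 1 u * G u \<partial>lborel)"
    by (rule integral_cong_AE) (use mk ae in \<open>auto elim: eventually_mono\<close>)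
  moreover have "\<dots> = (\<integral>u. G u \<partial>exp_law)"
    by (rule integral_exp_law[symmetric]) simp
  ultimately show ?thesis by (simp add: G_def)
qed

text \<open>Dominated convergence for difference quotients: on a convex \<open>S\<close> the bound
  on \<open>u'\<close> bounds them by \<open>B\<close>, and a constant is integrable because the
  measure is finite. Derivatives within \<open>S\<close> include one-sided ones at its end
  points.\<close>

lemma (in finite_measure) has_derivative_integral:
  fixes u u' :: "real \<Rightarrow> 'a \<Rightarrow> real"
  assumes S: "convex S" "t \<in> S"
    and m: "\<And>t. t \<in> S \<Longrightarrow> u t \<in> borel_measurable M" "u' t \<in> borel_measurable M"
    and int: "\<And>t. t \<in> S \<Longrightarrow> integrable M (u t)"
    and d: "\<And>t x. t \<in> S \<Longrightarrow> x \<in> space M \<Longrightarrow> ((\<lambda>t. u t x) has_real_derivative u' t x) (at t within S)"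
    and B: "\<And>t x. t \<in> S \<Longrightarrow> x \<in> space M \<Longrightarrow> \<bar>u' t x\<bar> \<le> B"
  shows "((\<lambda>t. \<integral>x. u t x \<partial>M) has_real_derivative (\<integral>x. u' t x \<partial>M)) (at t within S)"
  unfolding has_field_derivative_iff tendsto_at_iff_sequentially comp_def
proof (intro allI impI)
  fix X :: "nat \<Rightarrow> real"
  assume XS: "\<forall>i. X i \<in> S - {t}" and X: "X \<longlonglongrightarrow> t"
  have "(\<lambda>i. \<integral>x. (u (X i) x - u t x) / (X i - t) \<partial>M) \<longlonglongrightarrow> (\<integral>x. u' t x \<partial>M)"
  proof (rule integral_dominated_convergence[where w="\<lambda>_. B"])
    show "AE x in M. (\<lambda>i. (u (X i) x - u t x) / (X i - t)) \<longlonglongrightarrow> u' t x"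
    proof (rule AE_I2)
      fix x assume "x \<in> space M"
      then show "(\<lambda>i. (u (X i) x - u t x) / (X i - t)) \<longlonglongrightarrow> u' t x"
        using d[OF S(2), of x] XS X unfolding has_field_derivative_iff tendsto_at_iff_sequentially comp_def by blast
    qed
    show "AE x in M. norm ((u (X i) x - u t x) / (X i - t)) \<le> B" for i
    proof (rule AE_I2)
      fix x assume x: "x \<in> space M"
      have "norm (u (X i) x - u t x) \<le> B * norm (X i - t)"
        by (rule field_differentiable_bound[OF S(1), where f'="\<lambda>t. u' t x"]) (use d B x XS S in auto)
      then show "norm ((u (X i) x - u t x) / (X i - t)) \<le> B"
        using XS by (simp add: field_simps)
    qed
    show "(\<lambda>x. (u (X i) x - u t x) / (X i - t)) \<in> borel_measurable M" for i
      using m(1)[of "X i"] m(1)[of t] XS S by (intro borel_measurable_divide borel_measurable_diff) auto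
  qed (use m in auto)
  moreover have "(\<integral>x. (u (X i) x - u t x) / (X i - t) \<partial>M) = ((\<integral>x. u (X i) x \<partial>M) - (\<integral>x. u t x \<partial>M)) / (X i - t)" for i
    using int[of "X i"] int[of t] XS S by simp
  ultimately show "(\<lambda>i. ((\<integral>x. u (X i) x \<partial>M) - (\<integral>x. u t x \<partial>M)) / (X i - t)) \<longlonglongrightarrow> (\<integral>x. u' t x \<partial>M)"
    by (simp only:)
qed

section \<open>Integrals against the speed measure as boundary values at infinity\<close>

context speed_weight
begin

abbreviation speed :: "real measure" where
  "speed \<equiv> density (restrict_space lborel {0..}) (\<lambda>x. ennreal (2 * W x))"

lemma space_speed [simp]: "space speed = {0..}"
  by (simp add: space_restrict_space)

lemma borel_measurable_restrict_half_line:
  "continuous_on {0..} g \<Longrightarrow> g \<in> borel_measurable (restrict_space lborel {0..})" for g :: "real \<Rightarrow> real"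
  using borel_measurable_continuous_on_restrict[of "{0..}" g]
  by (simp cong: measurable_cong_sets add: sets_restrict_space)

lemma borel_measurable_speed:
  "continuous_on {0..} g \<Longrightarrow> g \<in> borel_measurable speed" for g :: "real \<Rightarrow> real"
  using borel_measurable_restrict_half_line by simp

lemma
  fixes g :: "real \<Rightarrow> real"
  assumes g: "continuous_on {0..} g"
  shows integrable_speed_iff: "integrable speed g \<longleftrightarrow> integrable lborel (\<lambda>x. indicator {0..} x *\<^sub>R (2 * W x * g x))"
    and integral_speed: "(\<integral>x. g x \<partial>speed) = (\<integral>x. indicator {0..} x *\<^sub>R (2 * W x * g x) \<partial>lborel)"
proof -
  note [measurable] = borel_measurable_restrict_half_line[OF g] borel_measurable_restrict_half_line[OF W_cont]
  have nn: "AE x in restrict_space lborel {0..}. 0 \<le> 2 * W x"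
    using W_pos by (intro AE_I2) (auto simp: space_restrict_space less_imp_le)
  show "integrable speed g \<longleftrightarrow> integrable lborel (\<lambda>x. indicator {0..} x *\<^sub>R (2 * W x * g x))"
    using nn by (subst integrable_density) (auto simp: integrable_restrict_space)
  show "(\<integral>x. g x \<partial>speed) = (\<integral>x. indicator {0..} x *\<^sub>R (2 * W x * g x) \<partial>lborel)"
    using nn by (subst integral_density) (auto simp: integral_restrict_space)
qed

text \<open>The nonnegative density has the antiderivative \<open>- tail\<close>, which converges at
  infinity.\<close>

lemma finite_measure_speed: "finite_measure speed"
proof -
  have int: "set_integrable lborel (einterval 0 \<infinity>) (\<lambda>x. 2 * W x)"
  proof (rule interval_integral_FTC_nonneg(1)[where F="\<lambda>x. - tail x"])
    fix x assume "0 < ereal x"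
    then have x: "x > 0" by simp
    show "((\<lambda>x. - tail x) has_real_derivative 2 * W x) (at x)"
      using tail_deriv[of x] x by (auto intro!: derivative_eq_intros simp: at_within_half_line_interior)
    have "isCont W x"
      using W_cont x at_within_half_line_interior[OF x] by (metis atLeast_iff continuous_on_eq_continuous_within less_imp_le)
    then show "isCont (\<lambda>x. 2 * W x) x" by (intro continuous_intros)
  next
    show "AE x in lborel. 0 < ereal x \<longrightarrow> ereal x < \<infinity> \<longrightarrow> 0 \<le> 2 * W x"
      using W_pos by (intro AE_I2) (auto simp: less_imp_le)
    have "((\<lambda>x. - tail x) \<longlongrightarrow> - tail 0) (at 0 within {0..})"
      using tail_cont unfolding continuous_on_def by (intro tendsto_minus) (meson atLeast_iff order_refl)
    then have "((\<lambda>x. - tail x) \<longlongrightarrow> - tail 0) (at_right 0)"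
      by (rule tendsto_within_subset) auto
    then show "(((\<lambda>x. - tail x) \<circ> real_of_ereal) \<longlongrightarrow> - tail 0) (at_right 0)"
      unfolding zero_ereal_def ereal_tendsto_simps .
    show "(((\<lambda>x. - tail x) \<circ> real_of_ereal) \<longlongrightarrow> - 0) (at_left \<infinity>)"
      unfolding ereal_tendsto_simps by (intro tendsto_minus tail_tendsto)
  qed simp
  have m: "(\<lambda>x. indicator {0..} x *\<^sub>R (2 * W x)) \<in> borel_measurable borel"
    by (rule borel_measurable_continuous_on_indicator) (auto intro!: continuous_intros W_cont)
  have "integrable lborel (\<lambda>x. indicator {0..} x *\<^sub>R (2 * W x))"
    by (rule integrable_cong_AE_imp[OF int[unfolded set_integrable_def]])
       (use m AE_lborel_singleton[of 0] in \<open>auto simp: zero_ereal_def indicator_def elim!: eventually_mono\<close>)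
  then have "integrable speed (\<lambda>x. 1 :: real)"
    by (subst integrable_speed_iff) auto
  then have "integrable speed (indicator {0..} :: real \<Rightarrow> real)"
    by (rule Bochner_Integration.integrable_cong[THEN iffD1, rotated -1]) auto
  then have "emeasure speed {0..} < \<infinity>"
    using integrable_indicator_iff[of speed "{0..}"] by simp
  then show ?thesis by (intro finite_measureI) auto
qed

sublocale speed: finite_measure speed
  by (rule finite_measure_speed)

lemma integrable_speed:
  fixes g :: "real \<Rightarrow> real"
  assumes "continuous_on {0..} g" "\<And>x. x \<ge> 0 \<Longrightarrow> \<bar>g x\<bar> \<le> B"
  shows "integrable speed g"
  by (rule speed.integrable_const_bound[where B=B])
     (use assms in \<open>auto intro!: AE_I2 borel_measurable_restrict_half_line\<close>)

lemma speed_integral_tendsto: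
  fixes g :: "real \<Rightarrow> real"
  assumes g: "continuous_on {0..} g" and B: "\<And>x. x \<ge> 0 \<Longrightarrow> \<bar>g x\<bar> \<le> B"
  shows "((\<lambda>R. integral {0..R} (\<lambda>x. 2 * W x * g x)) \<longlongrightarrow> (\<integral>x. g x \<partial>speed)) at_top"
proof -
  have int: "integrable lborel (\<lambda>x. indicator {0..} x *\<^sub>R (2 * W x * g x))"
    using integrable_speed[OF g B] integrable_speed_iff[OF g] by simp
  have c: "continuous_on {0..} (\<lambda>x. 2 * W x * g x)" by (intro continuous_intros W_cont g)
  have eq: "integral {0..R} (\<lambda>x. 2 * W x * g x) = (\<integral>x. indicator {0..R} x *\<^sub>R (2 * W x * g x) \<partial>lborel)" for R
  proof -
    have *: "set_integrable lborel {0..R} (\<lambda>x. 2 * W x * g x)"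
      unfolding set_integrable_def by (rule borel_integrable_compact) (auto intro: continuous_on_subset[OF c])
    show ?thesis
      using set_borel_integral_eq_integral(2)[OF *] by (simp add: set_lebesgue_integral_def)
  qed
  have "((\<lambda>R. \<integral>x. indicator {0..R} x *\<^sub>R (2 * W x * g x) \<partial>lborel) \<longlongrightarrow>
      (\<integral>x. indicator {0..} x *\<^sub>R (2 * W x * g x) \<partial>lborel)) at_top"
  proof (rule integral_dominated_convergence_at_top[where w="\<lambda>x. norm (indicator {0..} x *\<^sub>R (2 * W x * g x))"])
    show "(\<lambda>x. indicator {0..} x *\<^sub>R (2 * W x * g x)) \<in> borel_measurable lborel"
      using int by (rule borel_measurable_integrable)
    show "(\<lambda>x. indicator {0..R} x *\<^sub>R (2 * W x * g x)) \<in> borel_measurable lborel" for R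
      using borel_measurable_continuous_on_indicator[OF _ continuous_on_subset[OF c, of "{0..R}"]] by simp
    show "AE x in lborel. ((\<lambda>R. indicator {0..R} x *\<^sub>R (2 * W x * g x)) \<longlongrightarrow> indicator {0..} x *\<^sub>R (2 * W x * g x)) at_top"
    proof (rule AE_I2)
      fix x :: real
      show "((\<lambda>R. indicator {0..R} x *\<^sub>R (2 * W x * g x)) \<longlongrightarrow> indicator {0..} x *\<^sub>R (2 * W x * g x)) at_top"
        by (rule tendsto_eventually, rule eventually_at_top_linorderI[of x]) (auto simp: indicator_def)
    qed
    show "\<forall>\<^sub>F R in at_top. AE x in lborel. norm (indicator {0..R} x *\<^sub>R (2 * W x * g x)) \<le> norm (indicator {0..} x *\<^sub>R (2 * W x * g x))"
      by (auto simp: indicator_def)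
  qed (use int in auto)
  then show ?thesis by (simp add: eq integral_speed[OF g])
qed

lemma speed_integral_antiderivative_tendsto:
  fixes g H :: "real \<Rightarrow> real"
  assumes g: "continuous_on {0..} g" and B: "\<And>x. x \<ge> 0 \<Longrightarrow> \<bar>g x\<bar> \<le> B"
    and H: "\<And>x. x \<ge> 0 \<Longrightarrow> (H has_real_derivative 2 * W x * g x) (at x within {0..})"
  shows "(H \<longlongrightarrow> H 0 + (\<integral>x. g x \<partial>speed)) at_top"
proof -
  have eq: "H 0 + integral {0..R} (\<lambda>x. 2 * W x * g x) = H R" if "R \<ge> 0" for R
  proof -
    have *: "((\<lambda>x. 2 * W x * g x) has_integral H R - H 0) {0..R}"
    proof (rule fundamental_theorem_of_calculus[OF that])
      fix x assume x: "x \<in> {0..R}"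
      then have "(H has_real_derivative 2 * W x * g x) (at x within {0..R})"
        by (intro has_field_derivative_subset[OF H]) auto
      then show "(H has_vector_derivative 2 * W x * g x) (at x within {0..R})"
        by (simp add: has_real_derivative_iff_has_vector_derivative)
    qed
    show ?thesis unfolding integral_unique[OF *] by simp
  qed
  have "((\<lambda>R. H 0 + integral {0..R} (\<lambda>x. 2 * W x * g x)) \<longlongrightarrow> H 0 + (\<integral>x. g x \<partial>speed)) at_top"
    by (intro tendsto_add tendsto_const speed_integral_tendsto[OF g B])
  then show ?thesis
    by (rule Lim_transform_eventually) (rule eventually_at_top_linorderI[of 0], rule eq)
qed

lemma speed_integral_FTC:
  fixes g H :: "real \<Rightarrow> real"
  assumes g: "continuous_on {0..} g" and B: "\<And>x. x \<ge> 0 \<Longrightarrow> \<bar>g x\<bar> \<le> B"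
    and H: "\<And>x. x \<ge> 0 \<Longrightarrow> (H has_real_derivative 2 * W x * g x) (at x within {0..})"
    and lim: "(H \<longlongrightarrow> l) at_top"
  shows "(\<integral>x. g x \<partial>speed) = l - H 0"
  using tendsto_unique[OF trivial_limit_at_top_linorder lim speed_integral_antiderivative_tendsto[OF g B H]] by simp

text \<open>A version for antiderivatives with a surplus \<open>k \<ge> 0\<close> in the derivative.
  It leaves the integrability of \<open>k\<close> open, which in the energy estimate is
  \<open>h^2 / W\<close>.\<close>

lemma speed_integral_le:
  fixes g H :: "real \<Rightarrow> real"
  assumes g: "continuous_on {0..} g" and B: "\<And>x. x \<ge> 0 \<Longrightarrow> \<bar>g x\<bar> \<le> B"
    and H: "\<And>x. x \<ge> 0 \<Longrightarrow> (H has_real_derivative 2 * W x * g x + k x) (at x within {0..})"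
    and k: "\<And>x. x \<ge> 0 \<Longrightarrow> k x \<ge> 0"
    and lim: "(H \<longlongrightarrow> l) at_top"
  shows "(\<integral>x. g x \<partial>speed) \<le> l - H 0"
proof (rule tendsto_le[OF trivial_limit_at_top_linorder _ speed_integral_tendsto[OF g B]])
  show "((\<lambda>R. H R - H 0) \<longlongrightarrow> l - H 0) at_top" by (intro tendsto_intros lim)
  show "\<forall>\<^sub>F R in at_top. integral {0..R} (\<lambda>x. 2 * W x * g x) \<le> H R - H 0"
  proof (rule eventually_at_top_linorderI[of 0])
    fix R :: real assume R: "0 \<le> R"
    let ?g = "\<lambda>R. H R - integral {0..R} (\<lambda>x. 2 * W x * g x)"
    have "?g 0 \<le> ?g R"
    proof (rule half_line_mono[where f="?g" and f'=k])
      fix x assume x: "0 \<le> x" "x \<le> R"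
      have "(?g has_real_derivative 2 * W x * g x + k x - 2 * W x * g x) (at x within {0..})"
        by (intro DERIV_diff H x integral_half_line_deriv continuous_intros W_cont g)
      then show "(?g has_real_derivative k x) (at x within {0..})" by simp
    qed (use R k in auto)
    then show "integral {0..R} (\<lambda>x. 2 * W x * g x) \<le> H R - H 0" by simp
  qed
qed

lemma speed_total: "(\<integral>x. 1 \<partial>speed) = m_inf"
proof -
  have "(\<integral>x. (1::real) \<partial>speed) = 0 - (- tail 0)"
    by (rule speed_integral_FTC[where B=1])
       (auto intro!: derivative_eq_intros tail_deriv tendsto_eq_intros tail_tendsto)
  then show ?thesis by simp
qed

text \<open>
  Since \<open>1 / W \<ge> 2 - W\<close>, a finite speed measure forces the scale of \<open>[0,\<infinity>)\<close> to be infinite; a flux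
  with a positive limit would make \<open>f\<close> unbounded.
\<close>

lemma flux_limit_not_pos:
  assumes f: "\<And>x. x \<ge> 0 \<Longrightarrow> (f has_real_derivative h x / W x) (at x within {0..})"
    and h: "(h \<longlongrightarrow> l) at_top" and B: "\<And>x. x \<ge> 0 \<Longrightarrow> f x \<le> B"
  shows "l \<le> 0"
proof (rule ccontr)
  assume "\<not> l \<le> 0"
  then have l: "l > 0" by simp
  then have "\<forall>\<^sub>F x in at_top. h x > l / 2" by (intro order_tendstoD[OF h]) simp
  then obtain y0 where y0: "\<And>x. x \<ge> y0 \<Longrightarrow> h x > l / 2" unfolding eventually_at_top_linorder by blast
  define x0 where "x0 = max 0 y0"
  \<comment> \<open>From \<open>h > l / 2\<close> and \<open>1 / W \<ge> 2 - W\<close> the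
    derivative of \<open>f\<close> is at least \<open>l - l / 2 * W\<close>. The comparison function
    subtracts an antiderivative of this bound, its second term through
    \<open>tail' = - 2 * W\<close>. As \<open>tail\<close> is positive, \<open>f\<close> grows at
    least like \<open>l * x\<close>.\<close>
  let ?g = "\<lambda>x. f x - l * x - l / 4 * tail x"
  have "?g x0 \<le> ?g x" if x: "x0 \<le> x" for x
  proof (rule half_line_mono[where f="?g" and f'="\<lambda>x. h x / W x - l + l / 2 * W x"])
    fix z assume z: "x0 \<le> z" "z \<le> x"
    then have z0: "z \<ge> 0" "z \<ge> y0" by (auto simp: x0_def)
    show "(?g has_real_derivative h z / W z - l + l / 2 * W z) (at z within {0..})"
      using z0 by (auto intro!: derivative_eq_intros f tail_deriv)
    have Wz: "W z > 0" using W_pos z0 by simp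
    have "0 \<le> l / 2 * (1 - W z)\<^sup>2 / W z" using l Wz by simp
    also have "\<dots> = l / 2 / W z - l + l / 2 * W z" using Wz by (simp add: power2_eq_square field_simps)
    also have "\<dots> \<le> h z / W z - l + l / 2 * W z"
      using y0[OF z0(2)] Wz by (intro add_right_mono diff_right_mono divide_right_mono) auto
    finally show "0 \<le> h z / W z - l + l / 2 * W z" .
  qed (use x in \<open>auto simp: x0_def\<close>)
  note g = this
  define x where "x = max x0 ((B + \<bar>?g x0\<bar> + 1) / l)"
  have x: "x \<ge> x0" "x \<ge> 0" "x \<ge> (B + \<bar>?g x0\<bar> + 1) / l" by (auto simp: x_def x0_def)
  have "l / 4 * tail x \<ge> 0" using tail_pos[OF x(2)] l by simp
  moreover have "l * x \<ge> B + \<bar>?g x0\<bar> + 1" using x(3) l by (simp add: field_simps)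
  ultimately show False using g[OF x(1)] B[OF x(2)] by linarith
qed

end

section \<open>The Feller semigroup and its resolvent\<close>

lemma space_half_line [simp]: "space half_line = {0..}"
  by (simp add: half_line_def space_restrict_space)

lemma borel_measurable_half_line:
  "continuous_on {0..} f \<Longrightarrow> f \<in> borel_measurable half_line" for f :: "real \<Rightarrow> real"
  unfolding half_line_def by (rule borel_measurable_continuous_on_restrict)

lemma C0_bounded:
  assumes "C0 f" obtains B where "B \<ge> 0" "\<And>x. x \<ge> 0 \<Longrightarrow> \<bar>f x\<bar> \<le> B"
proof -
  have c: "continuous_on {0..} f" and l: "(f \<longlongrightarrow> 0) at_top" using assms by (auto simp: C0_def)
  have "\<forall>\<^sub>F x in at_top. \<bar>f x\<bar> < 1" using tendstoD[OF l, of 1] by (simp add: dist_real_def)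
  then obtain N where N: "\<And>x. x \<ge> N \<Longrightarrow> \<bar>f x\<bar> < 1" unfolding eventually_at_top_linorder by blast
  have "bounded (f ` {0..N})"
    by (intro compact_imp_bounded compact_continuous_image continuous_on_subset[OF c]) auto
  then obtain C where C: "\<And>x. x \<in> {0..N} \<Longrightarrow> \<bar>f x\<bar> \<le> C"
    unfolding bounded_iff real_norm_def by blast
  show ?thesis
  proof (rule that[of "max 1 C"])
    fix x :: real assume "x \<ge> 0"
    then show "\<bar>f x\<bar> \<le> max 1 C" using N[of x] C[of x] by (cases "x \<ge> N") auto
  qed simp
qed

lemma C0_linear: "C0 f \<Longrightarrow> C0 g \<Longrightarrow> C0 (\<lambda>x. c * f x + d * g x)"
  unfolding C0_def by (auto intro!: continuous_intros tendsto_eq_intros)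

section \<open>The semigroup on C0 and its time derivative\<close>

context reflecting_diffusion
begin

lemma prob_P: "x \<ge> 0 \<Longrightarrow> prob_space (P x)" and sets_P: "x \<ge> 0 \<Longrightarrow> sets (P x) = sets \<Omega>"
  using measurable_space[OF kernel, of x] by (auto simp: space_prob_algebra)

lemma space_P: "x \<ge> 0 \<Longrightarrow> space (P x) = space \<Omega>"
  using sets_eq_imp_space_eq[OF sets_P] .

lemma X_nonneg: "t \<ge> 0 \<Longrightarrow> \<omega> \<in> space \<Omega> \<Longrightarrow> X t \<omega> \<ge> 0"
  using measurable_space[OF measurable_X, of t \<omega>] by simp

lemma measurable_C0_X:
  assumes "C0 f" "t \<ge> 0" "x \<ge> 0" shows "(\<lambda>\<omega>. f (X t \<omega>)) \<in> borel_measurable (P x)"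
proof -
  have "(\<lambda>\<omega>. f (X t \<omega>)) \<in> borel_measurable \<Omega>"
    using assms by (intro measurable_compose[OF measurable_X borel_measurable_half_line]) (auto simp: C0_def)
  then show ?thesis using measurable_cong_sets[OF sets_P[OF assms(3)] refl] by blast
qed

lemma integrable_C0_X:
  assumes f: "C0 f" and t: "t \<ge> 0" and x: "x \<ge> 0" shows "integrable (P x) (\<lambda>\<omega>. f (X t \<omega>))"
proof -
  interpret prob_space "P x" by (rule prob_P[OF x])
  obtain B where "\<And>x. x \<ge> 0 \<Longrightarrow> \<bar>f x\<bar> \<le> B" using C0_bounded[OF f] by metis
  then show ?thesis
    by (intro integrable_const_bound[where B=B] measurable_C0_X f t x AE_I2)
       (auto simp: space_P[OF x] X_nonneg[OF t])
qed

abbreviation T :: "real \<Rightarrow> (real \<Rightarrow> real) \<Rightarrow> real \<Rightarrow> real" where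
  "T \<equiv> transition_op P X"

lemma T_bound:
  assumes f: "C0 f" and B: "\<And>x. x \<ge> 0 \<Longrightarrow> \<bar>f x\<bar> \<le> B" and t: "t \<ge> 0" and x: "x \<ge> 0"
  shows "\<bar>T t f x\<bar> \<le> B"
proof -
  interpret prob_space "P x" by (rule prob_P[OF x])
  have "\<bar>T t f x\<bar> \<le> (\<integral>\<omega>. B \<partial>P x)"
    unfolding transition_op_def
  proof (rule order.trans[OF integral_abs_bound integral_mono])
    show "integrable (P x) (\<lambda>\<omega>. \<bar>f (X t \<omega>)\<bar>)" using integrable_C0_X[OF f t x] by simp
    show "\<bar>f (X t \<omega>)\<bar> \<le> B" if "\<omega> \<in> space (P x)" for \<omega>
      using that B X_nonneg[OF t] by (simp add: space_P[OF x])
  qed simp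
  then show ?thesis using prob_space by simp
qed

lemma T_nonneg:
  assumes "\<And>x. x \<ge> 0 \<Longrightarrow> f x \<ge> 0" "t \<ge> 0" "x \<ge> 0" shows "T t f x \<ge> 0"
  unfolding transition_op_def
  by (rule Bochner_Integration.integral_nonneg) (use assms X_nonneg in \<open>auto simp: space_P\<close>)

lemma T_linear:
  assumes "C0 f" "C0 g" "t \<ge> 0" "x \<ge> 0"
  shows "T t (\<lambda>x. c * f x + d * g x) x = c * T t f x + d * T t g x"
  unfolding transition_op_def using integrable_C0_X[of f t x] integrable_C0_X[of g t x] assms by simp

lemma T_cong:
  assumes "\<And>y. y \<ge> 0 \<Longrightarrow> f y = g y" "t \<ge> 0" "x \<ge> 0" shows "T t f x = T t g x"
  unfolding transition_op_def
  by (rule Bochner_Integration.integral_cong) (use assms X_nonneg in \<open>auto simp: space_P\<close>)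

lemma T_0:
  assumes f: "C0 f" and x: "x \<ge> 0" shows "T 0 f x = f x"
proof -
  interpret prob_space "P x" by (rule prob_P[OF x])
  have "T 0 f x = (\<integral>\<omega>. f x \<partial>P x)"
    unfolding transition_op_def using start[OF x] measurable_C0_X[OF f _ x, of 0]
    by (intro integral_cong_AE) (auto elim!: eventually_mono)
  then show ?thesis using prob_space by simp
qed

lemma subalgebra_natural_sigma:
  assumes s: "s \<ge> 0" and x: "x \<ge> 0" shows "subalgebra (P x) (natural_sigma \<Omega> X s)"
proof -
  let ?G = "\<Union>u\<in>{0..s}. {X u -` A \<inter> space \<Omega> | A. A \<in> sets half_line}"
  have sub: "?G \<subseteq> sets \<Omega>"
    using measurable_sets[OF measurable_X] by auto
  have "sigma_sets (space \<Omega>) ?G \<subseteq> sets \<Omega>"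
    by (rule sets.sigma_sets_subset[OF sub])
  moreover have "?G \<subseteq> Pow (space \<Omega>)" by auto
  ultimately show ?thesis
    unfolding subalgebra_def natural_sigma_def
    by (simp add: space_P[OF x] sets_P[OF x])
qed

text \<open>The Markov property at time \<open>s\<close> after taking expectations, which
  conditioning preserves.\<close>

lemma T_semigroup:
  assumes f: "C0 f" and s: "s \<ge> 0" and t: "t \<ge> 0" and x: "x \<ge> 0"
  shows "T (s + t) f x = T s (T t f) x"
proof -
  interpret prob_space "P x" by (rule prob_P[OF x])
  interpret finite_measure_subalgebra "P x" "natural_sigma \<Omega> X s"
    by unfold_locales (rule subalgebra_natural_sigma[OF s x])
  have st: "s + t \<ge> 0" using s t by simp
  note i = integrable_C0_X[OF f st x]
  obtain B where B: "\<And>x. x \<ge> 0 \<Longrightarrow> \<bar>f x\<bar> \<le> B" using C0_bounded[OF f] by metis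
  have bd: "bounded (f ` {0..})" unfolding bounded_iff using B by auto
  have m: "f \<in> borel_measurable half_line" using f by (auto simp: C0_def intro: borel_measurable_half_line)
  have "T (s + t) f x = (\<integral>\<omega>. 1 * f (X (s + t) \<omega>) \<partial>P x)" by (simp add: transition_op_def)
  also have "\<dots> = (\<integral>\<omega>. 1 * real_cond_exp (P x) (natural_sigma \<Omega> X s) (\<lambda>\<omega>. f (X (s + t) \<omega>)) \<omega> \<partial>P x)"
    by (rule real_cond_exp_intg(2)[symmetric]) (use i in auto)
  also have "\<dots> = (\<integral>\<omega>. T t f (X s \<omega>) \<partial>P x)"
    using markov[OF x s t m bd] measurable_C0_X[OF feller[OF t f] s x]
    by (intro integral_cong_AE) auto
  finally show ?thesis by (simp add: transition_op_def)
qed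

lemma T_time_continuous:
  assumes f: "C0 f" and x: "x \<ge> 0" shows "continuous_on {0..} (\<lambda>t. T t f x)"
  unfolding continuous_on_sequentially comp_def
proof (intro allI ballI impI)
  fix u :: "nat \<Rightarrow> real" and t :: real
  assume t: "t \<in> {0..}" and u: "(\<forall>n. u n \<in> {0..}) \<and> u \<longlonglongrightarrow> t"
  interpret prob_space "P x" by (rule prob_P[OF x])
  obtain B where B: "\<And>x. x \<ge> 0 \<Longrightarrow> \<bar>f x\<bar> \<le> B" using C0_bounded[OF f] by metis
  show "(\<lambda>n. T (u n) f x) \<longlonglongrightarrow> T t f x"
    unfolding transition_op_def
  proof (rule integral_dominated_convergence[where w="\<lambda>_. B"])
    show "AE \<omega> in P x. (\<lambda>n. f (X (u n) \<omega>)) \<longlonglongrightarrow> f (X t \<omega>)"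
    proof (rule AE_I2)
      fix \<omega> assume "\<omega> \<in> space (P x)"
      then have \<omega>: "\<omega> \<in> space \<Omega>" by (simp add: space_P[OF x])
      have "(\<lambda>n. X (u n) \<omega>) \<longlonglongrightarrow> X t \<omega>"
        using continuous_paths[OF \<omega>] t u unfolding continuous_on_sequentially comp_def by blast
      moreover have "continuous_on {0..} f" using f by (simp add: C0_def)
      ultimately show "(\<lambda>n. f (X (u n) \<omega>)) \<longlonglongrightarrow> f (X t \<omega>)"
        using X_nonneg[OF _ \<omega>] t u unfolding continuous_on_sequentially comp_def by (metis atLeast_iff)
    qed
    show "AE \<omega> in P x. norm (f (X (u n) \<omega>)) \<le> B" for n
      using B X_nonneg[of "u n"] u by (intro AE_I2) (auto simp: space_P[OF x])
  qed (use u t in \<open>auto intro!: measurable_C0_X f x\<close>)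
qed

lemma generatorD: "generator P X f g \<Longrightarrow> C0 f" "generator P X f g \<Longrightarrow> C0 g"
  by (auto simp: generator_def)

lemma generator_rate:
  assumes "generator P X f g" "e > 0"
  obtains d where "d > 0" "\<And>h x. 0 < h \<Longrightarrow> h < d \<Longrightarrow> x \<ge> 0 \<Longrightarrow> \<bar>(T h f x - f x) / h - g x\<bar> < e"
proof -
  have "\<forall>\<^sub>F h in at_right 0. \<forall>x\<in>{0..}. dist ((T h f x - f x) / h) (g x) < e"
    using assms unfolding generator_def uniform_limit_iff by blast
  then obtain d where "d > 0" "\<forall>h>0. h < d \<longrightarrow> (\<forall>x\<in>{0..}. dist ((T h f x - f x) / h) (g x) < e)"
    unfolding eventually_at_right_field by auto
  then show ?thesis using that[of d] by (auto simp: dist_real_def)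
qed

text \<open>Contractivity of \<open>T t\<close> carries the error of the difference quotient from
  time 0 to time \<open>t\<close> with the same bound \<open>e\<close>. This uniformity in
  \<open>t\<close> serves the invariance of the domain, the two-sided time derivative and the
  Laplace integral.\<close>

lemma T_increment:
  assumes fg: "generator P X f g" and t: "t \<ge> 0" and h: "h > 0" and x: "x \<ge> 0"
    and e: "\<And>x. x \<ge> 0 \<Longrightarrow> \<bar>(T h f x - f x) / h - g x\<bar> \<le> e"
  shows "\<bar>(T (t + h) f x - T t f x) / h - T t g x\<bar> \<le> e"
proof -
  note C = generatorD[OF fg]
  have Th: "C0 (T h f)" using feller C h by simp
  let ?A = "\<lambda>x. 1 / h * (1 * T h f x + (- 1) * f x) + (- 1) * g x"
  have A1: "C0 (\<lambda>x. 1 * T h f x + (- 1) * f x)" by (rule C0_linear[OF Th C(1)])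
  have A: "C0 ?A" by (rule C0_linear[OF A1 C(2)])
  have "T t ?A x = 1 / h * T t (\<lambda>x. 1 * T h f x + (- 1) * f x) x + (- 1) * T t g x"
    by (rule T_linear[OF A1 C(2) t x])
  also have "T t (\<lambda>x. 1 * T h f x + (- 1) * f x) x = 1 * T t (T h f) x + (- 1) * T t f x"
    by (rule T_linear[OF Th C(1) t x])
  also have "T t (T h f) x = T (t + h) f x"
    using T_semigroup[OF C(1) t _ x, of h] h by simp
  finally have "(T (t + h) f x - T t f x) / h - T t g x = T t ?A x" by simp
  also have "\<bar>\<dots>\<bar> \<le> e"
    by (rule T_bound[OF A _ t x]) (use e in simp)
  finally show ?thesis .
qed

lemma generator_T:
  assumes fg: "generator P X f g" and t: "t \<ge> 0"
  shows "generator P X (T t f) (T t g)"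
proof -
  note C = generatorD[OF fg]
  have "uniform_limit {0..} (\<lambda>h x. (T h (T t f) x - T t f x) / h) (T t g) (at_right 0)"
  proof (rule uniform_limitI)
    fix e :: real assume "e > 0"
    then have e2: "e / 2 > 0" by simp
    obtain d where d: "d > 0" "\<And>h x. 0 < h \<Longrightarrow> h < d \<Longrightarrow> x \<ge> 0 \<Longrightarrow> \<bar>(T h f x - f x) / h - g x\<bar> < e / 2"
      using generator_rate[OF fg e2] by metis
    show "\<forall>\<^sub>F h in at_right 0. \<forall>x\<in>{0..}. dist ((T h (T t f) x - T t f x) / h) (T t g x) < e"
      unfolding eventually_at_right_field
    proof (intro exI[of _ d] conjI allI impI ballI)
      fix h x assume h: "0 < h" "h < d" and x: "x \<in> {0::real..}"
      have "T h (T t f) x = T (t + h) f x"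
        using T_semigroup[OF C(1) _ t, of h x] h x by (simp add: add.commute)
      moreover have "\<bar>(T (t + h) f x - T t f x) / h - T t g x\<bar> \<le> e / 2"
        by (rule T_increment[OF fg t h(1)]) (use d h x in \<open>auto simp: less_imp_le\<close>)
      ultimately show "dist ((T h (T t f) x - T t f x) / h) (T t g x) < e"
        using \<open>e > 0\<close> by (simp add: dist_real_def)
    qed (rule d)
  qed
  then show ?thesis using C feller[OF t] by (simp add: generator_def)
qed

lemma T_deriv:
  assumes fg: "generator P X f g" and t: "t \<ge> 0" and x: "x \<ge> 0"
  shows "((\<lambda>t. T t f x) has_real_derivative T t g x) (at t within {0..})"
  unfolding has_field_derivative_iff
proof (rule tendstoI)
  fix e :: real assume e: "e > 0"
  then have e2: "e / 2 > 0" by simp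
  obtain d1 where d1: "d1 > 0" "\<And>h x. 0 < h \<Longrightarrow> h < d1 \<Longrightarrow> x \<ge> 0 \<Longrightarrow> \<bar>(T h f x - f x) / h - g x\<bar> < e / 2"
    using generator_rate[OF fg e2] by metis
  obtain d2 where d2: "d2 > 0" "\<And>u. u \<ge> 0 \<Longrightarrow> \<bar>u - t\<bar> < d2 \<Longrightarrow> \<bar>T u g x - T t g x\<bar> < e / 2"
    using T_time_continuous[OF generatorD(2)[OF fg] x] t e2
    unfolding continuous_on_iff dist_real_def by (metis atLeast_iff)
  show "\<forall>\<^sub>F y in at t within {0..}. dist ((T y f x - T t f x) / (y - t)) (T t g x) < e"
    unfolding eventually_at
  proof (intro exI[of _ "min d1 d2"] conjI ballI impI)
    fix y assume y: "y \<in> {0::real..}" "y \<noteq> t \<and> dist y t < min d1 d2"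
    \<comment> \<open>A backward increment from \<open>t\<close> is a forward increment from the
      earlier time \<open>u\<close>, so that \<open>T_increment\<close> covers both sides;
      \<open>T u g x\<close> is close to \<open>T t g x\<close> by continuity in time.\<close>
    define u h where "u = min y t" and "h = \<bar>y - t\<bar>"
    have "\<bar>y - t\<bar> < d1" "\<bar>y - t\<bar> < d2" using y by (simp_all add: dist_real_def)
    then have u: "u \<ge> 0" "\<bar>u - t\<bar> < d2" and h: "h > 0" "h < d1"
      using y t d2(1) by (auto simp: u_def h_def min_def)
    have "(T y f x - T t f x) / (y - t) = (T (u + h) f x - T u f x) / h"
    proof (cases "y \<ge> t")
      case True
      then have "u + h = y" "u = t" "h = y - t" by (auto simp: u_def h_def)
      then show ?thesis by simp
    next
      case False
      then have "u + h = t" "u = y" "h = t - y" by (auto simp: u_def h_def)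
      then show ?thesis by (simp add: minus_divide_divide[symmetric, of "T y f x - T t f x"])
    qed
    moreover have "\<bar>(T (u + h) f x - T u f x) / h - T u g x\<bar> \<le> e / 2"
      by (rule T_increment[OF fg u(1) h(1) x]) (use d1 h in \<open>auto simp: less_imp_le\<close>)
    ultimately show "dist ((T y f x - T t f x) / (y - t)) (T t g x) < e"
      using d2(2)[OF u] unfolding dist_real_def by linarith
  qed (use d1 d2 in auto)
qed

text \<open>For \<open>f\<close> in the domain, \<open>T t f x\<close> is Lipschitz in
  \<open>t\<close> with a constant independent of \<open>x\<close>, since its time derivative
  \<open>T t g x\<close> is bounded. With continuity in \<open>x\<close> this gives joint
  continuity, the source of measurability in the Fubini step for the resolvent.\<close>

lemma T_jointly_continuous:
  assumes fg: "generator P X f g"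
  shows "continuous_on ({0..} \<times> {0..}) (\<lambda>(t, x). T t f x)"
proof -
  note C = generatorD[OF fg]
  obtain B where B: "B \<ge> 0" "\<And>x. x \<ge> 0 \<Longrightarrow> \<bar>g x\<bar> \<le> B" using C0_bounded[OF C(2)] by metis
  have lip: "\<bar>T s f x - T t f x\<bar> \<le> B * \<bar>s - t\<bar>" if "s \<ge> 0" "t \<ge> 0" "x \<ge> 0" for s t x
    using field_differentiable_bound[of "{0..}" "\<lambda>t. T t f x" "\<lambda>t. T t g x" B s t]
      T_deriv[OF fg] T_bound[OF C(2) B(2)] that by auto
  show ?thesis
    unfolding continuous_on_sequentially comp_def
  proof (intro allI ballI impI)
    fix u :: "nat \<Rightarrow> real \<times> real" and z :: "real \<times> real"
    assume z: "z \<in> {0..} \<times> {0..}" and u: "(\<forall>n. u n \<in> {0..} \<times> {0..}) \<and> u \<longlonglongrightarrow> z"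
    obtain t x where zz: "z = (t, x)" by (cases z)
    have tx: "t \<ge> 0" "x \<ge> 0" using z zz by auto
    have u1: "fst (u n) \<ge> 0" "snd (u n) \<ge> 0" for n using u by (auto simp: mem_Times_iff)
    have l1: "(\<lambda>n. fst (u n)) \<longlonglongrightarrow> t" and l2: "(\<lambda>n. snd (u n)) \<longlonglongrightarrow> x"
      using u zz tendsto_fst[of u z] tendsto_snd[of u z] by auto
    have "continuous_on {0..} (T t f)" using feller[OF tx(1) C(1)] by (simp add: C0_def)
    then have "(\<lambda>n. T t f (snd (u n))) \<longlonglongrightarrow> T t f x"
      using u1 tx l2 unfolding continuous_on_sequentially comp_def by (metis atLeast_iff)
    moreover have "(\<lambda>n. T (fst (u n)) f (snd (u n)) - T t f (snd (u n))) \<longlonglongrightarrow> 0"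
    proof (rule Lim_null_comparison)
      show "\<forall>\<^sub>F n in sequentially. norm (T (fst (u n)) f (snd (u n)) - T t f (snd (u n))) \<le> B * \<bar>fst (u n) - t\<bar>"
        using lip[OF u1(1) tx(1) u1(2)] by simp
      have "(\<lambda>n. B * \<bar>fst (u n) - t\<bar>) \<longlonglongrightarrow> B * \<bar>t - t\<bar>" by (intro tendsto_intros l1)
      then show "(\<lambda>n. B * \<bar>fst (u n) - t\<bar>) \<longlonglongrightarrow> 0" by simp
    qed
    ultimately have "(\<lambda>n. (T (fst (u n)) f (snd (u n)) - T t f (snd (u n))) + T t f (snd (u n))) \<longlonglongrightarrow> 0 + T t f x"
      by (intro tendsto_add)
    then show "(\<lambda>n. case u n of (t, x) \<Rightarrow> T t f x) \<longlonglongrightarrow> (case z of (t, x) \<Rightarrow> T t f x)"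
      by (simp add: zz case_prod_unfold)
  qed
qed

end

lemma has_real_derivative_chain_within:
  fixes G g :: "real \<Rightarrow> real"
  assumes "(G has_real_derivative D) (at (g r) within A)" "(g has_real_derivative E) (at r within S)" "g ` S \<subseteq> A"
  shows "((\<lambda>r. G (g r)) has_real_derivative D * E) (at r within S)"
  using DERIV_image_chain[OF has_field_derivative_subset[OF assms(1,3)] assms(2)] by (simp add: comp_def)

lemma has_real_derivative_rescale:
  fixes G G' :: "real \<Rightarrow> real"
  assumes G: "\<And>t. t \<ge> 0 \<Longrightarrow> (G has_real_derivative G' t) (at t within {0..})" and s: "s > 0" and u: "u \<ge> 0"
  shows "((\<lambda>u. G (u / s)) has_real_derivative G' (u / s) / s) (at u within {0..})"
proof -
  have "((\<lambda>u. G (u / s)) has_real_derivative G' (u / s) * (1 / s)) (at u within {0..})"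
    by (rule has_real_derivative_chain_within[where g="\<lambda>u. u / s" and r=u, OF G])
       (use s u in \<open>auto intro!: derivative_eq_intros\<close>)
  then show ?thesis by simp
qed

lemma C0_mult: "C0 f \<Longrightarrow> C0 g \<Longrightarrow> C0 (\<lambda>x. f x * g x)"
  unfolding C0_def by (auto intro!: continuous_intros tendsto_eq_intros)

section \<open>The resolvent\<close>

context reflecting_diffusion
begin

text \<open>
  The Laplace integral of the semigroup after the substitution \<open>u = s t\<close>. The operators \<open>T t\<close> with
  \<open>t < 0\<close> are junk, hence the \<open>max 0 u\<close>, which changes nothing \<open>exp_law\<close>-almost everywhere.
\<close>

definition resolvent :: "real \<Rightarrow> (real \<Rightarrow> real) \<Rightarrow> real \<Rightarrow> real" where
  "resolvent s f x = (\<integral>u. T (max 0 u / s) f x / s \<partial>exp_law)"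

lemma
  assumes f: "C0 f" and s: "s > 0" and x: "x \<ge> 0" and h: "h \<ge> 0"
  shows measurable_T_time: "(\<lambda>u. T (max 0 u / s + h) f x) \<in> borel_measurable borel"
    and integrable_T_time: "integrable exp_law (\<lambda>u. T (max 0 u / s + h) f x)"
proof -
  have "continuous_on {0..} (\<lambda>u. T (u / s + h) f x)"
    by (rule continuous_on_compose2[OF T_time_continuous[OF f x]]) (use s h in \<open>auto intro!: continuous_intros\<close>)
  then show m: "(\<lambda>u. T (max 0 u / s + h) f x) \<in> borel_measurable borel"
    by (rule borel_measurable_max_half_line)
  obtain B where B: "\<And>x. x \<ge> 0 \<Longrightarrow> \<bar>f x\<bar> \<le> B" using C0_bounded[OF f] by metis
  show "integrable exp_law (\<lambda>u. T (max 0 u / s + h) f x)"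
    by (rule integrable_exp_law[where B=B, OF m]) (use s h x in \<open>auto intro!: T_bound f B\<close>)
qed

lemmas measurable_T_time0 = measurable_T_time[where h=0, simplified]
lemmas integrable_T_time0 = integrable_T_time[where h=0, simplified]

lemma resolvent_C0:
  assumes f: "C0 f" and s: "s > 0" shows "C0 (resolvent s f)"
proof -
  obtain B where B: "\<And>x. x \<ge> 0 \<Longrightarrow> \<bar>f x\<bar> \<le> B" using C0_bounded[OF f] by metis
  have Tb: "norm (T (max 0 u / s) f x / s) \<le> B / s" if "x \<ge> 0" for u x
    using T_bound[OF f B _ that, of "max 0 u / s"] s by (simp add: divide_right_mono)
  have TC: "C0 (T (max 0 u / s) f)" for u using feller[OF _ f] s by simp
  have "continuous_on {0..} (resolvent s f)"
    unfolding continuous_on_sequentially comp_def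
  proof (intro allI ballI impI)
    fix y :: "nat \<Rightarrow> real" and x :: real
    assume x: "x \<in> {0..}" and y: "(\<forall>n. y n \<in> {0..}) \<and> y \<longlonglongrightarrow> x"
    show "(\<lambda>n. resolvent s f (y n)) \<longlonglongrightarrow> resolvent s f x"
      unfolding resolvent_def
    proof (rule integral_dominated_convergence[where w="\<lambda>_. B / s"])
      show "AE u in exp_law. (\<lambda>n. T (max 0 u / s) f (y n) / s) \<longlonglongrightarrow> T (max 0 u / s) f x / s"
      proof (rule AE_I2)
        fix u
        have "continuous_on {0..} (T (max 0 u / s) f)" using TC by (simp add: C0_def)
        then have "(\<lambda>n. T (max 0 u / s) f (y n)) \<longlonglongrightarrow> T (max 0 u / s) f x"
          using x y unfolding continuous_on_sequentially comp_def by blast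
        then show "(\<lambda>n. T (max 0 u / s) f (y n) / s) \<longlonglongrightarrow> T (max 0 u / s) f x / s"
          using s by (intro tendsto_divide tendsto_const) auto
      qed
      show "AE u in exp_law. norm (T (max 0 u / s) f (y n) / s) \<le> B / s" for n
        using Tb y by (intro AE_I2) auto
      show "(\<lambda>u. T (max 0 u / s) f x / s) \<in> borel_measurable exp_law"
        "\<And>n. (\<lambda>u. T (max 0 u / s) f (y n) / s) \<in> borel_measurable exp_law"
        using measurable_T_time0[OF f s] x y by auto
    qed auto
  qed
  moreover have "(resolvent s f \<longlongrightarrow> (\<integral>u. 0 \<partial>exp_law)) at_top"
    unfolding resolvent_def
  proof (rule tendsto_at_topI_sequentially)
    fix y :: "nat \<Rightarrow> real" assume y: "filterlim y at_top sequentially"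
    then have "\<forall>\<^sub>F n in sequentially. y n \<ge> 0" by (simp add: filterlim_at_top)
    then obtain N where N: "\<And>n. n \<ge> N \<Longrightarrow> y n \<ge> 0" unfolding eventually_sequentially by blast
    show "(\<lambda>n. \<integral>u. T (max 0 u / s) f (y n) / s \<partial>exp_law) \<longlonglongrightarrow> (\<integral>u. 0 \<partial>exp_law)"
    \<comment> \<open>The sequence \<open>y\<close> may start with negative points, outside the
      state space; they are cut off.\<close>
    proof (rule LIMSEQ_offset[where k=N], rule integral_dominated_convergence[where w="\<lambda>_. B / s"])
      show "AE u in exp_law. (\<lambda>n. T (max 0 u / s) f (y (n + N)) / s) \<longlonglongrightarrow> 0"
      proof (rule AE_I2)
        fix u
        have "(T (max 0 u / s) f \<longlongrightarrow> 0) at_top" using TC by (simp add: C0_def)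
        then have "(\<lambda>n. T (max 0 u / s) f (y n)) \<longlonglongrightarrow> 0" using y by (rule filterlim_compose)
        then have "(\<lambda>n. T (max 0 u / s) f (y (n + N))) \<longlonglongrightarrow> 0" by (rule LIMSEQ_ignore_initial_segment)
        then show "(\<lambda>n. T (max 0 u / s) f (y (n + N)) / s) \<longlonglongrightarrow> 0" by (rule tendsto_divide_zero)
      qed
      show "AE u in exp_law. norm (T (max 0 u / s) f (y (n + N)) / s) \<le> B / s" for n
        using Tb N by (intro AE_I2) auto
      show "\<And>n. (\<lambda>u. T (max 0 u / s) f (y (n + N)) / s) \<in> borel_measurable exp_law"
        using measurable_T_time0[OF f s] N by auto
    qed auto
  qed
  ultimately show ?thesis by (simp add: C0_def)
qed

lemma T_resolvent:
  assumes fg: "generator P X f g" and s: "s > 0" and h: "h \<ge> 0" and x: "x \<ge> 0"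
  shows "T h (resolvent s f) x = (\<integral>u. T (max 0 u / s + h) f x / s \<partial>exp_law)"
proof -
  note f = generatorD(1)[OF fg]
  obtain B where B: "\<And>x. x \<ge> 0 \<Longrightarrow> \<bar>f x\<bar> \<le> B" using C0_bounded[OF f] by metis
  interpret Px: prob_space "P x" by (rule prob_P[OF x])
  interpret pair_prob_space "P x" exp_law ..
  \<comment> \<open>\<open>max 0\<close> in both arguments extends the jointly continuous function
    to the whole plane, where continuity yields Borel measurability.\<close>
  let ?\<Phi> = "\<lambda>(u, y). T (max 0 u / s) f (max 0 y) / s"
  have "continuous_on UNIV (\<lambda>z. (case (max 0 (fst z) / s, max 0 (snd z)) of (t, x) \<Rightarrow> T t f x) / s)"
    by (intro continuous_intros continuous_on_compose2[OF T_jointly_continuous[OF fg]])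
       (use s in \<open>auto intro!: continuous_intros\<close>)
  then have "continuous_on UNIV ?\<Phi>" by (simp only: case_prod_unfold fst_conv snd_conv)
  then have \<Phi>: "?\<Phi> \<in> borel_measurable (borel \<Otimes>\<^sub>M borel)"
    unfolding borel_prod by (rule borel_measurable_continuous_onI)
  have "X h \<in> \<Omega> \<rightarrow>\<^sub>M borel"
    using measurable_compose[OF measurable_X[OF h] borel_measurable_half_line[of "\<lambda>x. x"]] by (simp add: continuous_on_id)
  then have [measurable]: "X h \<in> P x \<rightarrow>\<^sub>M borel"
    using measurable_cong_sets[OF sets_P[OF x] refl] by blast
  have [measurable]: "(\<lambda>z. z) \<in> exp_law \<rightarrow>\<^sub>M borel" by (simp add: measurable_def)
  have "(\<lambda>z. ?\<Phi> (snd z, X h (fst z))) \<in> borel_measurable (P x \<Otimes>\<^sub>M exp_law)"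
    by (rule measurable_compose[OF _ \<Phi>]) measurable
  then have m: "(\<lambda>(\<omega>, u). T (max 0 u / s) f (max 0 (X h \<omega>)) / s) \<in> borel_measurable (P x \<Otimes>\<^sub>M exp_law)"
    by (simp only: case_prod_unfold fst_conv snd_conv)
  have int: "integrable (P x \<Otimes>\<^sub>M exp_law) (\<lambda>(\<omega>, u). T (max 0 u / s) f (max 0 (X h \<omega>)) / s)"
  proof (rule integrable_const_bound[where B="B / s", OF AE_I2 m])
    fix z
    show "norm (case z of (\<omega>, u) \<Rightarrow> T (max 0 u / s) f (max 0 (X h \<omega>)) / s) \<le> B / s"
      using T_bound[OF f B, of "max 0 (snd z) / s" "max 0 (X h (fst z))"] s
      by (simp only: case_prod_unfold) (simp add: divide_right_mono)
  qed
  have "T h (resolvent s f) x = (\<integral>\<omega>. \<integral>u. T (max 0 u / s) f (max 0 (X h \<omega>)) / s \<partial>exp_law \<partial>P x)"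
    unfolding transition_op_def[of P X h] resolvent_def
    by (rule Bochner_Integration.integral_cong) (use X_nonneg[OF h] in \<open>auto simp: space_P[OF x]\<close>)
  also have "\<dots> = (\<integral>u. \<integral>\<omega>. T (max 0 u / s) f (max 0 (X h \<omega>)) / s \<partial>P x \<partial>exp_law)"
    by (rule Fubini_integral[OF int, symmetric])
  also have "\<dots> = (\<integral>u. T (max 0 u / s + h) f x / s \<partial>exp_law)"
  proof (rule Bochner_Integration.integral_cong[OF refl])
    fix u
    have "(\<integral>\<omega>. T (max 0 u / s) f (max 0 (X h \<omega>)) / s \<partial>P x) = (\<integral>\<omega>. T (max 0 u / s) f (X h \<omega>) / s \<partial>P x)"
      by (rule Bochner_Integration.integral_cong) (use X_nonneg[OF h] in \<open>auto simp: space_P[OF x]\<close>)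
    also have "\<dots> = (\<integral>\<omega>. T (max 0 u / s) f (X h \<omega>) \<partial>P x) / s" by simp
    also have "(\<integral>\<omega>. T (max 0 u / s) f (X h \<omega>) \<partial>P x) = T (h + max 0 u / s) f x"
      using T_semigroup[OF f h _ x, of "max 0 u / s"] s by (simp add: transition_op_def)
    finally show "(\<integral>\<omega>. T (max 0 u / s) f (max 0 (X h \<omega>)) / s \<partial>P x) = T (max 0 u / s + h) f x / s"
      by (simp add: add.commute)
  qed
  finally show ?thesis .
qed

text \<open>By \<open>T_resolvent\<close> the error of the difference quotient is a Laplace average
  of increments over all times, each bounded by \<open>T_increment\<close>. The tolerance
  \<open>e * s / 2\<close> anticipates the division by \<open>s\<close> in
  \<open>resolvent\<close>.\<close>

lemma generator_resolvent:
  assumes fg: "generator P X f g" and s: "s > 0"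
  shows "generator P X (resolvent s f) (resolvent s g)"
proof -
  note C = generatorD[OF fg]
  have "uniform_limit {0..} (\<lambda>h x. (T h (resolvent s f) x - resolvent s f x) / h) (resolvent s g) (at_right 0)"
  proof (rule uniform_limitI)
    fix e :: real assume e: "e > 0"
    then have es: "e * s / 2 > 0" using s by simp
    obtain d where d: "d > 0" "\<And>h x. 0 < h \<Longrightarrow> h < d \<Longrightarrow> x \<ge> 0 \<Longrightarrow> \<bar>(T h f x - f x) / h - g x\<bar> < e * s / 2"
      using generator_rate[OF fg es] by metis
    show "\<forall>\<^sub>F h in at_right 0. \<forall>x\<in>{0..}. dist ((T h (resolvent s f) x - resolvent s f x) / h) (resolvent s g x) < e"
      unfolding eventually_at_right_field
    proof (intro exI[of _ d] conjI allI impI ballI)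
      fix h x assume h: "0 < h" "h < d" and x': "x \<in> {0::real..}"
      then have x: "x \<ge> 0" and h0: "h \<ge> 0" by auto
      note i = integrable_T_time[OF C(1) s x h0] integrable_T_time0[OF C(1) s x] integrable_T_time0[OF C(2) s x]
      have alg': "\<bar>A / s\<bar> \<le> e / 2" if "\<bar>A\<bar> \<le> e * s / 2" for A
        using that s by (simp add: field_simps)
      have eq: "(T h (resolvent s f) x - resolvent s f x) / h - resolvent s g x =
          (\<integral>u. ((T (max 0 u / s + h) f x - T (max 0 u / s) f x) / h - T (max 0 u / s) g x) / s \<partial>exp_law)"
      proof -
        have alg: "(A / s - B / s) / h - C / s = ((A - B) / h - C) / s" for A B C :: real
          using s h by (simp add: field_simps)
        show ?thesis
          unfolding T_resolvent[OF fg s h0 x] resolvent_def integral_divide_zero alg using i by simp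
      qed
      have "\<bar>(T h (resolvent s f) x - resolvent s f x) / h - resolvent s g x\<bar> \<le> (\<integral>u. e / 2 \<partial>exp_law)"
        unfolding eq
      proof (rule order.trans[OF integral_abs_bound integral_mono])
        fix u :: real
        have "\<bar>(T (max 0 u / s + h) f x - T (max 0 u / s) f x) / h - T (max 0 u / s) g x\<bar> \<le> e * s / 2"
          by (rule T_increment[OF fg _ h(1) x less_imp_le[OF d(2)[OF h]]]) (use s in auto)
        then show "\<bar>((T (max 0 u / s + h) f x - T (max 0 u / s) f x) / h - T (max 0 u / s) g x) / s\<bar> \<le> e / 2"
          by (rule alg')
      qed (use i in auto)
      moreover have "(\<integral>u. e / 2 \<partial>exp_law) = e / 2" using exp_law.prob_space by simp
      ultimately show "dist ((T h (resolvent s f) x - resolvent s f x) / h) (resolvent s g x) < e"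
        unfolding dist_real_def using e by linarith
    qed (rule d)
  qed
  then show ?thesis using C resolvent_C0[OF _ s] by (simp add: generator_def)
qed

text \<open>Integration by parts in time: the derivative of \<open>T (u / s) f x\<close> in
  \<open>u\<close> is \<open>T (u / s) g x / s\<close>.\<close>

lemma resolvent_eq:
  assumes fg: "generator P X f g" and s: "s > 0" and x: "x \<ge> 0"
  shows "resolvent s g x = s * resolvent s f x - f x"
proof -
  note C = generatorD[OF fg]
  obtain B where B: "\<And>x. x \<ge> 0 \<Longrightarrow> \<bar>f x\<bar> \<le> B" using C0_bounded[OF C(1)] by metis
  obtain B' where B': "\<And>x. x \<ge> 0 \<Longrightarrow> \<bar>g x\<bar> \<le> B'" using C0_bounded[OF C(2)] by metis
  have "(\<integral>u. T (max 0 u / s) f x - T (max 0 u / s) g x / s \<partial>exp_law) = T (0 / s) f x"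
  proof (rule exp_law_FTC[where F="\<lambda>u. T (u / s) f x" and F'="\<lambda>u. T (u / s) g x / s" and B=B and B'="B' / s"])
    show "((\<lambda>u. T (u / s) f x) has_real_derivative T (u / s) g x / s) (at u within {0..})" if "u \<ge> 0" for u
      by (rule has_real_derivative_rescale[OF _ s that]) (rule T_deriv[OF fg _ x])
    show "continuous_on {0..} (\<lambda>u. T (u / s) g x / s)"
      by (intro continuous_intros continuous_on_compose2[OF T_time_continuous[OF C(2) x]])
         (use s in \<open>auto intro!: continuous_intros\<close>)
    show "\<bar>T (u / s) f x\<bar> \<le> B" if "u \<ge> 0" for u
      by (rule T_bound[OF C(1) B _ x]) (use that s in auto)
    have "\<bar>T (u / s) g x\<bar> \<le> B'" if "u \<ge> 0" for u
      by (rule T_bound[OF C(2) B' _ x]) (use that s in auto)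
    then show "\<bar>T (u / s) g x / s\<bar> \<le> B' / s" if "u \<ge> 0" for u
      using that s by (simp add: divide_right_mono)
  qed
  moreover have "(\<integral>u. T (max 0 u / s) f x - T (max 0 u / s) g x / s \<partial>exp_law) = s * resolvent s f x - resolvent s g x"
    unfolding resolvent_def integral_divide_zero
    using integrable_T_time0[OF C(1) s x] integrable_T_time0[OF C(2) s x] s
    by (subst Bochner_Integration.integral_diff) auto
  ultimately have "s * resolvent s f x - resolvent s g x = T (0 / s) f x" by (simp only:)
  then show ?thesis using T_0[OF C(1) x] by simp
qed

lemma resolvent_nonneg:
  assumes "\<And>x. x \<ge> 0 \<Longrightarrow> f x \<ge> 0" "s > 0" "x \<ge> 0" shows "resolvent s f x \<ge> 0"
  unfolding resolvent_def
proof (rule Bochner_Integration.integral_nonneg)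
  fix u :: real
  have "T (max 0 u / s) f x \<ge> 0" by (rule T_nonneg) (use assms in simp_all)
  then show "0 \<le> T (max 0 u / s) f x / s" using assms(2) by (intro divide_nonneg_nonneg) simp_all
qed

end

section \<open>Symmetry of the semigroup\<close>

locale diffusion_density = reflecting_diffusion b \<Omega> P X
  for b :: "real \<Rightarrow> real" and \<Omega> :: "'w measure" and P X +
  fixes p :: "real \<Rightarrow> real \<Rightarrow> real \<Rightarrow> real" and m_inf :: real
  assumes b_int: "loc_integrable b"
    and density: "transition_density b P X p"
    and speed_lim: "(speed_fun b \<longlongrightarrow> m_inf) at_top"
begin

sublocale speed_weight "weight b" m_inf
proof
  show "((\<lambda>x. 2 * integral {0..x} (weight b)) \<longlongrightarrow> m_inf) at_top"
    by (rule Lim_transform_eventually[OF speed_lim])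
       (rule eventually_at_top_linorderI[of 0], rule speed_fun_eq[OF b_int])
qed (use weight_continuous[OF b_int] weight_pos in auto)

lemma speed_measure_eq: "speed_measure b = speed"
  by (simp add: speed_measure_def)

lemma tail_eq: "x \<ge> 0 \<Longrightarrow> tail x = m_inf - speed_fun b x"
  by (simp add: tail_def speed_fun_eq[OF b_int])

lemma C0_continuous: "C0 f \<Longrightarrow> continuous_on {0..} f"
  by (simp add: C0_def)

lemma integrable_speed_C0: "C0 f \<Longrightarrow> integrable speed f"
  using C0_bounded integrable_speed C0_continuous by metis

text \<open>No mass escapes through infinity: the flux tends to the integral of \<open>g\<close>,
  and by \<open>flux_limit_not_pos\<close>, applied to \<open>f\<close> and \<open>- f\<close>, a
  nonzero limit of either sign would contradict the boundedness of \<open>f\<close>. The vanishing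
  flux at both ends removes the boundary terms in what follows.\<close>

lemma generator_flux:
  assumes fg: "generator P X f g"
  obtains h where "\<And>x. x \<ge> 0 \<Longrightarrow> (f has_real_derivative h x / weight b x) (at x within {0..})"
    and "\<And>x. x \<ge> 0 \<Longrightarrow> (h has_real_derivative 2 * weight b x * g x) (at x within {0..})"
    and "h 0 = 0" and "(h \<longlongrightarrow> 0) at_top"
proof -
  note C = generatorD[OF fg]
  obtain B where B: "\<And>x. x \<ge> 0 \<Longrightarrow> \<bar>f x\<bar> \<le> B" using C0_bounded[OF C(1)] by metis
  obtain B' where B': "\<And>x. x \<ge> 0 \<Longrightarrow> \<bar>g x\<bar> \<le> B'" using C0_bounded[OF C(2)] by metis
  obtain h where f: "\<And>x. x \<ge> 0 \<Longrightarrow> (f has_real_derivative h x / weight b x) (at x within {0..})"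
    and h: "\<And>x. x \<ge> 0 \<Longrightarrow> (h has_real_derivative 2 * weight b x * g x) (at x within {0..})"
    and h0: "h 0 = 0"
    using fg unfolding generator_eq reflecting_L_iff[OF b_int] by blast
  define l where "l = (\<integral>x. g x \<partial>speed)"
  have lim: "(h \<longlongrightarrow> l) at_top"
    using speed_integral_antiderivative_tendsto[OF C0_continuous[OF C(2)] B' h] h0 by (simp add: l_def)
  have "l \<le> 0"
    by (rule flux_limit_not_pos[OF f lim]) (use B in \<open>auto simp: abs_le_iff\<close>)
  moreover have "- l \<le> 0"
  proof (rule flux_limit_not_pos[where f="\<lambda>x. - f x" and h="\<lambda>x. - h x"])
    show "((\<lambda>x. - f x) has_real_derivative - h x / weight b x) (at x within {0..})" if "x \<ge> 0" for x
      using DERIV_minus[OF f[OF that]] by simp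
    show "((\<lambda>x. - h x) \<longlongrightarrow> - l) at_top" by (intro tendsto_minus lim)
    show "- f x \<le> B" if "x \<ge> 0" for x using B[OF that] by (simp add: abs_le_iff)
  qed
  ultimately have "l = 0" by simp
  then show ?thesis using that[of h] f h h0 lim by simp
qed

section \<open>Green's formula for the generator\<close>

lemma generator_conservative:
  assumes fg: "generator P X f g" shows "(\<integral>x. g x \<partial>speed) = 0"
proof -
  note C = generatorD[OF fg]
  obtain B' where B': "\<And>x. x \<ge> 0 \<Longrightarrow> \<bar>g x\<bar> \<le> B'" using C0_bounded[OF C(2)] by metis
  obtain h where h: "\<And>x. x \<ge> 0 \<Longrightarrow> (h has_real_derivative 2 * weight b x * g x) (at x within {0..})"
    and h0: "h 0 = 0" "(h \<longlongrightarrow> 0) at_top"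
    using generator_flux[OF fg] by metis
  show ?thesis using speed_integral_FTC[OF C0_continuous[OF C(2)] B' h h0(2)] h0(1) by simp
qed

text \<open>\<open>(f * h)' = 2 * W * f * g + h^2 / W\<close> with the flux \<open>h\<close> of
  \<open>f\<close>, and \<open>f * h\<close> vanishes at 0 and at infinity.\<close>

lemma generator_dissipative:
  assumes fg: "generator P X f g" shows "(\<integral>x. f x * g x \<partial>speed) \<le> 0"
proof -
  note C = generatorD[OF fg]
  have Cfg: "C0 (\<lambda>x. f x * g x)" by (rule C0_mult[OF C])
  obtain B where B: "\<And>x. x \<ge> 0 \<Longrightarrow> \<bar>f x * g x\<bar> \<le> B" using C0_bounded[OF Cfg] by metis
  obtain h where f: "\<And>x. x \<ge> 0 \<Longrightarrow> (f has_real_derivative h x / weight b x) (at x within {0..})"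
    and h: "\<And>x. x \<ge> 0 \<Longrightarrow> (h has_real_derivative 2 * weight b x * g x) (at x within {0..})"
    and h0: "h 0 = 0" "(h \<longlongrightarrow> 0) at_top"
    using generator_flux[OF fg] by metis
  have "(\<integral>x. f x * g x \<partial>speed) \<le> 0 - f 0 * h 0"
  proof (rule speed_integral_le[OF C0_continuous[OF Cfg] B, where H="\<lambda>x. f x * h x" and k="\<lambda>x. (h x)\<^sup>2 / weight b x"])
    fix x :: real assume x: "x \<ge> 0"
    show "((\<lambda>x. f x * h x) has_real_derivative 2 * weight b x * (f x * g x) + (h x)\<^sup>2 / weight b x) (at x within {0..})"
      using DERIV_mult[OF f[OF x] h[OF x]] by (simp add: power2_eq_square algebra_simps)
    show "0 \<le> (h x)\<^sup>2 / weight b x" using weight_pos[of b x] by simp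
  next
    have "(f \<longlongrightarrow> 0) at_top" using C by (simp add: C0_def)
    then show "((\<lambda>x. f x * h x) \<longlongrightarrow> 0) at_top" using h0(2) by (auto intro: tendsto_mult_zero)
  qed
  then show ?thesis using h0 by simp
qed

text \<open>Here \<open>f'\<close> and \<open>g'\<close> are images under the generator. In the
  derivative of \<open>h * g - f * k\<close>, with \<open>h\<close> and \<open>k\<close> the fluxes,
  the cross terms \<open>h * k / W\<close> cancel, and the boundary values vanish.\<close>

lemma generator_symmetric:
  assumes fg: "generator P X f f'" and gg: "generator P X g g'"
  shows "(\<integral>x. f' x * g x \<partial>speed) = (\<integral>x. f x * g' x \<partial>speed)"
proof -
  note F = generatorD[OF fg] and G = generatorD[OF gg]
  note C1 = C0_mult[OF F(2) G(1)] and C2 = C0_mult[OF F(1) G(2)]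
  have C: "C0 (\<lambda>x. f' x * g x - f x * g' x)" using C0_linear[OF C1 C2, of 1 "-1"] by simp
  obtain B where B: "\<And>x. x \<ge> 0 \<Longrightarrow> \<bar>f' x * g x - f x * g' x\<bar> \<le> B" using C0_bounded[OF C] by metis
  obtain h where f: "\<And>x. x \<ge> 0 \<Longrightarrow> (f has_real_derivative h x / weight b x) (at x within {0..})"
    and h: "\<And>x. x \<ge> 0 \<Longrightarrow> (h has_real_derivative 2 * weight b x * f' x) (at x within {0..})"
    and h0: "h 0 = 0" "(h \<longlongrightarrow> 0) at_top"
    using generator_flux[OF fg] by metis
  obtain k where g: "\<And>x. x \<ge> 0 \<Longrightarrow> (g has_real_derivative k x / weight b x) (at x within {0..})"
    and k: "\<And>x. x \<ge> 0 \<Longrightarrow> (k has_real_derivative 2 * weight b x * g' x) (at x within {0..})"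
    and k0: "k 0 = 0" "(k \<longlongrightarrow> 0) at_top"
    using generator_flux[OF gg] by metis
  have "(\<integral>x. f' x * g x - f x * g' x \<partial>speed) = 0 - (h 0 * g 0 - f 0 * k 0)"
  proof (rule speed_integral_FTC[OF C0_continuous[OF C] B, where H="\<lambda>x. h x * g x - f x * k x"])
    fix x :: real assume x: "x \<ge> 0"
    show "((\<lambda>x. h x * g x - f x * k x) has_real_derivative 2 * weight b x * (f' x * g x - f x * g' x)) (at x within {0..})"
      using DERIV_diff[OF DERIV_mult[OF h[OF x] g[OF x]] DERIV_mult[OF f[OF x] k[OF x]]]
      by (simp add: algebra_simps)
  next
    have "(f \<longlongrightarrow> 0) at_top" "(g \<longlongrightarrow> 0) at_top" using F G by (simp_all add: C0_def)
    then have "((\<lambda>x. h x * g x - f x * k x) \<longlongrightarrow> 0 * 0 - 0 * 0) at_top"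
      by (intro tendsto_diff tendsto_mult h0 k0)
    then show "((\<lambda>x. h x * g x - f x * k x) \<longlongrightarrow> 0) at_top" by simp
  qed
  then show ?thesis using h0 k0 integrable_speed_C0[OF C1] integrable_speed_C0[OF C2] by simp
qed

section \<open>Symmetry and conservation of mass for the semigroup\<close>

lemma pairing_bound:
  assumes f: "C0 f" and g: "C0 g" and F: "\<And>x. x \<ge> 0 \<Longrightarrow> \<bar>f x\<bar> \<le> F" and G: "\<And>x. x \<ge> 0 \<Longrightarrow> \<bar>g x\<bar> \<le> G"
  shows "\<bar>\<integral>x. f x * g x \<partial>speed\<bar> \<le> F * G * m_inf"
proof -
  have F0: "F \<ge> 0" using F[of 0] by simp
  have "\<bar>\<integral>x. f x * g x \<partial>speed\<bar> \<le> (\<integral>x. F * G * 1 \<partial>speed)"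
  proof (rule order.trans[OF integral_abs_bound integral_mono])
    show "integrable speed (\<lambda>x. \<bar>f x * g x\<bar>)" using integrable_speed_C0[OF C0_mult[OF f g]] by (rule integrable_abs)
    fix x assume "x \<in> space speed"
    then have x: "x \<ge> 0" by simp
    show "\<bar>f x * g x\<bar> \<le> F * G * 1" using F[OF x] G[OF x] F0 unfolding abs_mult by (simp add: mult_mono)
  qed simp
  also have "\<dots> = F * G * m_inf" unfolding integral_mult_right_zero speed_total ..
  finally show ?thesis .
qed

lemma pairing_deriv:
  assumes \<psi>: "C0 \<psi>" and fg: "generator P X f g" and t: "t \<ge> 0"
  shows "((\<lambda>t. \<integral>x. \<psi> x * T t f x \<partial>speed) has_real_derivative (\<integral>x. \<psi> x * T t g x \<partial>speed)) (at t within {0..})"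
proof -
  note C = generatorD[OF fg]
  obtain B where B: "B \<ge> 0" "\<And>x. x \<ge> 0 \<Longrightarrow> \<bar>\<psi> x\<bar> \<le> B" using C0_bounded[OF \<psi>] by metis
  obtain B' where B': "\<And>x. x \<ge> 0 \<Longrightarrow> \<bar>g x\<bar> \<le> B'" using C0_bounded[OF C(2)] by metis
  note int = integrable_speed_C0[OF C0_mult[OF \<psi> feller]]
  show ?thesis
  proof (rule speed.has_derivative_integral[where S="{0..}" and u="\<lambda>t x. \<psi> x * T t f x" and u'="\<lambda>t x. \<psi> x * T t g x" and B="B * B'"])
    fix t x assume t: "t \<in> {0::real..}" and "x \<in> space speed"
    then have x: "x \<ge> 0" and t0: "t \<ge> 0" by auto
    show "((\<lambda>t. \<psi> x * T t f x) has_real_derivative \<psi> x * T t g x) (at t within {0..})"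
      by (intro DERIV_cmult T_deriv[OF fg t0 x])
    show "\<bar>\<psi> x * T t g x\<bar> \<le> B * B'"
      unfolding abs_mult using B(2)[OF x] T_bound[OF C(2) B' t0 x] B(1) by (intro mult_mono) auto
  qed (use t int C in \<open>auto intro: borel_measurable_integrable\<close>)
qed

text \<open>Interpolation: the pairing of \<open>T r f\<close> with \<open>T (t - r) g\<close> is
  constant in \<open>r\<close>, because both factors stay in the domain and its derivative is zero
  by Green's formula for them.\<close>

lemma T_symmetric:
  assumes ff: "generator P X f f'" and gg: "generator P X g g'" and t: "t \<ge> 0"
  shows "(\<integral>x. T t f x * g x \<partial>speed) = (\<integral>x. f x * T t g x \<partial>speed)"
proof -
  note F = generatorD[OF ff] and G = generatorD[OF gg]
  obtain B1 where B1: "B1 \<ge> 0" "\<And>x. x \<ge> 0 \<Longrightarrow> \<bar>f x\<bar> \<le> B1" using C0_bounded[OF F(1)] by metis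
  obtain B2 where B2: "B2 \<ge> 0" "\<And>x. x \<ge> 0 \<Longrightarrow> \<bar>f' x\<bar> \<le> B2" using C0_bounded[OF F(2)] by metis
  obtain B3 where B3: "B3 \<ge> 0" "\<And>x. x \<ge> 0 \<Longrightarrow> \<bar>g x\<bar> \<le> B3" using C0_bounded[OF G(1)] by metis
  obtain B4 where B4: "B4 \<ge> 0" "\<And>x. x \<ge> 0 \<Longrightarrow> \<bar>g' x\<bar> \<le> B4" using C0_bounded[OF G(2)] by metis
  define u where "u r x = T r f x * T (t - r) g x" for r x
  define u' where "u' r x = T r f' x * T (t - r) g x - T r f x * T (t - r) g' x" for r x
  have int: "integrable speed (u r)" "integrable speed (\<lambda>x. T r f' x * T (t - r) g x)"
    "integrable speed (\<lambda>x. T r f x * T (t - r) g' x)" if "r \<in> {0..t}" for r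
    unfolding u_def using that F G by (auto intro!: integrable_speed_C0 C0_mult feller)
  have int': "integrable speed (u' r)" if "r \<in> {0..t}" for r
    unfolding u'_def using int[OF that] by simp
  have "((\<lambda>r. \<integral>x. u r x \<partial>speed) has_real_derivative 0) (at r within {0..t})" if r: "r \<in> {0..t}" for r
  proof -
    have "((\<lambda>r. \<integral>x. u r x \<partial>speed) has_real_derivative (\<integral>x. u' r x \<partial>speed)) (at r within {0..t})"
    proof (rule speed.has_derivative_integral[where B="B2 * B3 + B1 * B4"])
      fix r x assume r: "r \<in> {0..t}" and "x \<in> space speed"
      then have x: "x \<ge> 0" and r0: "r \<ge> 0" "t - r \<ge> 0" by auto
      have d1: "((\<lambda>r. T r f x) has_real_derivative T r f' x) (at r within {0..t})"
        by (rule has_field_derivative_subset[OF T_deriv[OF ff r0(1) x]]) auto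
      have "((\<lambda>r. T (t - r) g x) has_real_derivative T (t - r) g' x * (- 1)) (at r within {0..t})"
        by (rule has_real_derivative_chain_within[where g="\<lambda>r. t - r" and r=r, OF T_deriv[OF gg r0(2) x]])
           (auto intro!: derivative_eq_intros)
      from DERIV_mult[OF d1 this] show "((\<lambda>r. u r x) has_real_derivative u' r x) (at r within {0..t})"
        unfolding u_def u'_def by (simp add: algebra_simps)
      have "\<bar>T r f' x * T (t - r) g x\<bar> \<le> B2 * B3"
        unfolding abs_mult using T_bound[OF F(2) B2(2) r0(1) x] T_bound[OF G(1) B3(2) r0(2) x] B2(1)
        by (intro mult_mono) auto
      moreover have "\<bar>T r f x * T (t - r) g' x\<bar> \<le> B1 * B4"
        unfolding abs_mult using T_bound[OF F(1) B1(2) r0(1) x] T_bound[OF G(2) B4(2) r0(2) x] B1(1)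
        by (intro mult_mono) auto
      ultimately show "\<bar>u' r x\<bar> \<le> B2 * B3 + B1 * B4" unfolding u'_def by linarith
    qed (use r int int' in \<open>auto intro: borel_measurable_integrable\<close>)
    moreover have "(\<integral>x. u' r x \<partial>speed) = 0"
      unfolding u'_def Bochner_Integration.integral_diff[OF int(2,3)[OF r]]
      using generator_symmetric[OF generator_T[OF ff, of r] generator_T[OF gg, of "t - r"]] r by simp
    ultimately show ?thesis by simp
  qed
  then obtain c where c: "\<And>r. r \<in> {0..t} \<Longrightarrow> (\<integral>x. u r x \<partial>speed) = c"
    using has_field_derivative_zero_constant[of "{0..t}" "\<lambda>r. \<integral>x. u r x \<partial>speed"] by auto
  have "(\<integral>x. T t f x * g x \<partial>speed) = (\<integral>x. u t x \<partial>speed)"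
    by (rule Bochner_Integration.integral_cong) (auto simp: u_def T_0[OF G(1)])
  also have "\<dots> = (\<integral>x. u 0 x \<partial>speed)" using c[of 0] c[of t] t by simp
  also have "\<dots> = (\<integral>x. f x * T t g x \<partial>speed)"
    by (rule Bochner_Integration.integral_cong) (auto simp: u_def T_0[OF F(1)])
  finally show ?thesis .
qed

lemma T_conservative:
  assumes fg: "generator P X f g" and t: "t \<ge> 0"
  shows "(\<integral>x. T t f x \<partial>speed) = (\<integral>x. f x \<partial>speed)"
proof -
  note C = generatorD[OF fg]
  obtain B where B: "\<And>x. x \<ge> 0 \<Longrightarrow> \<bar>g x\<bar> \<le> B" using C0_bounded[OF C(2)] by metis
  have "((\<lambda>t. \<integral>x. T t f x \<partial>speed) has_real_derivative 0) (at t within {0..})" if t: "t \<in> {0..}" for t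
  proof -
    have "((\<lambda>t. \<integral>x. T t f x \<partial>speed) has_real_derivative (\<integral>x. T t g x \<partial>speed)) (at t within {0..})"
    proof (rule speed.has_derivative_integral[where B=B])
      fix t x assume "t \<in> {0::real..}" and "x \<in> space speed"
      then show "((\<lambda>t. T t f x) has_real_derivative T t g x) (at t within {0..})" "\<bar>T t g x\<bar> \<le> B"
        using T_deriv[OF fg] T_bound[OF C(2) B] by auto
    qed (use t integrable_speed_C0[OF feller] C in \<open>auto intro: borel_measurable_integrable\<close>)
    then show ?thesis using generator_conservative[OF generator_T[OF fg]] t by simp
  qed
  then obtain c where c: "\<And>r. r \<in> {0..} \<Longrightarrow> (\<integral>x. T r f x \<partial>speed) = c"
    using has_field_derivative_zero_constant[of "{0..}" "\<lambda>r. \<integral>x. T r f x \<partial>speed"] by auto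
  have "(\<integral>x. T t f x \<partial>speed) = (\<integral>x. T 0 f x \<partial>speed)" using c[of 0] c[of t] t by simp
  also have "\<dots> = (\<integral>x. f x \<partial>speed)"
    by (rule Bochner_Integration.integral_cong) (auto simp: T_0[OF C(1)])
  finally show ?thesis .
qed

section \<open>The function q of the overview and its Laplace transform\<close>

definition autocorr :: "(real \<Rightarrow> real) \<Rightarrow> real \<Rightarrow> real" where
  "autocorr f t = (\<integral>x. f x * T t f x \<partial>speed)"

lemma autocorr_eq_norm:
  assumes fg: "generator P X f g" and t: "t \<ge> 0"
  shows "autocorr f t = (\<integral>x. T (t / 2) f x * T (t / 2) f x \<partial>speed)"
proof -
  have t2: "t / 2 \<ge> 0" using t by simp
  have "(\<integral>x. T (t / 2) f x * T (t / 2) f x \<partial>speed) = (\<integral>x. f x * T (t / 2) (T (t / 2) f) x \<partial>speed)"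
    by (rule T_symmetric[OF fg generator_T[OF fg t2] t2])
  also have "\<dots> = autocorr f t"
    unfolding autocorr_def
  proof (rule Bochner_Integration.integral_cong[OF refl])
    fix x assume "x \<in> space speed"
    then have x: "x \<ge> 0" by simp
    show "f x * T (t / 2) (T (t / 2) f) x = f x * T t f x"
      using T_semigroup[OF generatorD(1)[OF fg] t2 t2 x] by simp
  qed
  finally show ?thesis by simp
qed

lemma autocorr_antimono:
  assumes fg: "generator P X f g" and st: "0 \<le> s" "s \<le> t"
  shows "autocorr f t \<le> autocorr f s"
proof -
  note C = generatorD[OF fg]
  obtain B where B: "B \<ge> 0" "\<And>x. x \<ge> 0 \<Longrightarrow> \<bar>f x\<bar> \<le> B" using C0_bounded[OF C(1)] by metis
  obtain B' where B': "\<And>x. x \<ge> 0 \<Longrightarrow> \<bar>g x\<bar> \<le> B'" using C0_bounded[OF C(2)] by metis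
  define N where "N t = (\<integral>x. T t f x * T t f x \<partial>speed)" for t
  have "- N (s / 2) \<le> - N (t / 2)"
  proof (rule half_line_mono[where f="\<lambda>t. - N t" and f'="\<lambda>t. - (\<integral>x. 2 * (T t f x * T t g x) \<partial>speed)"])
    fix r assume "s / 2 \<le> r" "r \<le> t / 2"
    then have r: "r \<ge> 0" using st by simp
    have "(N has_real_derivative (\<integral>x. 2 * (T r f x * T r g x) \<partial>speed)) (at r within {0..})"
      unfolding N_def
    proof (rule speed.has_derivative_integral[where B="2 * (B * B')" and u="\<lambda>r x. T r f x * T r f x" and u'="\<lambda>r x. 2 * (T r f x * T r g x)"])
      fix r x assume "r \<in> {0::real..}" and "x \<in> space speed"
      then have r: "r \<ge> 0" and x: "x \<ge> 0" by auto
      show "((\<lambda>r. T r f x * T r f x) has_real_derivative 2 * (T r f x * T r g x)) (at r within {0..})"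
        using DERIV_mult[OF T_deriv[OF fg r x] T_deriv[OF fg r x]] by (simp add: algebra_simps)
      have "\<bar>T r f x * T r g x\<bar> \<le> B * B'"
        unfolding abs_mult using T_bound[OF C(1) B(2) r x] T_bound[OF C(2) B' r x] B(1)
        by (intro mult_mono) auto
      then show "\<bar>2 * (T r f x * T r g x)\<bar> \<le> 2 * (B * B')" unfolding abs_mult by simp
    next
      fix r assume "r \<in> {0::real..}"
      then have r: "r \<ge> 0" by simp
      show i: "integrable speed (\<lambda>x. T r f x * T r f x)"
        by (intro integrable_speed_C0 C0_mult feller r C)
      then show "(\<lambda>x. T r f x * T r f x) \<in> borel_measurable speed" by (rule borel_measurable_integrable)
    next
      have "integrable speed (\<lambda>x. T r f x * T r g x)"
        by (intro integrable_speed_C0 C0_mult feller r C)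
      then show "(\<lambda>x. 2 * (T r f x * T r g x)) \<in> borel_measurable speed"
        by (intro borel_measurable_times borel_measurable_const borel_measurable_integrable)
    qed (use r in auto)
    then show "((\<lambda>t. - N t) has_real_derivative - (\<integral>x. 2 * (T r f x * T r g x) \<partial>speed)) (at r within {0..})"
      by (rule DERIV_minus)
    show "0 \<le> - (\<integral>x. 2 * (T r f x * T r g x) \<partial>speed)"
      unfolding integral_mult_right_zero using generator_dissipative[OF generator_T[OF fg r]] by simp
  qed (use st in auto)
  then show ?thesis using autocorr_eq_norm[OF fg] st by (simp add: N_def)
qed

text \<open>Cauchy-Schwarz against the constant 1, in the form of the nonnegative variance of
  \<open>T (t / 2) f\<close> about its mean \<open>c\<close>; the mean is independent of time by
  conservation of mass.\<close>

lemma autocorr_lower: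
  assumes fg: "generator P X f g" and t: "t \<ge> 0"
  shows "(\<integral>x. f x \<partial>speed)\<^sup>2 / m_inf \<le> autocorr f t"
proof -
  note C = generatorD[OF fg]
  have t2: "t / 2 \<ge> 0" using t by simp
  define F where "F = T (t / 2) f"
  define I where "I = (\<integral>x. f x \<partial>speed)"
  have CF: "C0 F" unfolding F_def by (rule feller[OF t2 C(1)])
  have I: "(\<integral>x. F x \<partial>speed) = I" unfolding F_def I_def by (rule T_conservative[OF fg t2])
  have i: "integrable speed (\<lambda>x. F x * F x)" "integrable speed F"
    by (rule integrable_speed_C0[OF C0_mult[OF CF CF]], rule integrable_speed_C0[OF CF])
  define c where "c = I / m_inf"
  have "0 \<le> (\<integral>x. (F x - c)\<^sup>2 \<partial>speed)" by simp
  also have "(\<integral>x. (F x - c)\<^sup>2 \<partial>speed) = (\<integral>x. F x * F x - 2 * c * F x + c\<^sup>2 * 1 \<partial>speed)"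
    by (rule Bochner_Integration.integral_cong) (auto simp: power2_eq_square algebra_simps)
  also have "\<dots> = (\<integral>x. F x * F x \<partial>speed) - 2 * c * (\<integral>x. F x \<partial>speed) + c\<^sup>2 * (\<integral>x. 1 \<partial>speed)"
    using i by simp
  also have "\<dots> = autocorr f t - 2 * c * I + c\<^sup>2 * m_inf"
    unfolding I speed_total using autocorr_eq_norm[OF fg t] by (simp add: F_def)
  also have "\<dots> = autocorr f t - I\<^sup>2 / m_inf"
    using m_inf_pos by (simp add: c_def power2_eq_square field_simps)
  finally show ?thesis by (simp add: I_def)
qed

lemma autocorr_continuous:
  assumes fg: "generator P X f g" shows "continuous_on {0..} (autocorr f)"
  unfolding autocorr_def
  by (rule DERIV_continuous_on, rule pairing_deriv[OF generatorD(1)[OF fg] fg]) simp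

text \<open>\<open>G t\<close>, the pairing of \<open>f\<close> with \<open>T t \<rho>\<close> for
  the resolvent \<open>\<rho>\<close> at \<open>s = (k + 1) * S\<close>, satisfies
  \<open>G' = s * G - autocorr f\<close>. For \<open>A u = exp (- k * u) * G (u / S)\<close> this
  gives \<open>A u - A' u = exp (- k * u) * autocorr f (u / S) / S\<close>, so
  \<open>exp_law_FTC\<close> evaluates the transform as \<open>G 0\<close>, without interchanging
  the integrals over time and space.\<close>

lemma autocorr_laplace:
  assumes fg: "generator P X f g" and S: "S > 0"
  shows "(\<integral>u. exp (- (real k * u)) * (autocorr f (max 0 u / S) / S) \<partial>exp_law)
    = (\<integral>x. f x * resolvent ((real k + 1) * S) f x \<partial>speed)"
proof -
  note C = generatorD[OF fg]
  define s where "s = (real k + 1) * S"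
  have s: "s > 0" using S by (simp add: s_def)
  define \<rho> \<rho>' where "\<rho> = resolvent s f" and "\<rho>' = resolvent s g"
  have gen: "generator P X \<rho> \<rho>'" unfolding \<rho>_def \<rho>'_def by (rule generator_resolvent[OF fg s])
  note R = generatorD[OF gen]
  define G where "G t = (\<integral>x. f x * T t \<rho> x \<partial>speed)" for t
  have T\<rho>': "T t \<rho>' x = s * T t \<rho> x + (- 1) * T t f x" if "t \<ge> 0" "x \<ge> 0" for t x
  proof -
    have "T t \<rho>' x = T t (\<lambda>x. s * \<rho> x + (- 1) * f x) x"
      by (rule T_cong) (use that resolvent_eq[OF fg s] in \<open>auto simp: \<rho>_def \<rho>'_def\<close>)
    also have "\<dots> = s * T t \<rho> x + (- 1) * T t f x" by (rule T_linear[OF R(1) C(1) that])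
    finally show ?thesis .
  qed
  have G': "(G has_real_derivative s * G t - autocorr f t) (at t within {0..})" if t: "t \<ge> 0" for t
  proof -
    have i1: "integrable speed (\<lambda>x. f x * T t \<rho> x)" and i2: "integrable speed (\<lambda>x. f x * T t f x)"
      by (intro integrable_speed_C0 C0_mult feller t C R)+
    have "(\<integral>x. f x * T t \<rho>' x \<partial>speed) = (\<integral>x. s * (f x * T t \<rho> x) - f x * T t f x \<partial>speed)"
    proof (rule Bochner_Integration.integral_cong[OF refl])
      fix x assume "x \<in> space speed"
      then have x: "x \<ge> 0" by simp
      show "f x * T t \<rho>' x = s * (f x * T t \<rho> x) - f x * T t f x"
        unfolding T\<rho>'[OF t x] by (simp add: algebra_simps)
    qed
    also have "\<dots> = s * G t - autocorr f t"
      unfolding G_def autocorr_def using i1 i2 by simp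
    finally show ?thesis
      using pairing_deriv[OF C(1) gen t] unfolding G_def by simp
  qed
  obtain F where F: "F \<ge> 0" "\<And>x. x \<ge> 0 \<Longrightarrow> \<bar>f x\<bar> \<le> F" using C0_bounded[OF C(1)] by metis
  obtain B where B: "B \<ge> 0" "\<And>x. x \<ge> 0 \<Longrightarrow> \<bar>\<rho> x\<bar> \<le> B" using C0_bounded[OF R(1)] by metis
  have Gb: "\<bar>G t\<bar> \<le> F * B * m_inf" if "t \<ge> 0" for t
    unfolding G_def by (rule pairing_bound[OF C(1) feller[OF that R(1)] F(2) T_bound[OF R(1) B(2) that]])
  have qb: "\<bar>autocorr f t\<bar> \<le> F * F * m_inf" if "t \<ge> 0" for t
    unfolding autocorr_def by (rule pairing_bound[OF C(1) feller[OF that C(1)] F(2) T_bound[OF C(1) F(2) that]])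
  define A where "A u = exp (- (real k * u)) * G (u / S)" for u
  define A' where "A' u = exp (- (real k * u)) * (G (u / S) - autocorr f (u / S) / S)" for u
  have e1: "\<bar>exp (- (real k * u)) * y\<bar> \<le> Y" if "u \<ge> 0" "\<bar>y\<bar> \<le> Y" for u y Y
  proof -
    have "\<bar>exp (- (real k * u)) * y\<bar> \<le> 1 * Y" unfolding abs_mult
      by (rule mult_mono) (use that in auto)
    then show ?thesis by simp
  qed
  have cG: "continuous_on {0..} G" by (rule DERIV_continuous_on) (use G' in auto)
  have "(\<integral>u. A (max 0 u) - A' (max 0 u) \<partial>exp_law) = A 0"
  proof (rule exp_law_FTC[where B="F * B * m_inf" and B'="F * B * m_inf + F * F * m_inf / S"])
    fix u :: real assume u: "u \<ge> 0"
    then have uS: "u / S \<ge> 0" using S by simp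
    have d1: "((\<lambda>u. G (u / S)) has_real_derivative (s * G (u / S) - autocorr f (u / S)) / S) (at u within {0..})"
      by (rule has_real_derivative_rescale[OF _ S u]) (rule G')
    have d2: "((\<lambda>u. exp (- (real k * u))) has_real_derivative - real k * exp (- (real k * u))) (at u within {0..})"
      by (auto intro!: derivative_eq_intros)
    have alg: "- real k * E * H + (s * H - Q) / S * E = E * (H - Q / S)" for E H Q :: real
      unfolding s_def using S by (simp add: field_simps)
    show "(A has_real_derivative A' u) (at u within {0..})"
      using DERIV_mult[OF d2 d1] unfolding alg A_def A'_def .
    show "\<bar>A u\<bar> \<le> F * B * m_inf" unfolding A_def by (rule e1[OF u Gb[OF uS]])
    have "\<bar>autocorr f (u / S) / S\<bar> \<le> F * F * m_inf / S" using qb[OF uS] S by (simp add: divide_right_mono)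
    then have "\<bar>G (u / S) - autocorr f (u / S) / S\<bar> \<le> F * B * m_inf + F * F * m_inf / S"
      using Gb[OF uS] by linarith
    then show "\<bar>A' u\<bar> \<le> F * B * m_inf + F * F * m_inf / S" unfolding A'_def by (rule e1[OF u])
  next
    have im: "(\<lambda>u. u / S) ` {0..} \<subseteq> {0..}" using S by auto
    have "continuous_on {0..} (\<lambda>u. u / S)" using S by (intro continuous_intros) auto
    note comp = continuous_on_compose2[OF _ this im]
    show "continuous_on {0..} A'"
      unfolding A'_def by (intro continuous_intros comp[OF cG] comp[OF autocorr_continuous[OF fg]]) (use S in auto)
  qed
  also have "A 0 = G 0" by (simp add: A_def)
  also have "G 0 = (\<integral>x. f x * \<rho> x \<partial>speed)"
    unfolding G_def by (rule Bochner_Integration.integral_cong) (auto simp: T_0[OF R(1)])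
  finally have 1: "(\<integral>u. A (max 0 u) - A' (max 0 u) \<partial>exp_law) = (\<integral>x. f x * \<rho> x \<partial>speed)" .
  have "(\<integral>u. exp (- (real k * u)) * (autocorr f (max 0 u / S) / S) \<partial>exp_law)
      = (\<integral>u. A (max 0 u) - A' (max 0 u) \<partial>exp_law)"
  proof (rule integral_cong_AE)
    have im: "(\<lambda>u. u / S) ` {0..} \<subseteq> {0..}" using S by auto
    have cS: "continuous_on {0..} (\<lambda>u. u / S)" using S by (intro continuous_intros) auto
    note comp = continuous_on_compose2[OF _ cS im]
    note m1 = borel_measurable_max_half_line[OF comp[OF cG]]
    note m2 = borel_measurable_max_half_line[OF comp[OF autocorr_continuous[OF fg]]]
    show "(\<lambda>u. exp (- (real k * u)) * (autocorr f (max 0 u / S) / S)) \<in> borel_measurable exp_law"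
      using m2 by measurable
    show "(\<lambda>u. A (max 0 u) - A' (max 0 u)) \<in> borel_measurable exp_law"
      unfolding A_def A'_def using m1 m2 by measurable
    show "AE u in exp_law. exp (- (real k * u)) * (autocorr f (max 0 u / S) / S) = A (max 0 u) - A' (max 0 u)"
      using AE_exp_law_nonneg
    proof (rule eventually_mono)
      fix u :: real assume "u \<ge> 0"
      then have mu: "max 0 u = u" by simp
      have "E * Q = E * H - E * (H - Q)" for E H Q :: real by (simp add: algebra_simps)
      then show "exp (- (real k * u)) * (autocorr f (max 0 u / S) / S) = A (max 0 u) - A' (max 0 u)"
        unfolding A_def A'_def mu .
    qed
  qed
  then show ?thesis using 1 unfolding \<rho>_def s_def by (rule trans)
qed

text \<open>Integrate \<open>resolvent_eq\<close>; the left-hand side is an image under the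
  generator and integrates to zero.\<close>

lemma resolvent_mass:
  assumes fg: "generator P X f g" and s: "s > 0"
  shows "s * (\<integral>x. resolvent s f x \<partial>speed) = (\<integral>x. f x \<partial>speed)"
proof -
  have gen: "generator P X (resolvent s f) (resolvent s g)" by (rule generator_resolvent[OF fg s])
  note i1 = integrable_speed_C0[OF generatorD(1)[OF gen]] and i2 = integrable_speed_C0[OF generatorD(1)[OF fg]]
  have "0 = (\<integral>x. resolvent s g x \<partial>speed)" using generator_conservative[OF gen] by simp
  also have "\<dots> = (\<integral>x. s * resolvent s f x - f x \<partial>speed)"
    by (rule Bochner_Integration.integral_cong) (use resolvent_eq[OF fg s] in auto)
  also have "\<dots> = s * (\<integral>x. resolvent s f x \<partial>speed) - (\<integral>x. f x \<partial>speed)" using i1 i2 by simp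
  finally show ?thesis by simp
qed

end

section \<open>Approximate delta functions at the origin\<close>

lemma has_real_derivative_pos_part_square:
  "((\<lambda>y. (max 0 y)\<^sup>2) has_real_derivative 2 * max 0 y) (at y)" for y :: real
proof -
  consider "y > 0" | "y < 0" | "y = 0" by linarith
  then show ?thesis
  proof cases
    case 1
    have "((\<lambda>y. y\<^sup>2) has_real_derivative 2 * max 0 y) (at y)"
      using 1 by (auto intro!: derivative_eq_intros)
    then show ?thesis
      by (rule has_field_derivative_transform_within_open[where S="{0<..}"]) (use 1 in auto)
  next
    case 2
    have "((\<lambda>y. 0) has_real_derivative 2 * max 0 y) (at y)"
      using 2 by (auto intro!: derivative_eq_intros)
    then show ?thesis
      by (rule has_field_derivative_transform_within_open[where S="{..<0}"]) (use 2 in auto)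
  next
    case 3
    have "((\<lambda>h::real. ((max 0 (0 + h))\<^sup>2 - (max 0 0)\<^sup>2) / h) \<longlongrightarrow> 0) (at 0)"
    proof (rule Lim_null_comparison)
      show "\<forall>\<^sub>F h in at 0. norm (((max 0 (0 + h))\<^sup>2 - (max 0 0)\<^sup>2) / h) \<le> \<bar>h\<bar>"
        by (rule always_eventually) (auto simp: max_def power2_eq_square)
      show "((\<lambda>h::real. \<bar>h\<bar>) \<longlongrightarrow> 0) (at 0)"
        using tendsto_rabs[OF tendsto_ident_at[of "0::real" UNIV]] by simp
    qed
    then show ?thesis using 3 by (simp add: DERIV_def)
  qed
qed

context diffusion_density
begin

text \<open>An approximate delta function at 0. Membership in the domain of the generator makes
  symmetry, conservation and the resolvent identities available for it.\<close>

definition bump :: "real \<Rightarrow> (real \<Rightarrow> real) \<Rightarrow> (real \<Rightarrow> real) \<Rightarrow> bool" where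
  "bump a \<phi> \<phi>' \<longleftrightarrow> generator P X \<phi> \<phi>' \<and> (\<forall>x\<ge>0. \<phi> x \<ge> 0) \<and> (\<forall>x\<ge>a. \<phi> x = 0) \<and> (\<integral>x. \<phi> x \<partial>speed) = 1"

text \<open>
  Taking the flux \<open>- \<mu> * (max 0 (c - \<mu>))\<^sup>2\<close>, a \<open>C\<^sup>1\<close> function of the speed \<open>\<mu>\<close>, makes \<open>L \<phi>\<close> a continuous
  function of \<open>\<mu>\<close> no matter how rough the drift is.
\<close>

lemma bump_exists:
  assumes a: "a > 0"
  shows "\<exists>\<phi> \<phi>'. bump a \<phi> \<phi>'"
proof -
  define \<mu> where "\<mu> x = m_inf - tail x" for x
  have \<mu>': "(\<mu> has_real_derivative 2 * weight b x) (at x within {0..})" if "x \<ge> 0" for x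
    unfolding \<mu>_def using DERIV_diff[OF DERIV_const tail_deriv[OF that], of m_inf] by simp
  have \<mu>_less: "\<mu> x < \<mu> y" if "0 \<le> x" "x < y" for x y
    by (rule half_line_less[where f'="\<lambda>x. 2 * weight b x"]) (use that \<mu>' weight_pos in auto)
  have \<mu>0: "\<mu> 0 = 0" by (simp add: \<mu>_def)
  have \<mu>_nonneg: "\<mu> x \<ge> 0" if "x \<ge> 0" for x using \<mu>_less[of 0 x] that \<mu>0 by (cases "x = 0") auto
  define c where "c = \<mu> a"
  \<comment> \<open>The factor \<open>\<mu>\<close> makes the flux vanish at 0, which is the
    reflecting condition; the square makes it vanish to second order at \<open>\<mu> = c\<close>, so
    that its derivative in \<open>\<mu>\<close> is continuous and zero beyond \<open>a\<close>. The
    function \<open>g\<close> below is minus that derivative.\<close>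
  define k where "k x = \<mu> x * (max 0 (c - \<mu> x))\<^sup>2" for x
  define g where "g x = 2 * \<mu> x * max 0 (c - \<mu> x) - (max 0 (c - \<mu> x))\<^sup>2" for x
  have k0: "k x \<ge> 0" if "x \<ge> 0" for x unfolding k_def using \<mu>_nonneg[OF that] by simp
  have far: "max 0 (c - \<mu> x) = 0" if "x \<ge> a" for x
    using \<mu>_less[of a x] a that by (cases "x = a") (auto simp: c_def)
  have k_far: "k x = 0" and g_far: "g x = 0" if "x \<ge> a" for x
    using far[OF that] by (simp_all add: k_def g_def)
  have k_pos: "k x > 0" if "0 < x" "x < a" for x
    using \<mu>_less[of 0 x] \<mu>_less[of x a] that \<mu>0 by (simp add: k_def c_def)
  have c\<mu>: "continuous_on {0..} \<mu>" by (rule DERIV_continuous_on, rule \<mu>') simp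
  have ck: "continuous_on {0..} k" and cg: "continuous_on {0..} g"
    unfolding k_def g_def by (intro continuous_intros c\<mu>)+
  have k': "((\<lambda>x. - k x) has_real_derivative 2 * weight b x * g x) (at x within {0..})" if x: "x \<ge> 0" for x
  proof -
    have 1: "((\<lambda>x. c - \<mu> x) has_real_derivative - (2 * weight b x)) (at x within {0..})"
      using DERIV_diff[OF DERIV_const \<mu>'[OF x], of c] by simp
    have 2: "((\<lambda>x. (max 0 (c - \<mu> x))\<^sup>2) has_real_derivative 2 * max 0 (c - \<mu> x) * - (2 * weight b x)) (at x within {0..})"
      by (rule has_real_derivative_chain_within[where g="\<lambda>x. c - \<mu> x" and r=x and A=UNIV, OF has_real_derivative_pos_part_square 1]) simp
    have alg: "- (w * m\<^sup>2 + 2 * m * - w * u) = w * (2 * u * m - m\<^sup>2)" for w m u :: real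
      by (simp add: algebra_simps)
    show ?thesis
      using DERIV_minus[OF DERIV_mult[OF \<mu>'[OF x] 2]] unfolding alg k_def g_def .
  qed
  have ckW: "continuous_on {0..} (\<lambda>x. k x / weight b x)"
    using weight_pos[of b] by (intro continuous_intros ck W_cont) (simp add: less_imp_neq[symmetric])
  define \<phi> where "\<phi> x = integral {0..a} (\<lambda>x. k x / weight b x) - integral {0..x} (\<lambda>x. k x / weight b x)" for x
  have \<phi>': "(\<phi> has_real_derivative - k x / weight b x) (at x within {0..})" if "x \<ge> 0" for x
    unfolding \<phi>_def using DERIV_diff[OF DERIV_const integral_half_line_deriv[OF ckW that]] by simp
  have c\<phi>: "continuous_on {0..} \<phi>" by (rule DERIV_continuous_on, rule \<phi>') simp
  have \<phi>a: "\<phi> a = 0" by (simp add: \<phi>_def)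
  have \<phi>_far: "\<phi> x = 0" if x: "x \<ge> a" for x
  proof -
    have d: "(\<phi> has_real_derivative 0) (at z within {0..})" if "a \<le> z" for z
      using \<phi>'[of z] k_far[of z] a that by simp
    obtain c where c: "\<And>z. z \<in> {a..} \<Longrightarrow> \<phi> z = c"
      using has_field_derivative_zero_constant[of "{a..}" \<phi>] has_field_derivative_subset[OF d, of _ "{a..}"] a by auto
    show ?thesis using c[of a] c[of x] x \<phi>a by simp
  qed
  have \<phi>_pos: "\<phi> x > 0" if x: "0 \<le> x" "x < a" for x
  proof -
    have "- \<phi> x < - \<phi> a"
    proof (rule half_line_less[where f="\<lambda>x. - \<phi> x" and f'="\<lambda>x. - (- k x / weight b x)"])
      show "((\<lambda>x. - \<phi> x) has_real_derivative - (- k z / weight b z)) (at z within {0..})" if "x \<le> z" "z \<le> a" for z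
        by (rule DERIV_minus[OF \<phi>']) (use that x in auto)
      show "0 < - (- k z / weight b z)" if "x < z" "z < a" for z
        using k_pos[of z] weight_pos[of b z] that x by simp
    qed (use x in auto)
    then show ?thesis using \<phi>a by simp
  qed
  have \<phi>_nonneg: "\<phi> x \<ge> 0" if "x \<ge> 0" for x
    using \<phi>_pos[of x] \<phi>_far[of x] that by (cases "x < a") auto
  have C0\<phi>: "C0 \<phi>" and C0g: "C0 g"
    unfolding C0_def using c\<phi> cg
    by (auto intro!: tendsto_eventually eventually_at_top_linorderI[of a] simp: \<phi>_far g_far)
  define Z where "Z = (\<integral>x. \<phi> x \<partial>speed)"
  have Z: "Z > 0"
  proof -
    obtain B where B: "\<And>x. x \<ge> 0 \<Longrightarrow> \<bar>\<phi> x\<bar> \<le> B" using C0_bounded[OF C0\<phi>] by metis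
    define H where "H x = integral {0..x} (\<lambda>x. 2 * weight b x * \<phi> x)" for x
    have cH: "continuous_on {0..} (\<lambda>x. 2 * weight b x * \<phi> x)" by (intro continuous_intros W_cont c\<phi>)
    have H': "(H has_real_derivative 2 * weight b x * \<phi> x) (at x within {0..})" if "x \<ge> 0" for x
      unfolding H_def by (rule integral_half_line_deriv[OF cH that])
    have "H 0 = 0" by (simp add: H_def)
    then have lim: "(H \<longlongrightarrow> Z) at_top"
      using speed_integral_antiderivative_tendsto[OF c\<phi> B H'] by (simp add: Z_def)
    have "H 0 < H a"
      by (rule half_line_less[where f'="\<lambda>x. 2 * weight b x * \<phi> x"])
         (use a H' \<phi>_pos weight_pos in auto)
    moreover have "H a \<le> Z"
    proof (rule half_line_le_limit[where f=H and f'="\<lambda>x. 2 * weight b x * \<phi> x", OF _ _ _ lim])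
      fix z assume "a \<le> z"
      then have z: "z \<ge> 0" using a by simp
      show "(H has_real_derivative 2 * weight b z * \<phi> z) (at z within {0..})" by (rule H'[OF z])
      show "0 \<le> 2 * weight b z * \<phi> z"
        using \<phi>_nonneg[OF z] weight_pos[of b z] by simp
    qed (use a in simp)
    ultimately show ?thesis using \<open>H 0 = 0\<close> by simp
  qed
  have "generator P X (\<lambda>x. \<phi> x / Z) (\<lambda>x. g x / Z)"
    unfolding generator_eq reflecting_L_iff[OF b_int]
  proof (intro conjI exI[of _ "\<lambda>x. - k x / Z"] allI impI)
    show "C0 (\<lambda>x. \<phi> x / Z)" "C0 (\<lambda>x. g x / Z)"
      using C0_linear[OF C0\<phi> C0\<phi>, of "1 / Z" 0] C0_linear[OF C0g C0g, of "1 / Z" 0] by simp_all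
    show "- k 0 / Z = 0" by (simp add: k_def \<mu>0)
    fix x :: real assume x: "0 \<le> x"
    show "((\<lambda>x. \<phi> x / Z) has_real_derivative - k x / Z / weight b x) (at x within {0..})"
      using DERIV_cdivide[OF \<phi>'[OF x], of Z] by (simp add: mult.commute)
    show "((\<lambda>x. - k x / Z) has_real_derivative 2 * weight b x * (g x / Z)) (at x within {0..})"
      using DERIV_cdivide[OF k'[OF x], of Z] by simp
  qed
  moreover have "(\<integral>x. \<phi> x / Z \<partial>speed) = 1"
    using Z unfolding integral_divide_zero Z_def[symmetric] by simp
  ultimately have "bump a (\<lambda>x. \<phi> x / Z) (\<lambda>x. g x / Z)"
    unfolding bump_def using \<phi>_nonneg \<phi>_far Z by auto
  then show ?thesis by blast
qed

section \<open>Averaging over approximate delta functions\<close>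

lemma T_density:
  assumes f: "C0 f" and t: "t > 0" and x: "x \<ge> 0"
  shows "integrable speed (\<lambda>y. p t x y * f y)" and "T t f x = (\<integral>y. p t x y * f y \<partial>speed)"
proof -
  have c: "continuous_on ({0..} \<times> {0..}) (\<lambda>(x, y). p t x y)" and p0: "\<And>y. y \<ge> 0 \<Longrightarrow> p t x y \<ge> 0"
    and d: "distr (P x) half_line (X t) = density speed (\<lambda>y. ennreal (p t x y))"
    using density t x unfolding transition_density_def speed_measure_eq by auto
  have "continuous_on {0..} (\<lambda>y. (\<lambda>(x, y). p t x y) (x, y))"
    by (rule continuous_on_compose2[OF c]) (use x in \<open>auto intro!: continuous_intros\<close>)
  then have "continuous_on {0..} (p t x)" by simp
  then have mp: "p t x \<in> borel_measurable speed" by (rule borel_measurable_speed)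
  have mf: "f \<in> borel_measurable speed" using f by (intro borel_measurable_speed C0_continuous)
  have mh: "f \<in> borel_measurable half_line" using f by (intro borel_measurable_half_line C0_continuous)
  have mX: "X t \<in> P x \<rightarrow>\<^sub>M half_line"
    using measurable_X[of t] t measurable_cong_sets[OF sets_P[OF x] refl] by auto
  have nn: "AE y in speed. 0 \<le> p t x y" using p0 by (intro AE_I2) simp
  have "integrable (distr (P x) half_line (X t)) f"
    using integrable_C0_X[OF f _ x] t by (subst integrable_distr_eq[OF mX mh]) simp
  then show "integrable speed (\<lambda>y. p t x y * f y)"
    unfolding d using integrable_density[OF mf mp nn] by simp
  have "T t f x = (\<integral>y. f y \<partial>distr (P x) half_line (X t))"
    unfolding transition_op_def by (rule integral_distr[OF mX mh, symmetric])
  then show "T t f x = (\<integral>y. p t x y * f y \<partial>speed)"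
    unfolding d using integral_density[OF mf mp nn] by simp
qed

text \<open>\<open>\<phi>\<close> is a probability density with respect to the speed measure,
  concentrated on \<open>[0, a)\<close>.\<close>

lemma bump_average:
  assumes \<phi>: "bump a \<phi> \<phi>'" and i: "integrable speed (\<lambda>x. g x * \<phi> x)"
    and g: "\<And>x. 0 \<le> x \<Longrightarrow> x < a \<Longrightarrow> \<bar>g x - c\<bar> \<le> e"
  shows "\<bar>(\<integral>x. g x * \<phi> x \<partial>speed) - c\<bar> \<le> e"
proof -
  have \<phi>0: "\<And>x. x \<ge> 0 \<Longrightarrow> \<phi> x \<ge> 0" and \<phi>a: "\<And>x. x \<ge> a \<Longrightarrow> \<phi> x = 0" and \<phi>1: "(\<integral>x. \<phi> x \<partial>speed) = 1"
    and gen: "generator P X \<phi> \<phi>'"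
    using \<phi> by (auto simp: bump_def)
  have i\<phi>: "integrable speed \<phi>" using generatorD[OF gen] integrable_speed_C0 by blast
  have ic: "integrable speed (\<lambda>x. c * \<phi> x)" and ie: "integrable speed (\<lambda>x. e * \<phi> x)" using i\<phi> by simp_all
  have "(\<integral>x. g x * \<phi> x \<partial>speed) - c = (\<integral>x. g x * \<phi> x - c * \<phi> x \<partial>speed)"
    unfolding Bochner_Integration.integral_diff[OF i ic] integral_mult_right_zero \<phi>1 by simp
  also have "\<bar>\<dots>\<bar> \<le> (\<integral>x. e * \<phi> x \<partial>speed)"
  proof (rule order.trans[OF integral_abs_bound integral_mono])
    show "integrable speed (\<lambda>x. \<bar>g x * \<phi> x - c * \<phi> x\<bar>)"
      by (intro integrable_abs Bochner_Integration.integrable_diff i ic)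
    show "integrable speed (\<lambda>x. e * \<phi> x)" by (rule ie)
    fix x assume "x \<in> space speed"
    then have x: "x \<ge> 0" by simp
    have "\<bar>g x * \<phi> x - c * \<phi> x\<bar> = \<bar>g x - c\<bar> * \<phi> x"
      unfolding left_diff_distrib[symmetric] abs_mult using \<phi>0[OF x] by simp
    also have "\<dots> \<le> e * \<phi> x"
      using g[OF x] \<phi>0[OF x] \<phi>a[of x] by (cases "x < a") (auto intro: mult_right_mono)
    finally show "\<bar>g x * \<phi> x - c * \<phi> x\<bar> \<le> e * \<phi> x" .
  qed
  also have "\<dots> = e" unfolding integral_mult_right_zero \<phi>1 by simp
  finally show ?thesis .
qed

text \<open>\<open>autocorr \<phi> t\<close> averages \<open>p t x y\<close> over
  \<open>[0, a)\<close> in both variables, and \<open>p t\<close> is continuous at the corner.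
  Validity for every bump of width \<open>a\<close> allows the bump to be picked after
  \<open>a\<close>.\<close>

lemma autocorr_bump_approx:
  assumes t: "t > 0" and e: "e > 0"
  shows "\<forall>\<^sub>F a in at_right 0. \<forall>\<phi> \<phi>'. bump a \<phi> \<phi>' \<longrightarrow> \<bar>autocorr \<phi> t - p t 0 0\<bar> \<le> e"
proof -
  have c: "continuous_on ({0..} \<times> {0..}) (\<lambda>(x, y). p t x y)"
    using density t unfolding transition_density_def by auto
  obtain d where d: "d > 0" and pd: "\<And>z. z \<in> {0..} \<times> {0..} \<Longrightarrow> dist z (0, 0) < d \<Longrightarrow>
      dist ((\<lambda>(x, y). p t x y) z) ((\<lambda>(x, y). p t x y) (0, 0)) < e"
    using c e unfolding continuous_on_iff by (metis (no_types, lifting) SigmaI atLeast_iff order_refl)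
  have near: "\<bar>p t x y - p t 0 0\<bar> \<le> e" if "0 \<le> x" "x < d / 2" "0 \<le> y" "y < d / 2" for x y
  proof -
    have "dist (x, y) (0, 0) \<le> \<bar>x\<bar> + \<bar>y\<bar>"
      unfolding dist_prod_def using sqrt_sum_squares_le_sum_abs[of x y] by (simp add: dist_real_def)
    then have "dist (x, y) (0, 0) < d" using that by simp
    then show ?thesis using pd[of "(x, y)"] that by (simp add: dist_real_def)
  qed
  show ?thesis
    unfolding eventually_at_right_field
  proof (intro exI[of _ "d / 2"] conjI allI impI)
    fix a \<phi> \<phi>' assume a: "0 < a" "a < d / 2" and \<phi>: "bump a \<phi> \<phi>'"
    then have gen: "generator P X \<phi> \<phi>'" by (simp add: bump_def)
    note C = generatorD(1)[OF gen]
    have T: "\<bar>T t \<phi> x - p t 0 0\<bar> \<le> e" if x: "0 \<le> x" "x < a" for x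
      unfolding T_density(2)[OF C t x(1)]
      by (rule bump_average[OF \<phi> T_density(1)[OF C t x(1)]]) (use near x a in auto)
    have "\<bar>(\<integral>x. T t \<phi> x * \<phi> x \<partial>speed) - p t 0 0\<bar> \<le> e"
      by (rule bump_average[OF \<phi> _ T]) (use t C in \<open>auto intro!: integrable_speed_C0 C0_mult feller\<close>)
    then show "\<bar>autocorr \<phi> t - p t 0 0\<bar> \<le> e" unfolding autocorr_def by (simp add: mult.commute)
  qed (use d in auto)
qed

text \<open>The flux is \<open>s * I \<rho> - I \<phi>\<close> with \<open>I\<close> the cumulative
  integral against the speed measure. Both terms lie in \<open>[0, 1]\<close>, so the flux is at
  most 1 in absolute value, the slope of \<open>\<rho>\<close> is at most \<open>w\<close>, and
  \<open>\<rho>\<close> is constant on \<open>[0, a]\<close> up to \<open>w * a\<close>. At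
  \<open>a\<close> the bump has spent all its mass, \<open>I \<phi> a = 1\<close>, whence
  \<open>h a / s = I \<rho> a - 1 / s\<close>.\<close>

lemma bump_resolvent:
  assumes \<phi>: "bump a \<phi> \<phi>'" and a: "0 < a" and s: "s > 0"
    and w: "\<And>x. 0 \<le> x \<Longrightarrow> x \<le> a \<Longrightarrow> 1 / weight b x \<le> w"
  obtains h where "resolvent_tail (weight b) m_inf s a (resolvent s \<phi>) h"
    and "0 \<le> resolvent s \<phi> a"
    and "- 1 / s \<le> h a / s" and "h a / s \<le> (resolvent s \<phi> a + w * a) * (m_inf - tail a) - 1 / s"
    and "\<bar>(\<integral>x. \<phi> x * resolvent s \<phi> x \<partial>speed) - resolvent s \<phi> a\<bar> \<le> w * a"
proof -
  have \<phi>0: "\<And>x. x \<ge> 0 \<Longrightarrow> \<phi> x \<ge> 0" and \<phi>a: "\<And>x. x \<ge> a \<Longrightarrow> \<phi> x = 0" and \<phi>1: "(\<integral>x. \<phi> x \<partial>speed) = 1"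
    and gen: "generator P X \<phi> \<phi>'"
    using \<phi> by (auto simp: bump_def)
  define \<rho> where "\<rho> = resolvent s \<phi>"
  have rgen: "generator P X \<rho> (resolvent s \<phi>')" unfolding \<rho>_def by (rule generator_resolvent[OF gen s])
  note C = generatorD[OF gen] and R = generatorD[OF rgen]
  have \<rho>0: "\<rho> x \<ge> 0" if "x \<ge> 0" for x
    unfolding \<rho>_def by (rule resolvent_nonneg[OF \<phi>0 s that])
  have Lr: "resolvent s \<phi>' x = s * \<rho> x - \<phi> x" if "x \<ge> 0" for x
    unfolding \<rho>_def by (rule resolvent_eq[OF gen s that])
  obtain h where \<rho>': "\<And>x. x \<ge> 0 \<Longrightarrow> (\<rho> has_real_derivative h x / weight b x) (at x within {0..})"
    and h'': "\<And>x. x \<ge> 0 \<Longrightarrow> (h has_real_derivative 2 * weight b x * resolvent s \<phi>' x) (at x within {0..})"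
    and h0: "h 0 = 0" and hlim: "(h \<longlongrightarrow> 0) at_top"
    using generator_flux[OF rgen] by metis
  have h': "(h has_real_derivative 2 * weight b x * (s * \<rho> x - \<phi> x)) (at x within {0..})" if "x \<ge> 0" for x
    using h''[OF that] Lr[OF that] by simp
  define I where "I f x = integral {0..x} (\<lambda>x. 2 * weight b x * f x)" for f x
  have I': "(I f has_real_derivative 2 * weight b x * f x) (at x within {0..})" if "C0 f" "x \<ge> 0" for f x
    unfolding I_def using that by (intro integral_half_line_deriv continuous_intros W_cont C0_continuous)
  have I0: "I f 0 = 0" for f by (simp add: I_def)
  have I_lim: "(I f \<longlongrightarrow> (\<integral>x. f x \<partial>speed)) at_top" if f: "C0 f" for f
  proof -
    obtain B where B: "\<And>x. x \<ge> 0 \<Longrightarrow> \<bar>f x\<bar> \<le> B" using C0_bounded[OF f] by metis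
    show ?thesis
      using speed_integral_antiderivative_tendsto[OF C0_continuous[OF f] B I'[OF f]] by (simp add: I0)
  qed
  have I'0: "0 \<le> 2 * weight b z * f z" if "\<And>x. x \<ge> 0 \<Longrightarrow> f x \<ge> 0" "z \<ge> 0" for f z
    using that(1)[OF that(2)] weight_pos[of b z] by simp
  have I_le: "I f x \<le> (\<integral>x. f x \<partial>speed)" if f: "C0 f" "\<And>x. x \<ge> 0 \<Longrightarrow> f x \<ge> 0" and x: "0 \<le> x" for f x
    by (rule half_line_le_limit[where f="I f", OF x I'[OF f(1)] I'0[of f, OF f(2)] I_lim[OF f(1)]])
       (use x in simp_all)
  have I_nonneg: "0 \<le> I f x" if f: "C0 f" "\<And>x. x \<ge> 0 \<Longrightarrow> f x \<ge> 0" and x: "0 \<le> x" for f x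
    using half_line_mono[where f="I f", OF order_refl x I'[OF f(1)] I'0[of f, OF f(2)]] I0[of f] by simp
  have hI: "h x = s * I \<rho> x - I \<phi> x" if x: "x \<ge> 0" for x
  proof -
    have d: "((\<lambda>x. h x - (s * I \<rho> x - I \<phi> x)) has_real_derivative 0) (at z within {0..})" if "z \<in> {0..}" for z
    proof -
      have z: "z \<ge> 0" using that by simp
      have alg: "2 * v * (s * q - r) - (s * (2 * v * q) - 2 * v * r) = 0" for v q r :: real
        by (simp add: algebra_simps)
      show ?thesis
        using DERIV_diff[OF h'[OF z] DERIV_diff[OF DERIV_cmult[OF I'[OF R(1) z], of s] I'[OF C(1) z]]]
        unfolding alg .
    qed
    obtain c where c: "\<And>x. x \<in> {0..} \<Longrightarrow> h x - (s * I \<rho> x - I \<phi> x) = c"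
      using has_field_derivative_zero_constant[OF _ d] by auto
    then show ?thesis using c[of 0] c[of x] x by (simp add: I0 h0)
  qed
  have mass: "s * (\<integral>x. \<rho> x \<partial>speed) = 1" unfolding \<rho>_def using resolvent_mass[OF gen s] \<phi>1 by simp
  have sI: "0 \<le> s * I \<rho> x" "s * I \<rho> x \<le> 1" if "x \<ge> 0" for x
    using mult_left_mono[OF I_le[OF R(1) \<rho>0 that], of s] I_nonneg[OF R(1) \<rho>0 that] s mass by simp_all
  have I\<phi>: "0 \<le> I \<phi> x" "I \<phi> x \<le> 1" if "x \<ge> 0" for x
    using I_le[OF C(1) \<phi>0 that] I_nonneg[OF C(1) \<phi>0 that] \<phi>1 by simp_all
  have habs: "\<bar>h x\<bar> \<le> 1" if "x \<ge> 0" for x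
    unfolding hI[OF that] using sI[OF that] I\<phi>[OF that] by linarith
  have I\<phi>a: "I \<phi> a = 1"
  proof -
    have lim: "((\<lambda>x. - I \<phi> x) \<longlongrightarrow> - 1) at_top"
      using tendsto_minus[OF I_lim[OF C(1)]] \<phi>1 by simp
    have "- I \<phi> a \<le> - 1"
    proof (rule half_line_le_limit[where f="\<lambda>x. - I \<phi> x" and f'="\<lambda>x. - (2 * weight b x * \<phi> x)", OF _ _ _ lim])
      fix z assume z: "a \<le> z"
      show "((\<lambda>x. - I \<phi> x) has_real_derivative - (2 * weight b z * \<phi> z)) (at z within {0..})"
        by (rule DERIV_minus[OF I'[OF C(1)]]) (use z a in auto)
      show "0 \<le> - (2 * weight b z * \<phi> z)" using \<phi>a[OF z] by simp
    qed (use a in simp)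
    then show ?thesis using I\<phi>[of a] a by simp
  qed
  have w0: "w \<ge> 0" using w[of 0] a weight_pos[of b 0] by (simp add: order.trans[OF less_imp_le, rotated])
  have lip: "\<bar>\<rho> x - \<rho> a\<bar> \<le> w * a" if x: "0 \<le> x" "x \<le> a" for x
  proof -
    have "norm (\<rho> x - \<rho> a) \<le> w * norm (x - a)"
    proof (rule field_differentiable_bound[of "{0..a}" \<rho> "\<lambda>x. h x / weight b x"])
      fix z assume z: "z \<in> {0..a}"
      show "(\<rho> has_real_derivative h z / weight b z) (at z within {0..a})"
        by (rule has_field_derivative_subset[OF \<rho>']) (use z in auto)
      have "\<bar>h z\<bar> * (1 / weight b z) \<le> 1 * w"
        by (rule mult_mono) (use habs[of z] w[of z] z weight_pos[of b z] in auto)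
      then show "norm (h z / weight b z) \<le> w" using weight_pos[of b z] by (simp add: abs_divide)
    qed (use x a in auto)
    also have "\<dots> \<le> w * a" using x w0 by (intro mult_left_mono) auto
    finally show ?thesis by simp
  qed
  have I\<rho>a: "I \<rho> a \<le> (\<rho> a + w * a) * (m_inf - tail a)"
  proof -
    let ?g = "\<lambda>x. (\<rho> a + w * a) * (m_inf - tail x) - I \<rho> x"
    have "?g 0 \<le> ?g a"
    proof (rule half_line_mono[where f="?g" and f'="\<lambda>x. 2 * weight b x * (\<rho> a + w * a - \<rho> x)"])
      fix z assume z: "0 \<le> z" "z \<le> a"
      have d: "((\<lambda>x. m_inf - tail x) has_real_derivative 2 * weight b z) (at z within {0..})"
        using DERIV_diff[OF DERIV_const tail_deriv[OF z(1)], of m_inf] by simp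
      have alg: "c * (2 * v) - 2 * v * r = 2 * v * (c - r)" for c v r :: real by (simp add: algebra_simps)
      show "(?g has_real_derivative 2 * weight b z * (\<rho> a + w * a - \<rho> z)) (at z within {0..})"
        using DERIV_diff[OF DERIV_cmult[OF d, of "\<rho> a + w * a"] I'[OF R(1) z(1)]] unfolding alg .
      show "0 \<le> 2 * weight b z * (\<rho> a + w * a - \<rho> z)"
        using lip[OF z] weight_pos[of b z] by (intro mult_nonneg_nonneg) auto
    qed (use a in auto)
    then show ?thesis by (simp add: I0)
  qed
  show ?thesis
  proof (rule that)
    show "resolvent_tail (weight b) m_inf s a (resolvent s \<phi>) h"
    proof
      fix x assume x: "x \<ge> a"
      then have x0: "x \<ge> 0" using a by simp
      show "(resolvent s \<phi> has_real_derivative h x / weight b x) (at x within {0..})"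
        using \<rho>'[OF x0] unfolding \<rho>_def .
      show "(h has_real_derivative 2 * weight b x * (s * resolvent s \<phi> x)) (at x within {0..})"
        using h'[OF x0] \<phi>a[OF x] unfolding \<rho>_def by simp
      show "0 \<le> resolvent s \<phi> x" using \<rho>0[OF x0] unfolding \<rho>_def .
    qed (use s a hlim in auto)
    show "0 \<le> resolvent s \<phi> a" using \<rho>0[of a] a unfolding \<rho>_def by simp
    have ha: "h a / s = I \<rho> a - 1 / s" using hI[of a] a s I\<phi>a by (simp add: field_simps)
    show "- 1 / s \<le> h a / s" unfolding ha using I_nonneg[OF R(1) \<rho>0, of a] a by simp
    show "h a / s \<le> (resolvent s \<phi> a + w * a) * (m_inf - tail a) - 1 / s"
      unfolding ha using I\<rho>a unfolding \<rho>_def by simp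
    have "\<bar>(\<integral>x. \<rho> x * \<phi> x \<partial>speed) - \<rho> a\<bar> \<le> w * a"
      by (rule bump_average[OF \<phi>]) (use lip in \<open>auto intro!: integrable_speed_C0 C0_mult R C\<close>)
    then show "\<bar>(\<integral>x. \<phi> x * resolvent s \<phi> x \<partial>speed) - resolvent s \<phi> a\<bar> \<le> w * a"
      unfolding \<rho>_def by (simp only: mult.commute)
  qed
qed

end

section \<open>Asymptotics of the Green function and of the transition density\<close>

lemma filterlim_inverse_sqrt_at_right: "filterlim (\<lambda>s. 1 / sqrt s) at_top (at_right (0::real))"
proof -
  have "filterlim sqrt (at_right 0) (at_right 0)"
    unfolding filterlim_at
  proof
    show "(sqrt \<longlongrightarrow> 0) (at_right 0)"
      using tendsto_real_sqrt[OF tendsto_ident_at[of "0::real" "{0<..}"]] by simp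
    show "\<forall>\<^sub>F s in at_right 0. sqrt s \<in> {0<..} \<and> sqrt s \<noteq> 0"
      unfolding eventually_at_right_field by (auto intro: exI[of _ 1])
  qed
  then show ?thesis
    using filterlim_compose[OF filterlim_inverse_at_top_right] by (simp add: inverse_eq_divide)
qed

locale regular_diffusion_density = diffusion_density b \<Omega> P X p m_inf + regular_weight "weight b" m_inf
  for b :: "real \<Rightarrow> real" and \<Omega> :: "'w measure" and P X p m_inf
begin

abbreviation green :: "real \<Rightarrow> (real \<Rightarrow> real) \<Rightarrow> real" where
  "green s \<phi> \<equiv> (\<integral>x. \<phi> x * resolvent s \<phi> x \<partial>speed)"

lemma tail_sqrt_tendsto: "((\<lambda>s. tail (1 / sqrt s)) \<longlongrightarrow> 0) (at_right 0)"
  by (rule filterlim_compose[OF tail_tendsto filterlim_inverse_sqrt_at_right])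

lemma tail_tendsto_0: "(tail \<longlongrightarrow> m_inf) (at_right 0)"
proof -
  have "(tail \<longlongrightarrow> tail 0) (at 0 within {0..})"
    using tail_cont unfolding continuous_on_def by (meson atLeast_iff order_refl)
  then have "(tail \<longlongrightarrow> m_inf) (at 0 within {0..})" by simp
  then show ?thesis by (rule tendsto_within_subset) auto
qed

text \<open>With \<open>M\<close> the resolvent at \<open>a\<close>,
  \<open>deficit_asymptotics\<close> places \<open>M * m_inf - 1 / s\<close> between
  \<open>(1 - \<delta>) * \<tau> * M\<close> and \<open>(1 + \<delta>) * \<tau> * M\<close>, up to
  terms vanishing with \<open>a\<close>; solving for \<open>s * M\<close> gives the two fractions.
  The passage from \<open>\<delta>\<close> to \<open>2 * \<delta>\<close> makes room for these terms
  and for the difference between \<open>M\<close> and \<open>green s \<phi>\<close>.\<close>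

lemma green_bounds:
  assumes \<delta>: "0 < \<delta>" "\<delta> \<le> 1 / 4"
  shows "\<forall>\<^sub>F s in at_right 0. \<forall>\<^sub>F a in at_right 0. \<forall>\<phi> \<phi>'. bump a \<phi> \<phi>' \<longrightarrow>
    1 / (m_inf - (1 - 2 * \<delta>) * tail (1 / sqrt s)) \<le> s * green s \<phi> \<and>
    s * green s \<phi> \<le> 1 / (m_inf - (1 + 2 * \<delta>) * tail (1 / sqrt s))"
proof -
  obtain s0 where s0: "s0 > 0" and deficit: "\<And>s a f h. 0 < s \<Longrightarrow> s < s0 \<Longrightarrow> a \<le> 1 \<Longrightarrow>
      resolvent_tail (weight b) m_inf s a f h \<Longrightarrow>
      (1 - \<delta>) * tail (1 / sqrt s) * f a \<le> f a * tail a + h a / s \<and>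
      f a * tail a + h a / s \<le> (1 + \<delta>) * tail (1 / sqrt s) * f a"
    using deficit_asymptotics[of \<delta>] \<delta> by auto
  have "continuous_on {0..1} (\<lambda>x. 1 / weight b x)"
    using weight_pos[of b] by (intro continuous_intros continuous_on_subset[OF W_cont]) (auto simp: less_imp_neq[symmetric])
  then have "bounded ((\<lambda>x. 1 / weight b x) ` {0..1})"
    by (intro compact_imp_bounded compact_continuous_image) auto
  then obtain w where w: "\<And>x. x \<in> {0..1} \<Longrightarrow> \<bar>1 / weight b x\<bar> \<le> w"
    unfolding bounded_iff real_norm_def by blast
  have "\<forall>\<^sub>F s in at_right 0. tail (1 / sqrt s) < m_inf / 2"
    by (rule order_tendstoD[OF tail_sqrt_tendsto]) (use m_inf_pos in simp)
  moreover have "\<forall>\<^sub>F s in at_right 0. 0 < s \<and> s < s0"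
    unfolding eventually_at_right_field using s0 by auto
  ultimately show ?thesis
  proof eventually_elim
    case (elim s)
    then have s: "s > 0" "s < s0" by auto
    define \<tau> where "\<tau> = tail (1 / sqrt s)"
    have \<tau>: "\<tau> > 0" "\<tau> < m_inf / 2" using elim tail_pos s by (auto simp: \<tau>_def)
    \<comment> \<open>\<open>1 + 2 * \<delta> \<le> 3 / 2\<close> and
      \<open>\<tau> < m_inf / 2\<close> keep the denominators \<open>m_inf - c * \<tau>\<close>
      positive.\<close>
    have c\<tau>: "c * \<tau> < m_inf" if "c \<le> 3 / 2" for c
    proof -
      have "c * \<tau> \<le> 3 / 2 * \<tau>" using that \<tau> by (intro mult_right_mono) auto
      then show ?thesis using \<tau> by linarith
    qed
    have c: "(1 + \<delta>) * \<tau> < m_inf" "(1 - \<delta>) * \<tau> < m_inf" "(1 + 2 * \<delta>) * \<tau> < m_inf" "(1 - 2 * \<delta>) * \<tau> < m_inf"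
      using \<delta> by (auto intro!: c\<tau>)
    have d\<tau>: "(1 + \<delta>) * \<tau> < (1 + 2 * \<delta>) * \<tau>" "(1 - 2 * \<delta>) * \<tau> < (1 - \<delta>) * \<tau>"
      using \<delta> \<tau> by (auto intro!: mult_strict_right_mono)
    have id: "((\<lambda>a::real. a) \<longlongrightarrow> 0) (at_right 0)" by (rule tendsto_ident_at)
    \<comment> \<open>As \<open>a\<close> tends to 0, the bound with its errors converges to the
      fraction for \<open>1 + \<delta>\<close>, strictly below the one for
      \<open>1 + 2 * \<delta>\<close>. The lower bound is treated likewise.\<close>
    have "((\<lambda>a. s * w * a + 1 / (tail a - (1 + \<delta>) * \<tau>)) \<longlongrightarrow> s * w * 0 + 1 / (m_inf - (1 + \<delta>) * \<tau>)) (at_right 0)"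
      using c by (intro tendsto_intros id tail_tendsto_0) auto
    moreover have "s * w * 0 + 1 / (m_inf - (1 + \<delta>) * \<tau>) < 1 / (m_inf - (1 + 2 * \<delta>) * \<tau>)"
      using c d\<tau> by (simp add: frac_less2)
    ultimately have ev1: "\<forall>\<^sub>F a in at_right 0. s * w * a + 1 / (tail a - (1 + \<delta>) * \<tau>) < 1 / (m_inf - (1 + 2 * \<delta>) * \<tau>)"
      by (rule order_tendstoD)
    have "((\<lambda>a. - (s * w * a) + (1 - s * w * a * (m_inf - tail a)) / (m_inf - (1 - \<delta>) * \<tau>)) \<longlongrightarrow>
        - (s * w * 0) + (1 - s * w * 0 * (m_inf - m_inf)) / (m_inf - (1 - \<delta>) * \<tau>)) (at_right 0)"
      using c by (intro tendsto_intros id tail_tendsto_0) auto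
    moreover have "1 / (m_inf - (1 - 2 * \<delta>) * \<tau>) < - (s * w * 0) + (1 - s * w * 0 * (m_inf - m_inf)) / (m_inf - (1 - \<delta>) * \<tau>)"
      using c d\<tau> by (simp add: frac_less2)
    ultimately have ev2: "\<forall>\<^sub>F a in at_right 0. 1 / (m_inf - (1 - 2 * \<delta>) * \<tau>) <
        - (s * w * a) + (1 - s * w * a * (m_inf - tail a)) / (m_inf - (1 - \<delta>) * \<tau>)"
      by (rule order_tendstoD)
    have ev3: "\<forall>\<^sub>F a in at_right 0. (1 + \<delta>) * \<tau> < tail a"
      by (rule order_tendstoD(1)[OF tail_tendsto_0 c(1)])
    have ev4: "\<forall>\<^sub>F a in at_right 0. 0 < a \<and> a < (1::real)"
      unfolding eventually_at_right_field by (auto intro: exI[of _ 1])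
    show ?case
      using ev1 ev2 ev3 ev4
    proof eventually_elim
      case (elim a)
      show ?case
      proof (intro allI impI)
        fix \<phi> \<phi>' assume \<phi>: "bump a \<phi> \<phi>'"
        have a: "0 < a" "a \<le> 1" using elim by auto
        have wa: "1 / weight b x \<le> w" if "0 \<le> x" "x \<le> a" for x
          by (rule order.trans[OF abs_ge_self w]) (use that a in auto)
        obtain h where res: "resolvent_tail (weight b) m_inf s a (resolvent s \<phi>) h"
          and M0: "0 \<le> resolvent s \<phi> a" and h1: "- 1 / s \<le> h a / s"
          and h2: "h a / s \<le> (resolvent s \<phi> a + w * a) * (m_inf - tail a) - 1 / s"
          and gr: "\<bar>green s \<phi> - resolvent s \<phi> a\<bar> \<le> w * a"
          using bump_resolvent[OF \<phi> a(1) s(1) wa] by blast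
        define M where "M = resolvent s \<phi> a"
        note D = deficit[OF s a(2) res, folded \<tau>_def M_def]
        have "M * (tail a - (1 + \<delta>) * \<tau>) \<le> 1 / s"
        proof -
          have "M * (tail a - (1 + \<delta>) * \<tau>) = M * tail a - (1 + \<delta>) * \<tau> * M" by (simp add: algebra_simps)
          then show ?thesis using D h1 by linarith
        qed
        then have "s * (M * (tail a - (1 + \<delta>) * \<tau>)) \<le> s * (1 / s)" using s by (intro mult_left_mono) auto
        then have "s * M * (tail a - (1 + \<delta>) * \<tau>) \<le> 1" using s by simp
        then have up: "s * M \<le> 1 / (tail a - (1 + \<delta>) * \<tau>)" using elim by (subst pos_le_divide_eq) auto
        have "1 / s - w * a * (m_inf - tail a) \<le> M * (m_inf - (1 - \<delta>) * \<tau>)"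
        proof -
          have "M * (m_inf - (1 - \<delta>) * \<tau>) = M * tail a + (M + w * a) * (m_inf - tail a)
              - w * a * (m_inf - tail a) - (1 - \<delta>) * \<tau> * M" by (simp add: algebra_simps)
          then show ?thesis using D h2 unfolding M_def[symmetric] by linarith
        qed
        then have "s * (1 / s - w * a * (m_inf - tail a)) \<le> s * (M * (m_inf - (1 - \<delta>) * \<tau>))"
          using s by (intro mult_left_mono) auto
        moreover have "s * (1 / s - w * a * (m_inf - tail a)) = 1 - s * w * a * (m_inf - tail a)"
          using s by (simp add: algebra_simps)
        ultimately have "1 - s * w * a * (m_inf - tail a) \<le> s * M * (m_inf - (1 - \<delta>) * \<tau>)" by simp
        then have lo: "(1 - s * w * a * (m_inf - tail a)) / (m_inf - (1 - \<delta>) * \<tau>) \<le> s * M"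
          using c by (subst pos_divide_le_eq) auto
        have "\<bar>s * green s \<phi> - s * M\<bar> = s * \<bar>green s \<phi> - M\<bar>"
          unfolding right_diff_distrib[symmetric] abs_mult using s by simp
        also have "\<dots> \<le> s * (w * a)" using gr s unfolding M_def by (intro mult_left_mono) auto
        finally have "\<bar>s * green s \<phi> - s * M\<bar> \<le> s * w * a" by (simp only: mult.assoc)
        then show "1 / (m_inf - (1 - 2 * \<delta>) * tail (1 / sqrt s)) \<le> s * green s \<phi> \<and>
            s * green s \<phi> \<le> 1 / (m_inf - (1 + 2 * \<delta>) * tail (1 / sqrt s))"
          unfolding \<tau>_def[symmetric] using up lo elim by linarith
      qed
    qed
  qed
qed

text \<open>The normalisation is explained by \<open>(1 / (m_inf - c * \<tau>) - 1 / m_inf) *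
  (m_inf^2 / \<tau>) = c * m_inf / (m_inf - c * \<tau>)\<close>, which tends to \<open>c\<close> as
  \<open>\<tau>\<close> tends to 0; here \<open>c\<close> is \<open>1 + 2 * \<delta>\<close> or
  \<open>1 - 2 * \<delta>\<close>.\<close>

lemma green_asymptotics:
  assumes e: "e > 0"
  shows "\<forall>\<^sub>F s in at_right 0. \<forall>\<^sub>F a in at_right 0. \<forall>\<phi> \<phi>'. bump a \<phi> \<phi>' \<longrightarrow>
    \<bar>(s * green s \<phi> - 1 / m_inf) * (m_inf\<^sup>2 / tail (1 / sqrt s)) - 1\<bar> \<le> e"
proof -
  define \<delta> where "\<delta> = min (1 / 4) (e / 4)"
  have \<delta>: "0 < \<delta>" "\<delta> \<le> 1 / 4" "\<delta> \<le> e / 4" using e by (auto simp: \<delta>_def)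
  note m0 = m_inf_pos
  have lim: "((\<lambda>s. c * m_inf / (m_inf - c * tail (1 / sqrt s))) \<longlongrightarrow> c) (at_right 0)" for c
  proof -
    have "((\<lambda>s. c * m_inf / (m_inf - c * tail (1 / sqrt s))) \<longlongrightarrow> c * m_inf / (m_inf - c * 0)) (at_right 0)"
      using m0 by (intro tendsto_intros tail_sqrt_tendsto) auto
    then show ?thesis using m0 by simp
  qed
  have "\<forall>\<^sub>F s in at_right 0. (1 + 2 * \<delta>) * m_inf / (m_inf - (1 + 2 * \<delta>) * tail (1 / sqrt s)) < 1 + e"
    by (rule order_tendstoD[OF lim]) (use \<delta> e in linarith)
  moreover have "\<forall>\<^sub>F s in at_right 0. 1 - e < (1 - 2 * \<delta>) * m_inf / (m_inf - (1 - 2 * \<delta>) * tail (1 / sqrt s))"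
    by (rule order_tendstoD[OF lim]) (use \<delta> e in linarith)
  moreover have "\<forall>\<^sub>F s in at_right 0. tail (1 / sqrt s) < m_inf / 2"
    by (rule order_tendstoD[OF tail_sqrt_tendsto]) (use m0 in simp)
  moreover have "\<forall>\<^sub>F s in at_right 0. (0::real) < s"
    by (rule eventually_at_right_less)
  ultimately show ?thesis
    using green_bounds[OF \<delta>(1,2)]
  proof eventually_elim
    case (elim s)
    define \<tau> where "\<tau> = tail (1 / sqrt s)"
    have \<tau>: "\<tau> > 0" "\<tau> < m_inf / 2" using elim tail_pos by (auto simp: \<tau>_def)
    have conv: "(1 / (m_inf - c * \<tau>) - 1 / m_inf) * (m_inf\<^sup>2 / \<tau>) = c * m_inf / (m_inf - c * \<tau>)" if "c \<le> 3 / 2" for c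
    proof -
      have "c * \<tau> \<le> 3 / 2 * \<tau>" using that \<tau> by (intro mult_right_mono) auto
      then have "m_inf - c * \<tau> > 0" using \<tau> by linarith
      then have "1 / (m_inf - c * \<tau>) - 1 / m_inf = c * \<tau> / ((m_inf - c * \<tau>) * m_inf)"
        using m0 by (simp add: field_simps)
      then show ?thesis using m0 \<tau> by (simp add: power2_eq_square)
    qed
    have pos: "m_inf\<^sup>2 / \<tau> \<ge> 0" using \<tau> by simp
    show ?case
      using elim(5)
    proof eventually_elim
      case (elim a)
      show ?case
      proof (intro allI impI)
        fix \<phi> \<phi>' assume "bump a \<phi> \<phi>'"
        then have b: "1 / (m_inf - (1 - 2 * \<delta>) * \<tau>) \<le> s * green s \<phi>" "s * green s \<phi> \<le> 1 / (m_inf - (1 + 2 * \<delta>) * \<tau>)"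
          using elim unfolding \<tau>_def by blast+
        have "(s * green s \<phi> - 1 / m_inf) * (m_inf\<^sup>2 / \<tau>) \<le> (1 / (m_inf - (1 + 2 * \<delta>) * \<tau>) - 1 / m_inf) * (m_inf\<^sup>2 / \<tau>)"
          by (intro mult_right_mono diff_right_mono b pos)
        also have "\<dots> = (1 + 2 * \<delta>) * m_inf / (m_inf - (1 + 2 * \<delta>) * \<tau>)" by (rule conv) (use \<delta> in linarith)
        also have "\<dots> < 1 + e" using \<open>(1 + 2 * \<delta>) * m_inf / _ < 1 + e\<close> unfolding \<tau>_def .
        finally have 1: "(s * green s \<phi> - 1 / m_inf) * (m_inf\<^sup>2 / \<tau>) < 1 + e" .
        have "1 - e < (1 - 2 * \<delta>) * m_inf / (m_inf - (1 - 2 * \<delta>) * \<tau>)"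
          using \<open>1 - e < _\<close> unfolding \<tau>_def .
        also have "\<dots> = (1 / (m_inf - (1 - 2 * \<delta>) * \<tau>) - 1 / m_inf) * (m_inf\<^sup>2 / \<tau>)"
          by (rule conv[symmetric]) (use \<delta> in linarith)
        also have "\<dots> \<le> (s * green s \<phi> - 1 / m_inf) * (m_inf\<^sup>2 / \<tau>)"
          by (intro mult_right_mono diff_right_mono b pos)
        finally show "\<bar>(s * green s \<phi> - 1 / m_inf) * (m_inf\<^sup>2 / tail (1 / sqrt s)) - 1\<bar> \<le> e"
          using 1 unfolding \<tau>_def[symmetric] by linarith
      qed
    qed
  qed
qed

text \<open>Apply \<open>green_asymptotics\<close> at \<open>(k + 1) * s\<close> and divide by
  \<open>k + 1\<close>; replacing \<open>tail (1 / sqrt ((k + 1) * s))\<close> by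
  \<open>tail (1 / sqrt s)\<close> costs a ratio that tends to 1 by slow variation. This is where
  the transform \<open>1 / (k + 1)\<close> of the constant 1 arises.\<close>

lemma green_scaled_asymptotics:
  assumes e: "e > 0"
  shows "\<forall>\<^sub>F s in at_right 0. \<forall>\<^sub>F a in at_right 0. \<forall>\<phi> \<phi>'. bump a \<phi> \<phi>' \<longrightarrow>
    \<bar>(s * green ((real k + 1) * s) \<phi> - 1 / m_inf * (1 / (real k + 1))) * (m_inf\<^sup>2 / tail (1 / sqrt s)) - 1 / (real k + 1)\<bar> \<le> e"
proof -
  define K where "K = real k + 1"
  have K: "K \<ge> 1" by (simp add: K_def)
  define d where "d = min 1 (e / 3)"
  have d: "d > 0" "d \<le> 1" "d \<le> e / 3" using e by (auto simp: d_def)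
  have "filterlim (\<lambda>s. K * s) (at_right 0) (at_right 0)"
    unfolding filterlim_at
  proof
    show "((\<lambda>s. K * s) \<longlongrightarrow> 0) (at_right 0)" by (rule tendsto_mult_right_zero[OF tendsto_ident_at])
    show "\<forall>\<^sub>F s in at_right 0. K * s \<in> {0<..} \<and> K * s \<noteq> 0"
      unfolding eventually_at_right_field using K by (auto intro: exI[of _ 1])
  qed
  from eventually_compose_filterlim[OF green_asymptotics[OF d(1)] this]
  have 1: "\<forall>\<^sub>F s in at_right 0. \<forall>\<^sub>F a in at_right 0. \<forall>\<phi> \<phi>'. bump a \<phi> \<phi>' \<longrightarrow>
    \<bar>(K * s * green (K * s) \<phi> - 1 / m_inf) * (m_inf\<^sup>2 / tail (1 / sqrt (K * s))) - 1\<bar> \<le> d" .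
  have "((\<lambda>s. tail (1 / sqrt K * (1 / sqrt s)) / tail (1 / sqrt s)) \<longlongrightarrow> 1) (at_right 0)"
    by (rule filterlim_compose[OF tail_slow_variation filterlim_inverse_sqrt_at_right]) (use K in simp)
  from tendstoD[OF this d(1)]
  have 2: "\<forall>\<^sub>F s in at_right 0. \<bar>tail (1 / sqrt (K * s)) / tail (1 / sqrt s) - 1\<bar> < d"
    by (simp add: dist_real_def real_sqrt_mult)
  have 3: "\<forall>\<^sub>F s in at_right 0. (0::real) < s"
    by (rule eventually_at_right_less)
  show ?thesis
    using 1 2 3
  proof eventually_elim
    case (elim s)
    define \<rho> where "\<rho> = tail (1 / sqrt (K * s)) / tail (1 / sqrt s)"
    have t: "tail (1 / sqrt (K * s)) > 0" "tail (1 / sqrt s) > 0" using elim K by (auto intro!: tail_pos)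
    have \<rho>: "\<bar>\<rho> - 1\<bar> \<le> d" "\<rho> \<le> 2" "\<rho> > 0" using elim d t unfolding \<rho>_def by (auto simp: abs_less_iff)
    show ?case
      using elim(1)
    proof eventually_elim
      case (elim a)
      show ?case
      proof (intro allI impI)
        fix \<phi> \<phi>' assume "bump a \<phi> \<phi>'"
        define Y where "Y = (K * s * green (K * s) \<phi> - 1 / m_inf) * (m_inf\<^sup>2 / tail (1 / sqrt (K * s)))"
        have Y: "\<bar>Y - 1\<bar> \<le> d" using elim \<open>bump a \<phi> \<phi>'\<close> unfolding Y_def by blast
        have alg: "(s * G - 1 / m_inf * (1 / K)) * (m_inf\<^sup>2 / t2) = ((K * s * G - 1 / m_inf) * (m_inf\<^sup>2 / t1)) * (t1 / t2) / K"
          if "t1 > 0" "t2 > 0" for G t1 t2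
          using that K by (simp add: field_simps)
        have "(s * green (K * s) \<phi> - 1 / m_inf * (1 / K)) * (m_inf\<^sup>2 / tail (1 / sqrt s)) = Y * \<rho> / K"
          unfolding Y_def \<rho>_def by (rule alg[OF t])
        then have "(s * green (K * s) \<phi> - 1 / m_inf * (1 / K)) * (m_inf\<^sup>2 / tail (1 / sqrt s)) - 1 / K
            = ((Y - 1) * \<rho> + (\<rho> - 1)) / K"
          by (simp add: algebra_simps diff_divide_distrib)
        also have "\<bar>\<dots>\<bar> \<le> \<bar>(Y - 1) * \<rho> + (\<rho> - 1)\<bar>"
          using K by (simp add: abs_divide divide_le_eq mult_le_cancel_left1)
        also have "\<dots> \<le> \<bar>Y - 1\<bar> * \<bar>\<rho>\<bar> + \<bar>\<rho> - 1\<bar>"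
          by (rule order.trans[OF abs_triangle_ineq]) (simp add: abs_mult)
        also have "\<dots> \<le> d * 2 + d"
          by (intro add_mono mult_mono Y) (use \<rho> d in auto)
        also have "\<dots> \<le> e" using d by linarith
        finally show "\<bar>(s * green ((real k + 1) * s) \<phi> - 1 / m_inf * (1 / (real k + 1))) * (m_inf\<^sup>2 / tail (1 / sqrt s)) - 1 / (real k + 1)\<bar> \<le> e"
          unfolding K_def .
      qed
    qed
  qed
qed

section \<open>Transfer from the Laplace transform to the density\<close>

lemma autocorr_laplace_close:
  assumes \<phi>: "bump a \<phi> \<phi>'" and s: "s > 0" and c: "c > 0"
    and close: "\<And>k. k \<le> N \<Longrightarrow>
      \<bar>(s * green ((real k + 1) * s) \<phi> - 1 / m_inf * (1 / (real k + 1))) * c - 1 / (real k + 1)\<bar> \<le> \<delta>"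
  shows "laplace_close N \<delta> (\<lambda>u. (autocorr \<phi> (max 0 u / s) - 1 / m_inf) * c)"
proof -
  have gen: "generator P X \<phi> \<phi>'" and \<phi>1: "(\<integral>x. \<phi> x \<partial>speed) = 1" using \<phi> by (auto simp: bump_def)
  define q where "q u = autocorr \<phi> (max 0 u / s)" for u
  have low: "1 / m_inf \<le> q u" for u
    unfolding q_def using autocorr_lower[OF gen, of "max 0 u / s"] \<phi>1 s by simp
  have mono: "q v \<le> q u" if "u \<le> v" for u v
    unfolding q_def by (rule autocorr_antimono[OF gen]) (use that s in \<open>auto intro: divide_right_mono\<close>)
  have "(\<lambda>u. u / s) ` {0..} \<subseteq> {0..}" using s by auto
  then have "continuous_on {0..} (\<lambda>u. autocorr \<phi> (u / s))"
    by (rule continuous_on_compose2[OF autocorr_continuous[OF gen], rotated]) (use s in \<open>auto intro!: continuous_intros\<close>)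
  then have mq[measurable]: "q \<in> borel_measurable borel"
    unfolding q_def by (rule borel_measurable_max_half_line)
  have ie: "integrable exp_law (\<lambda>u. exp (- (real k * u)))" for k
    by (rule integrable_exp_law[where B=1]) auto
  have iq: "integrable exp_law (\<lambda>u. exp (- (real k * u)) * q u)" for k
  proof (rule integrable_exp_law_mult[where B=1 and C="q 0"])
    have "0 < 1 / m_inf" using m_inf_pos by simp
    then show "0 \<le> q u \<and> q u \<le> q 0" if "u \<ge> 0" for u using low[of u] mono[OF that] by linarith
  qed auto
  have lap: "(\<integral>u. exp (- (real k * u)) * ((q u - 1 / m_inf) * c) \<partial>exp_law)
      = (s * green ((real k + 1) * s) \<phi> - 1 / m_inf * (1 / (real k + 1))) * c" for k
  proof -
    have "(\<integral>u. exp (- (real k * u)) * (q u / s) \<partial>exp_law) = green ((real k + 1) * s) \<phi>"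
      unfolding q_def by (rule autocorr_laplace[OF gen s])
    moreover have "(\<integral>u. exp (- (real k * u)) * (q u / s) \<partial>exp_law) = (\<integral>u. exp (- (real k * u)) * q u \<partial>exp_law) / s"
      by simp
    ultimately have 1: "(\<integral>u. exp (- (real k * u)) * q u \<partial>exp_law) = s * green ((real k + 1) * s) \<phi>"
      using s by (simp add: field_simps)
    have "(\<integral>u. exp (- (real k * u)) * ((q u - 1 / m_inf) * c) \<partial>exp_law)
        = (\<integral>u. (exp (- (real k * u)) * q u - 1 / m_inf * exp (- (real k * u))) * c \<partial>exp_law)"
      by (rule Bochner_Integration.integral_cong) (simp_all add: algebra_simps)
    also have "\<dots> = ((\<integral>u. exp (- (real k * u)) * q u \<partial>exp_law) - 1 / m_inf * (\<integral>u. exp (- (real k * u)) \<partial>exp_law)) * c"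
      using ie[of k] iq[of k] by simp
    finally show ?thesis unfolding 1 exp_law_moment .
  qed
  have "(\<lambda>u. (q u - 1 / m_inf) * c) \<in> borel_measurable borel" by measurable
  moreover have "0 \<le> (q u - 1 / m_inf) * c" for u using low[of u] c by simp
  moreover have "(q v - 1 / m_inf) * c \<le> (q u - 1 / m_inf) * c" if "u \<le> v" for u v
    using mono[OF that] c by simp
  ultimately show ?thesis
    unfolding laplace_close_def q_def[symmetric] lap using close by blast
qed

text \<open>For a fixed small \<open>s\<close> only \<open>N + 1\<close> conditions on the transform
  have to hold, so one width \<open>a\<close> serves all of them and also brings
  \<open>autocorr \<phi> (1 / s)\<close> close to \<open>p (1 / s) 0 0\<close>. The Tauberian
  estimate is read off at \<open>u = 1\<close>, that is, at time \<open>1 / s\<close>.\<close>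

lemma density_asymptotics:
  "((\<lambda>t. (p t 0 0 - 1 / m_inf) * (m_inf\<^sup>2 / tail (sqrt t))) \<longlongrightarrow> 1) at_top"
proof (rule tendstoI)
  fix e :: real assume e: "e > 0"
  then have e3: "e / 3 > 0" by simp
  obtain \<delta> N where \<delta>: "\<delta> > 0" and taub: "\<And>r. laplace_close N \<delta> r \<Longrightarrow> \<bar>r 1 - 1\<bar> \<le> e / 3"
    using finite_tauberian[OF e3] by blast
  have "\<forall>\<^sub>F s in at_right 0. \<forall>k\<in>{..N}. \<forall>\<^sub>F a in at_right 0. \<forall>\<phi> \<phi>'. bump a \<phi> \<phi>' \<longrightarrow>
      \<bar>(s * green ((real k + 1) * s) \<phi> - 1 / m_inf * (1 / (real k + 1))) * (m_inf\<^sup>2 / tail (1 / sqrt s)) - 1 / (real k + 1)\<bar> \<le> \<delta>"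
    by (intro eventually_ball_finite ballI green_scaled_asymptotics \<delta>) simp
  moreover have "\<forall>\<^sub>F s in at_right 0. (0::real) < s" by (rule eventually_at_right_less)
  ultimately have "\<forall>\<^sub>F s in at_right 0. \<bar>(p (1 / s) 0 0 - 1 / m_inf) * (m_inf\<^sup>2 / tail (1 / sqrt s)) - 1\<bar> < e"
  proof eventually_elim
    case (elim s)
    define c where "c = m_inf\<^sup>2 / tail (1 / sqrt s)"
    have c: "c > 0" using m_inf_pos tail_pos[of "1 / sqrt s"] elim by (simp add: c_def)
    have "\<forall>\<^sub>F a in at_right 0. \<forall>k\<in>{..N}. \<forall>\<phi> \<phi>'. bump a \<phi> \<phi>' \<longrightarrow>
        \<bar>(s * green ((real k + 1) * s) \<phi> - 1 / m_inf * (1 / (real k + 1))) * c - 1 / (real k + 1)\<bar> \<le> \<delta>"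
      unfolding c_def using elim(1) by (intro eventually_ball_finite) auto
    \<comment> \<open>The tolerance compensates the later multiplication by \<open>c\<close>, which
      is fixed here although it grows without bound as \<open>s\<close> tends to 0.\<close>
    moreover have "\<forall>\<^sub>F a in at_right 0. \<forall>\<phi> \<phi>'. bump a \<phi> \<phi>' \<longrightarrow> \<bar>autocorr \<phi> (1 / s) - p (1 / s) 0 0\<bar> \<le> e / (3 * c)"
      by (rule autocorr_bump_approx) (use elim e c in auto)
    moreover have "\<forall>\<^sub>F a in at_right 0. (0::real) < a" by (rule eventually_at_right_less)
    ultimately have "\<forall>\<^sub>F a in at_right (0::real). \<bar>(p (1 / s) 0 0 - 1 / m_inf) * c - 1\<bar> < e"
    proof eventually_elim
      case (elim a)
      obtain \<phi> \<phi>' where \<phi>: "bump a \<phi> \<phi>'" using bump_exists[OF elim(3)] by blast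
      have "laplace_close N \<delta> (\<lambda>u. (autocorr \<phi> (max 0 u / s) - 1 / m_inf) * c)"
        by (rule autocorr_laplace_close[OF \<phi> \<open>0 < s\<close> c]) (use elim \<phi> in auto)
      from taub[OF this] have 1: "\<bar>(autocorr \<phi> (1 / s) - 1 / m_inf) * c - 1\<bar> \<le> e / 3" by simp
      have "\<bar>(p (1 / s) 0 0 - autocorr \<phi> (1 / s)) * c\<bar> \<le> e / (3 * c) * c"
        unfolding abs_mult using elim \<phi> c by (intro mult_mono) (auto simp: abs_minus_commute)
      also have "\<dots> = e / 3" using c by simp
      finally have 2: "\<bar>(p (1 / s) 0 0 - autocorr \<phi> (1 / s)) * c\<bar> \<le> e / 3" .
      have "(P - m) * c - 1 = (P - A) * c + ((A - m) * c - 1)" for P A m by (simp add: algebra_simps)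
      then have "(p (1 / s) 0 0 - 1 / m_inf) * c - 1 =
          (p (1 / s) 0 0 - autocorr \<phi> (1 / s)) * c + ((autocorr \<phi> (1 / s) - 1 / m_inf) * c - 1)" .
      then show ?case using 1 2 e by linarith
    qed
    \<comment> \<open>The inequality no longer mentions \<open>a\<close>, and there are widths
      arbitrarily close to 0.\<close>
    then show ?case unfolding c_def using eventually_const[OF trivial_limit_at_right_real[of "0::real"]] by blast
  qed
  from eventually_compose_filterlim[OF this filterlim_inverse_at_right_top]
  have "\<forall>\<^sub>F t in at_top. \<bar>(p (1 / inverse t) 0 0 - 1 / m_inf) * (m_inf\<^sup>2 / tail (1 / sqrt (inverse t))) - 1\<bar> < e" .
  then show "\<forall>\<^sub>F t in at_top. dist ((p t 0 0 - 1 / m_inf) * (m_inf\<^sup>2 / tail (sqrt t))) 1 < e"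
    by (simp add: dist_real_def real_sqrt_divide inverse_eq_divide)
qed

end

theorem theorem1p4:
  fixes b \<epsilon> \<eta> :: "real \<Rightarrow> real" and A m_inf :: real
    and \<Omega> :: "'w measure" and P :: "real \<Rightarrow> 'w measure" and X :: "real \<Rightarrow> 'w \<Rightarrow> real"
    and p :: "real \<Rightarrow> real \<Rightarrow> real \<Rightarrow> real"
  assumes "loc_integrable b"
    and "\<And>x. x \<ge> 1 \<Longrightarrow> b x = (-1 + \<epsilon> x) / x + \<eta> x"
    and "(\<epsilon> \<longlongrightarrow> 0) at_top"
    and "loc_integrable \<eta>"
    and "((\<lambda>x::real. LINT u=1..x|lebesgue. \<eta> u) \<longlongrightarrow> A) at_top"
    and "reflecting_diffusion b \<Omega> P X"
    and "transition_density b P X p"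
    and "(speed_fun b \<longlongrightarrow> m_inf) at_top"
  shows "(\<lambda>t. p t 0 0 - 1 / m_inf) \<sim>[at_top]
         (\<lambda>t. 1 / m_inf\<^sup>2 * (m_inf - speed_fun b (sqrt t)))"
proof -
  interpret reflecting_diffusion b \<Omega> P X by (rule assms)
  interpret diffusion_density b \<Omega> P X p m_inf by unfold_locales (rule assms)+
  interpret regular_diffusion_density b \<Omega> P X p m_inf
    by unfold_locales (rule weight_regular[OF assms(1,4,2,3,5)])
  show ?thesis
  proof (rule asymp_equivI')
    show "((\<lambda>t. (p t 0 0 - 1 / m_inf) / (1 / m_inf\<^sup>2 * (m_inf - speed_fun b (sqrt t)))) \<longlongrightarrow> 1) at_top"
    proof (rule Lim_transform_eventually[OF density_asymptotics], rule eventually_at_top_linorderI[of 0])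
      fix t :: real assume "0 \<le> t"
      then have "tail (sqrt t) = m_inf - speed_fun b (sqrt t)" by (simp add: tail_eq)
      then show "(p t 0 0 - 1 / m_inf) * (m_inf\<^sup>2 / tail (sqrt t)) =
          (p t 0 0 - 1 / m_inf) / (1 / m_inf\<^sup>2 * (m_inf - speed_fun b (sqrt t)))"
        by simp
    qed
  qed
qed

end
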